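(* Let $X$ be a complete metric space and suppose there exists $L>0$ such that $\mathcal{H}^2(B(x,r))\le L\cdot r^2$ for all $x\in X$ and $r>0$. Let $u\colon\overline{D}\to X$ be continuous, monotone and non-constant. If $u|_D\in N^{1,2}(D,X)$ and $u$ is infinitesimally $Q$-quasiconformal for some $Q\ge1$, then $u$ is a homeomorphism onto its image.
   Context: $D$, $\overline{D}$ are the open and closed unit discs in $\mathbb{R}^2$. $\mathcal{H}^2$ is Hausdorff $2$-measure normalized as Lebesgue measure on $\mathbb{R}^2$. A continuous map is monotone if all its fibers are connected. $N^{1,2}(D,X)$ is the Newton–Sobolev space (maps with $d(u(\cdot),x)\in L^2$ having a weak upper gradient in $L^2$, i.e. a Borel $g$ with $d(u(\gamma(a)),u(\gamma(b)))\le\int_\gamma g$ for all rectifiable curves outside a family of $2$-modulus zero); $g_u$ is the minimal weak upper gradient. $\operatorname{ap}\operatorname{md}u_z$ is the approximate metric derivative (a seminorm on $\mathbb{R}^2$, existing a.e.), and $\mathbf{J}(s)$ is the $\mathcal{H}^2$-measure with respect to $s$ of the unit square if $s$ is a norm and $0$ otherwise. $u$ is infinitesimally $Q$-quasiconformal if $g_u(z)^2\le Q\cdot\mathbf{J}(\operatorname{ap}\operatorname{md}u_z)$ for a.e. $z\in D$. *)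

theory Defs
  imports "HOL-Analysis.Analysis"
begin

text \<open>The plane R^2 is modelled by the type complex (Lebesgue measure lborel on complex
  is the Lebesgue measure of R^2).\<close>

definition dist_diam :: "('a \<Rightarrow> 'a \<Rightarrow> real) \<Rightarrow> 'a set \<Rightarrow> ennreal" where
  "dist_diam d C = (SUP x\<in>C. SUP y\<in>C. ennreal (d x y))"

text \<open>Normalization pi/4 so that H^2 agrees with Lebesgue measure on Euclidean R^2.\<close>
definition hausdorff2_pre :: "('a \<Rightarrow> 'a \<Rightarrow> real) \<Rightarrow> real \<Rightarrow> 'a set \<Rightarrow> ennreal" where
  "hausdorff2_pre d \<delta> A =
     (INF C \<in> {C :: nat \<Rightarrow> 'a set. A \<subseteq> (\<Union>i. C i) \<and> (\<forall>i. dist_diam d (C i) < ennreal \<delta>)}.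
        (\<Sum>i. ennreal (pi / 4) * dist_diam d (C i) ^ 2))"

definition hausdorff2 :: "('a \<Rightarrow> 'a \<Rightarrow> real) \<Rightarrow> 'a set \<Rightarrow> ennreal" where
  "hausdorff2 d A = (SUP \<delta>\<in>{0<..}. hausdorff2_pre d \<delta> A)"

definition curve_length :: "(real \<Rightarrow> 'a::metric_space) \<Rightarrow> real \<Rightarrow> real \<Rightarrow> ennreal" where
  "curve_length \<gamma> a b =
     (SUP ts \<in> {ts :: real list. sorted ts \<and> set ts \<subseteq> {a..b}}.
        ennreal (\<Sum>i<length ts - 1. dist (\<gamma> (ts ! (Suc i))) (\<gamma> (ts ! i))))"

text \<open>Rectifiable curves in S, represented by their arc-length parametrisations
  gamma : [0, l] -> S (every rectifiable curve has one, and all notions below are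
  invariant under reparametrisation).\<close>
definition arclength_curve_in :: "complex set \<Rightarrow> (real \<Rightarrow> complex) \<Rightarrow> real \<Rightarrow> bool" where
  "arclength_curve_in S \<gamma> l \<longleftrightarrow> 0 \<le> l \<and> \<gamma> ` {0..l} \<subseteq> S \<and>
     (\<forall>s t. 0 \<le> s \<and> s \<le> t \<and> t \<le> l \<longrightarrow> curve_length \<gamma> s t = ennreal (t - s))"

definition line_integral :: "(complex \<Rightarrow> ennreal) \<Rightarrow> (real \<Rightarrow> complex) \<Rightarrow> real \<Rightarrow> ennreal" where
  "line_integral \<rho> \<gamma> l = (\<integral>\<^sup>+ t\<in>{0..l}. \<rho> (\<gamma> t) \<partial>lborel)"

definition modulus2 :: "((real \<Rightarrow> complex) \<times> real) set \<Rightarrow> ennreal" where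
  "modulus2 \<Gamma> =
     (INF \<rho> \<in> {\<rho> :: complex \<Rightarrow> ennreal. \<rho> \<in> borel_measurable borel \<and>
                 (\<forall>(\<gamma>, l)\<in>\<Gamma>. 1 \<le> line_integral \<rho> \<gamma> l)}.
        \<integral>\<^sup>+ z. \<rho> z ^ 2 \<partial>lborel)"

definition weak_upper_gradient :: "complex set \<Rightarrow> (complex \<Rightarrow> 'a::metric_space) \<Rightarrow> (complex \<Rightarrow> ennreal) \<Rightarrow> bool" where
  "weak_upper_gradient S u g \<longleftrightarrow> g \<in> borel_measurable borel \<and>
     (\<exists>\<Gamma>. modulus2 \<Gamma> = 0 \<and>
        (\<forall>\<gamma> l. arclength_curve_in S \<gamma> l \<and> (\<gamma>, l) \<notin> \<Gamma> \<longrightarrow>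
            ennreal (dist (u (\<gamma> 0)) (u (\<gamma> l))) \<le> line_integral g \<gamma> l))"

definition L2_on :: "complex set \<Rightarrow> (complex \<Rightarrow> ennreal) \<Rightarrow> bool" where
  "L2_on S g \<longleftrightarrow> (\<integral>\<^sup>+ z\<in>S. g z ^ 2 \<partial>lborel) < \<infinity>"

definition newton_sobolev_12 :: "complex set \<Rightarrow> (complex \<Rightarrow> 'a::metric_space) \<Rightarrow> bool" where
  "newton_sobolev_12 S u \<longleftrightarrow>
     (\<exists>x. set_borel_measurable lborel S (\<lambda>z. dist (u z) x) \<and>
          (\<integral>\<^sup>+ z\<in>S. ennreal (dist (u z) x) ^ 2 \<partial>lborel) < \<infinity>) \<and>
     (\<exists>g. weak_upper_gradient S u g \<and> L2_on S g)"

definition minimal_weak_upper_gradient :: "complex set \<Rightarrow> (complex \<Rightarrow> 'a::metric_space) \<Rightarrow> (complex \<Rightarrow> ennreal) \<Rightarrow> bool" where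
  "minimal_weak_upper_gradient S u g \<longleftrightarrow> weak_upper_gradient S u g \<and> L2_on S g \<and>
     (\<forall>h. weak_upper_gradient S u h \<and> L2_on S h \<longrightarrow> (AE z in lborel. z \<in> S \<longrightarrow> g z \<le> h z))"

definition seminorm_on_plane :: "(complex \<Rightarrow> real) \<Rightarrow> bool" where
  "seminorm_on_plane s \<longleftrightarrow> (\<forall>x. 0 \<le> s x) \<and> (\<forall>x y. s (x + y) \<le> s x + s y) \<and>
     (\<forall>c::real. \<forall>x. s (of_real c * x) = \<bar>c\<bar> * s x)"

definition norm_on_plane :: "(complex \<Rightarrow> real) \<Rightarrow> bool" where
  "norm_on_plane s \<longleftrightarrow> seminorm_on_plane s \<and> (\<forall>x. s x = 0 \<longrightarrow> x = 0)"

text \<open>s is the approximate metric derivative of u at z: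
  ap lim_{y->z} (d(u y, u z) - s(y - z)) / |y - z| = 0, i.e. for each eps > 0 the set where
  the quotient exceeds eps has Lebesgue density 0 at z.\<close>
definition ap_md :: "complex set \<Rightarrow> (complex \<Rightarrow> 'a::metric_space) \<Rightarrow> complex \<Rightarrow> (complex \<Rightarrow> real) \<Rightarrow> bool" where
  "ap_md S u z s \<longleftrightarrow> seminorm_on_plane s \<and>
     (\<forall>\<epsilon>>0. ((\<lambda>r. measure lebesgue
                   {y \<in> S \<inter> ball z r. \<bar>dist (u y) (u z) - s (y - z)\<bar> > \<epsilon> * norm (y - z)}
                 / measure lebesgue (ball z r)) \<longlongrightarrow> 0) (at_right 0))"

definition jacobian_J :: "(complex \<Rightarrow> real) \<Rightarrow> ennreal" where
  "jacobian_J s = (if norm_on_plane s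
      then hausdorff2 (\<lambda>x y. s (x - y)) {x. 0 \<le> Re x \<and> Re x \<le> 1 \<and> 0 \<le> Im x \<and> Im x \<le> 1}
      else 0)"

definition infinitesimally_qc :: "real \<Rightarrow> complex set \<Rightarrow> (complex \<Rightarrow> 'a::metric_space) \<Rightarrow> bool" where
  "infinitesimally_qc Q S u \<longleftrightarrow>
     (\<exists>g. minimal_weak_upper_gradient S u g \<and>
        (AE z in lborel. z \<in> S \<longrightarrow>
           (\<forall>s. ap_md S u z s \<longrightarrow> g z ^ 2 \<le> ennreal Q * jacobian_J s)))"

end

theory Submission
  imports Defs
begin

text \<open>The weak upper gradient \<open>g\<close> of \<open>u\<close> controls \<open>u\<close> along almost every line of each fixed direction. On such
  lines the functions \<open>dist (u z) (u q)\<close> are absolutely continuous, hence differentiable almost everywhere;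
  the supremum over \<open>q\<close> of their differentials is an approximate metric derivative of \<open>u\<close>, so
  quasiconformality applies and says that almost everywhere this seminorm is comparable to \<open>g z\<close> times the
  Euclidean norm. Where \<open>g z > 0\<close> this forces the fibre through \<open>z\<close>, which is connected, to be a point. Hence
  \<open>u\<close> is injective on almost all of \<open>{g > 0}\<close> and expands at rate \<open>g\<close> on countably many pieces, and covering
  arguments give \<open>\<integral> g\<^sup>2 \<le> C r\<^sup>2\<close> over the preimage of any ball of radius \<open>r\<close>.

  By this bound the weight \<open>g / (d log (1 / d))\<close> with \<open>d = dist (u z) x\<close> is integrable over the disc, whereas its
  integral along every line segment leaving the fibre of \<open>x\<close> diverges. Thus almost every chord that
  meets this fibre lies in it. If the fibre is nondegenerate, it therefore contains a strip, and then the whole disc.\<close>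

section \<open>The plane in sheared coordinates\<close>

text \<open>An upper gradient says nothing on a curve family of modulus zero, so estimates are
  available only on almost every line of a prescribed direction. Countably many directions, the
  vertical one and the rational slopes, therefore have to carry the differential, and short vertical
  segments bridge the gaps between slopes. In a metric target the only derivatives at hand are those
  of distance functions, and these have to be shown to fit together linearly. The energy bound rests
  on lower distance estimates: where \<open>U\<close> expands, covers of the image pull back to
  covers of the preimage by balls of controlled radius. The logarithm reflects the critical exponent
  2. On the dyadic shell where d is about 2^-k the energy is of order 4^-k. Multiplying g by 2^k /
  (k+1) leaves energies of order 1/(k+1)^2, which are summable, while a line that crosses the shell
  still pays 1/(2(k+1)), and the harmonic series diverges. With the factor 2^k alone each shell
  would be allowed an energy of order 1 and nothing would converge.\<close>

lemma measurable_Complex_pair [measurable]: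
  "(\<lambda>(x, y). Complex x y) \<in> borel_measurable (lborel \<Otimes>\<^sub>M lborel)"
proof -
  have "(\<lambda>p::real \<times> real. Complex (fst p) (snd p)) \<in> borel_measurable borel"
    by (intro borel_measurable_continuous_onI continuous_intros)
  then show ?thesis
    by (simp add: lborel_prod case_prod_beta)
qed

lemma lborel_complex_pair:
  "(lborel :: complex measure) = distr (lborel \<Otimes>\<^sub>M lborel) borel (\<lambda>(x, y). Complex x y)"
proof (rule lborel_eqI)
  note m = measurable_Complex_pair
  fix l u :: complex
  assume le: "\<And>b. b \<in> Basis \<Longrightarrow> l \<bullet> b \<le> u \<bullet> b"
  have "Re l \<le> Re u" "Im l \<le> Im u"
    using le[of 1] le[of \<i>] by (auto simp: Basis_complex_def inner_complex_def)
  moreover have "(\<lambda>(x, y). Complex x y) -` box l u \<inter> space (lborel \<Otimes>\<^sub>M lborel)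
      = {Re l<..<Re u} \<times> {Im l<..<Im u}"
    by (auto simp: box_def Basis_complex_def inner_complex_def space_pair_measure)
  ultimately show "emeasure (distr (lborel \<Otimes>\<^sub>M lborel) borel (\<lambda>(x, y). Complex x y)) (box l u)
      = ennreal (\<Prod>b\<in>Basis. (u - l) \<bullet> b)"
    using m by (simp add: emeasure_distr lborel.emeasure_pair_measure_Times ennreal_mult[symmetric]
        Basis_complex_def inner_complex_def)
qed simp

lemma nn_integral_complex:
  assumes [measurable]: "h \<in> borel_measurable (borel :: complex measure)"
  shows "(\<integral>\<^sup>+ z. h z \<partial>lborel) = (\<integral>\<^sup>+ x. \<integral>\<^sup>+ y. h (Complex x y) \<partial>lborel \<partial>lborel)"
    and "(\<integral>\<^sup>+ z. h z \<partial>lborel) = (\<integral>\<^sup>+ y. \<integral>\<^sup>+ x. h (Complex x y) \<partial>lborel \<partial>lborel)"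
proof -
  note m = measurable_Complex_pair
  have "(\<integral>\<^sup>+ z. h z \<partial>lborel) = (\<integral>\<^sup>+ w. h (Complex (fst w) (snd w)) \<partial>(lborel \<Otimes>\<^sub>M lborel))"
    using m by (subst lborel_complex_pair) (simp add: nn_integral_distr case_prod_beta)
  moreover have "(\<lambda>w. h (Complex (fst w) (snd w))) \<in> borel_measurable (lborel \<Otimes>\<^sub>M lborel)"
    using measurable_compose[OF m assms] by (simp add: case_prod_beta)
  ultimately show "(\<integral>\<^sup>+ z. h z \<partial>lborel) = (\<integral>\<^sup>+ x. \<integral>\<^sup>+ y. h (Complex x y) \<partial>lborel \<partial>lborel)"
    and "(\<integral>\<^sup>+ z. h z \<partial>lborel) = (\<integral>\<^sup>+ y. \<integral>\<^sup>+ x. h (Complex x y) \<partial>lborel \<partial>lborel)"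
    using lborel.nn_integral_fst[of "\<lambda>w. h (Complex (fst w) (snd w))" lborel]
      lborel_pair.nn_integral_snd[of "\<lambda>w. h (Complex (fst w) (snd w))"]
    by (auto simp: case_prod_beta)
qed

text \<open>Line coordinates: \<open>y\<close> selects a line of direction \<open>v\<close>,
  \<open>t\<close> is the position on it, and \<open>p\<close> is a transversal along which the
  lines are counted.\<close>

definition chart :: "complex \<Rightarrow> complex \<Rightarrow> real \<Rightarrow> real \<Rightarrow> complex" where
  "chart p v y t = of_real y * p + of_real t * v"

text \<open>Fubini and a linear change of variables with determinant of modulus 1, merged into one
  formula for nonnegative Borel functions. The vector \<open>v\<close> may have any positive length,
  as slopes are represented by \<open>Complex 1 m\<close>; this is the origin of the factors
  \<open>norm v\<close> below.\<close>

definition unimodular :: "complex \<Rightarrow> complex \<Rightarrow> bool" where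
  "unimodular p v \<longleftrightarrow> v \<noteq> 0 \<and> (\<forall>h \<in> borel_measurable borel.
     (\<integral>\<^sup>+ z. h z \<partial>lborel) = (\<integral>\<^sup>+ y. \<integral>\<^sup>+ t. h (chart p v y t) \<partial>lborel \<partial>lborel))"

lemma unimodularD:
  "unimodular p v \<Longrightarrow> h \<in> borel_measurable borel \<Longrightarrow>
    (\<integral>\<^sup>+ z. h z \<partial>lborel) = (\<integral>\<^sup>+ y. \<integral>\<^sup>+ t. h (chart p v y t) \<partial>lborel \<partial>lborel)"
  by (simp add: unimodular_def)

lemma continuous_chart [continuous_intros]:
  "continuous_on S a \<Longrightarrow> continuous_on S b \<Longrightarrow> continuous_on S (\<lambda>x. chart p v (a x) (b x))"
  unfolding chart_def by (intro continuous_intros)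

lemma measurable_chart [measurable (raw)]:
  assumes [measurable]: "a \<in> borel_measurable M" "b \<in> borel_measurable M"
  shows "(\<lambda>x. chart p v (a x) (b x)) \<in> borel_measurable M"
  unfolding chart_def by measurable

lemma chart_add: "chart p v y t + chart p v y' t' = chart p v (y + y') (t + t')"
  by (simp add: chart_def algebra_simps)

lemma unimodular_slope: "unimodular \<i> (Complex 1 m)"
  unfolding unimodular_def
proof (intro conjI ballI)
  fix h :: "complex \<Rightarrow> ennreal" assume [measurable]: "h \<in> borel_measurable borel"
  have [measurable]: "(\<lambda>(y, t). chart \<i> (Complex 1 m) y t) \<in> borel_measurable (lborel \<Otimes>\<^sub>M lborel)"
    by measurable
  have c: "chart \<i> (Complex 1 m) y t = Complex t (m * t + 1 * y)" for y t
    by (auto simp: chart_def complex_eq_iff)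
  have "(\<integral>\<^sup>+ y. \<integral>\<^sup>+ t. h (chart \<i> (Complex 1 m) y t) \<partial>lborel \<partial>lborel)
      = (\<integral>\<^sup>+ t. \<integral>\<^sup>+ y. h (chart \<i> (Complex 1 m) y t) \<partial>lborel \<partial>lborel)"
    by (rule lborel_pair.Fubini') measurable
  also have "\<dots> = (\<integral>\<^sup>+ t. \<integral>\<^sup>+ y. h (Complex t y) \<partial>lborel \<partial>lborel)"
  proof (rule nn_integral_cong)
    fix t :: real
    have "(\<lambda>y. h (Complex t y)) \<in> borel_measurable borel"
      by (intro measurable_compose[OF _ \<open>h \<in> _\<close>] borel_measurable_continuous_onI continuous_intros)
    from nn_integral_real_affine[OF this, of 1 "m * t"]
    show "(\<integral>\<^sup>+ y. h (chart \<i> (Complex 1 m) y t) \<partial>lborel) = (\<integral>\<^sup>+ y. h (Complex t y) \<partial>lborel)"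
      by (simp add: c)
  qed
  finally show "(\<integral>\<^sup>+ z. h z \<partial>lborel)
      = (\<integral>\<^sup>+ y. \<integral>\<^sup>+ t. h (chart \<i> (Complex 1 m) y t) \<partial>lborel \<partial>lborel)"
    by (simp add: nn_integral_complex(1))
qed (simp add: complex_eq_iff)

lemma unimodular_vertical: "unimodular 1 \<i>"
  unfolding unimodular_def
proof (intro conjI ballI)
  fix h :: "complex \<Rightarrow> ennreal" assume "h \<in> borel_measurable borel"
  moreover have "chart 1 \<i> y t = Complex y t" for y t
    by (auto simp: chart_def complex_eq_iff)
  ultimately show "(\<integral>\<^sup>+ z. h z \<partial>lborel) = (\<integral>\<^sup>+ y. \<integral>\<^sup>+ t. h (chart 1 \<i> y t) \<partial>lborel \<partial>lborel)"
    by (simp add: nn_integral_complex(1))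
qed simp

text \<open>Serves \<open>fibre_trivial\<close>, where all four sides of a square are to be reached
  with the same positive line parameter.\<close>

lemma unimodular_uminus:
  assumes "unimodular p v"
  shows "unimodular (- p) v"
  unfolding unimodular_def
proof (intro conjI ballI)
  fix h :: "complex \<Rightarrow> ennreal" assume h[measurable]: "h \<in> borel_measurable borel"
  have "(\<lambda>y. \<integral>\<^sup>+ t. h (chart p v y t) \<partial>lborel) \<in> borel_measurable borel"
    by measurable
  from nn_integral_real_affine[OF this, of "-1" 0]
  show "(\<integral>\<^sup>+ z. h z \<partial>lborel) = (\<integral>\<^sup>+ y. \<integral>\<^sup>+ t. h (chart (- p) v y t) \<partial>lborel \<partial>lborel)"
    using assms h by (simp add: unimodular_def chart_def)
qed (use assms in \<open>simp add: unimodular_def\<close>)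

lemma unimodular_horizontal: "unimodular \<i> 1"
  using unimodular_slope[of 0] by (simp add: complex_eq_iff one_complex.ctr[symmetric])

lemma AE_chart:
  assumes "unimodular p v" "AE z in lborel. P z"
  shows "AE y in lborel. AE t in lborel. P (chart p v y t)"
proof -
  from assms(2) obtain N where N: "N \<in> sets lborel" "emeasure lborel N = 0" "\<And>z. z \<notin> N \<Longrightarrow> P z"
    by (auto simp: eventually_ae_filter null_sets_def)
  have [measurable]: "N \<in> sets borel" using N by simp
  have "(\<integral>\<^sup>+ y. \<integral>\<^sup>+ t. indicator N (chart p v y t) \<partial>lborel \<partial>lborel) = (\<integral>\<^sup>+ z. indicator N z \<partial>lborel)"
    by (rule unimodularD[OF assms(1), symmetric]) measurable
  also have "\<dots> = 0" using N by simp
  finally have "AE y in lborel. (\<integral>\<^sup>+ t. indicator N (chart p v y t) \<partial>lborel) = 0"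
    by (subst (asm) nn_integral_0_iff_AE) (auto intro: AE_mp)
  then show ?thesis
  proof eventually_elim
    case (elim y)
    then have "AE t in lborel. indicator N (chart p v y t) = (0::ennreal)"
      by (subst (asm) nn_integral_0_iff_AE) auto
    then show ?case
      by eventually_elim (auto simp: N indicator_def split: if_splits)
  qed
qed

text \<open>The converse direction of Fubini for null sets, valid for a Borel exceptional set. This
  is why the derivative conditions below get their own measurability lemma,
  \<open>sets_deriv_bound\<close>.\<close>

lemma AE_from_chart:
  assumes "unimodular p v" "{z. \<not> P z} \<in> sets borel"
    and "AE y in lborel. AE t in lborel. P (chart p v y t)"
  shows "AE z in lborel. P z"
proof -
  let ?N = "{z. \<not> P z}"
  have [measurable]: "?N \<in> sets borel" by fact
  have "emeasure lborel ?N = (\<integral>\<^sup>+ z. indicator ?N z \<partial>lborel)"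
    by (rule nn_integral_indicator[symmetric]) simp
  also have "\<dots> = (\<integral>\<^sup>+ y. \<integral>\<^sup>+ t. indicator ?N (chart p v y t) \<partial>lborel \<partial>lborel)"
    by (rule unimodularD[OF assms(1)]) measurable
  also have "\<dots> = (\<integral>\<^sup>+ y. 0 \<partial>(lborel :: real measure))"
  proof (rule nn_integral_cong_AE, use assms(3) in eventually_elim)
    case (elim y)
    then have "(\<integral>\<^sup>+ t. indicator ?N (chart p v y t) \<partial>lborel) = (\<integral>\<^sup>+ t. 0 \<partial>(lborel :: real measure))"
      by (intro nn_integral_cong_AE) (auto elim!: eventually_mono)
    then show ?case by simp
  qed
  finally show ?thesis
    by (intro AE_I[of _ _ ?N]) auto
qed

section \<open>Weak upper gradients on almost every line\<close>

lemma curve_length_isometric: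
  assumes "a \<le> b" "\<And>s t. dist (\<gamma> s) (\<gamma> t) = \<bar>s - t\<bar>"
  shows "curve_length \<gamma> a b = ennreal (b - a)"
proof (rule antisym)
  show "curve_length \<gamma> a b \<le> ennreal (b - a)"
    unfolding curve_length_def
  proof (rule SUP_least)
    fix ts :: "real list" assume "ts \<in> {ts. sorted ts \<and> set ts \<subseteq> {a..b}}"
    then have ts: "sorted ts" "set ts \<subseteq> {a..b}" by auto
    have "(\<Sum>i<length ts - 1. dist (\<gamma> (ts ! Suc i)) (\<gamma> (ts ! i)))
        = (\<Sum>i<length ts - 1. ts ! Suc i - ts ! i)"
      using ts(1) by (intro sum.cong) (auto simp: assms(2) sorted_iff_nth_mono)
    also have "\<dots> = ts ! (length ts - 1) - ts ! 0"
      by (rule sum_lessThan_telescope)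
    also have "\<dots> \<le> b - a"
    proof (cases ts)
      case Nil then show ?thesis using assms(1) by simp
    next
      case (Cons x xs)
      then have "ts ! (length ts - 1) \<in> set ts" "ts ! 0 \<in> set ts"
        by (metis One_nat_def diff_less length_greater_0_conv list.distinct(1) nth_mem zero_less_one)+
      then have "ts ! (length ts - 1) \<in> {a..b}" "ts ! 0 \<in> {a..b}" using ts(2) by blast+
      then show ?thesis by simp
    qed
    finally show "ennreal (\<Sum>i<length ts - 1. dist (\<gamma> (ts ! Suc i)) (\<gamma> (ts ! i))) \<le> ennreal (b - a)"
      by (rule ennreal_leI)
  qed
  show "ennreal (b - a) \<le> curve_length \<gamma> a b"
    unfolding curve_length_def
    by (rule SUP_upper2[of "[a, b]"]) (use assms in \<open>auto simp: dist_commute\<close>)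
qed

text \<open>Takes the place of Cauchy-Schwarz: if the square of \<open>r\<close> has integral below
  \<open>e^2\<close>, integrating over a set of measure m bounds the integral of \<open>r\<close> by
  \<open>e * (m + 1)\<close>.\<close>

lemma ennreal_le_add_square_divide:
  fixes r :: ennreal
  assumes "0 < e"
  shows "r \<le> ennreal e + r\<^sup>2 * ennreal (1 / e)"
proof (cases "r \<le> ennreal e")
  case True
  then show ?thesis by (simp add: add_increasing2)
next
  case False
  have "r = r * (ennreal e * ennreal (1 / e))"
    using assms by (simp flip: ennreal_mult)
  also have "\<dots> \<le> r\<^sup>2 * ennreal (1 / e)"
    using False unfolding power2_eq_square mult.assoc
    by (intro mult_left_mono mult_right_mono) auto
  finally show ?thesis by (simp add: add_increasing)
qed

text \<open>Modulus zero supplies admissible densities of arbitrarily small energy. A line that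
  contains a single exceptional segment in \<open>S\<close> has integral at least 1 for all of these
  densities, so such lines form a null set. Integrating over the whole part of the line in
  \<open>S\<close> settles all segments \<open>[a, b]\<close> at once.\<close>

lemma weak_upper_gradient_lines:
  assumes wug: "weak_upper_gradient S u g" and um: "unimodular p v"
    and [measurable]: "S \<in> sets borel" and fin: "emeasure lborel S < \<infinity>"
  shows "AE y in lborel. \<forall>a b. a \<le> b \<longrightarrow> (\<forall>t\<in>{a..b}. chart p v y t \<in> S) \<longrightarrow>
    ennreal (dist (u (chart p v y a)) (u (chart p v y b)))
      \<le> (\<integral>\<^sup>+ t\<in>{a..b}. ennreal (norm v) * g (chart p v y t) \<partial>lborel)"
proof -
  from wug obtain \<Gamma> where \<Gamma>: "modulus2 \<Gamma> = 0"
      "\<And>\<gamma> l. arclength_curve_in S \<gamma> l \<Longrightarrow> (\<gamma>, l) \<notin> \<Gamma> \<Longrightarrow>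
        ennreal (dist (u (\<gamma> 0)) (u (\<gamma> l))) \<le> line_integral g \<gamma> l"
    and [measurable]: "g \<in> borel_measurable borel"
    by (auto simp: weak_upper_gradient_def)
  have v: "v \<noteq> 0" using um by (simp add: unimodular_def)
  define E where "E n = 1 / real (Suc n)" for n
  have Epos: "0 < E n" for n by (simp add: E_def)
  have ex: "\<exists>\<rho>. \<rho> \<in> borel_measurable borel \<and> (\<forall>(\<gamma>, l)\<in>\<Gamma>. 1 \<le> line_integral \<rho> \<gamma> l)
      \<and> (\<integral>\<^sup>+ z. \<rho> z ^ 2 \<partial>lborel) < ennreal ((E n)\<^sup>2)" for n
  proof -
    have "modulus2 \<Gamma> < ennreal ((E n)\<^sup>2)" using Epos[of n] \<Gamma>(1) by simp
    then show ?thesis unfolding modulus2_def INF_less_iff by auto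
  qed
  obtain \<rho> where [measurable]: "\<And>n. \<rho> n \<in> borel_measurable borel"
    and adm: "\<And>n \<gamma> l. (\<gamma>, l) \<in> \<Gamma> \<Longrightarrow> 1 \<le> line_integral (\<rho> n) \<gamma> l"
    and small: "\<And>n. (\<integral>\<^sup>+ z. \<rho> n z ^ 2 \<partial>lborel) < ennreal ((E n)\<^sup>2)"
  proof -
    have "\<forall>n. \<exists>\<rho>. \<rho> \<in> borel_measurable borel \<and> (\<forall>(\<gamma>, l)\<in>\<Gamma>. 1 \<le> line_integral \<rho> \<gamma> l)
      \<and> (\<integral>\<^sup>+ z. \<rho> z ^ 2 \<partial>lborel) < ennreal ((E n)\<^sup>2)"
      using ex by blast
    from choice[OF this] obtain \<rho> where "\<forall>n. \<rho> n \<in> borel_measurable borel \<and>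
      (\<forall>(\<gamma>, l)\<in>\<Gamma>. 1 \<le> line_integral (\<rho> n) \<gamma> l) \<and> (\<integral>\<^sup>+ z. \<rho> n z ^ 2 \<partial>lborel) < ennreal ((E n)\<^sup>2)"
      by blast
    then show thesis by (intro that[of \<rho>]) auto
  qed
  define I where "I n y = ennreal (norm v) *
      (\<integral>\<^sup>+ t. \<rho> n (chart p v y t) * indicator S (chart p v y t) \<partial>lborel)" for n y
  have [measurable]: "I n \<in> borel_measurable borel" for n
    unfolding I_def by measurable
  \<comment> \<open>All lines that may contain an exceptional segment. Chebyshev applied to
    \<open>I n\<close> bounds the measure of \<open>N\<close> by \<open>C * E n\<close> for every
    \<open>n\<close>.\<close>
  define N where "N = {y. \<forall>n. 1 \<le> I n y}"
  have [measurable]: "N \<in> sets borel" unfolding N_def by measurable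
  define C where "C = norm v * (measure lborel S + 1)"
  have "emeasure lborel N \<le> ennreal (C * E n)" for n
  proof -
    have "emeasure lborel N \<le> emeasure lborel {y\<in>UNIV. 1 \<le> 1 * I n y}"
      by (intro emeasure_mono) (auto simp: N_def)
    also have "\<dots> \<le> 1 * (\<integral>\<^sup>+ y. I n y * indicator UNIV y \<partial>lborel)"
      by (intro nn_integral_Markov_inequality) auto
    also have "\<dots> = ennreal (norm v) *
        (\<integral>\<^sup>+ y. \<integral>\<^sup>+ t. \<rho> n (chart p v y t) * indicator S (chart p v y t) \<partial>lborel \<partial>lborel)"
      unfolding I_def by (simp add: nn_integral_cmult)
    also have "\<dots> = ennreal (norm v) * (\<integral>\<^sup>+ z. \<rho> n z * indicator S z \<partial>lborel)"
      by (subst unimodularD[OF um, symmetric]) auto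
    also have "(\<integral>\<^sup>+ z. \<rho> n z * indicator S z \<partial>lborel)
        \<le> (\<integral>\<^sup>+ z. ennreal (E n) * indicator S z + \<rho> n z ^ 2 * ennreal (1 / E n) \<partial>lborel)"
      using ennreal_le_add_square_divide[OF Epos]
      by (intro nn_integral_mono) (auto simp: indicator_def)
    also have "\<dots> = ennreal (E n) * emeasure lborel S
        + (\<integral>\<^sup>+ z. \<rho> n z ^ 2 \<partial>lborel) * ennreal (1 / E n)"
      by (subst nn_integral_add) (auto simp: nn_integral_cmult nn_integral_multc)
    also have "\<dots> \<le> ennreal (E n) * ennreal (measure lborel S) + ennreal ((E n)\<^sup>2) * ennreal (1 / E n)"
      using small[of n] fin
      by (intro add_mono mult_mono) (auto simp: emeasure_eq_ennreal_measure top.not_eq_extremum)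
    also have "\<dots> = ennreal (E n * (measure lborel S + 1))"
      using Epos[of n] by (simp add: algebra_simps power2_eq_square flip: ennreal_mult ennreal_plus)
    finally show ?thesis
      using Epos[of n] by (simp add: C_def mult_right_mono ac_simps ennreal_mult)
  qed
  moreover have "(\<lambda>n. C * E n) \<longlonglongrightarrow> 0"
    unfolding E_def by (rule LIMSEQ_Suc) real_asymp
  then have "(\<lambda>n. ennreal (C * E n)) \<longlonglongrightarrow> ennreal 0"
    by (rule tendsto_ennrealI)
  ultimately have "emeasure lborel N \<le> ennreal 0"
    by (intro LIMSEQ_le_const[where X = "\<lambda>n. ennreal (C * E n)"]) auto
  then have "AE y in lborel. y \<notin> N"
    by (intro AE_I[of _ _ N]) auto
  then show ?thesis
  proof (eventually_elim, intro allI impI)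
    fix y a b :: real
    assume "y \<notin> N" and ab: "a \<le> b" "\<forall>t\<in>{a..b}. chart p v y t \<in> S"
    then obtain n where n: "I n y < 1" by (auto simp: N_def not_le)
    define l where "l = (b - a) * norm v"
    \<comment> \<open>Curves are tested in arc-length parametrisation, whereas
      \<open>chart p v y\<close> runs with speed \<open>norm v\<close>.\<close>
    define \<gamma> where "\<gamma> s = chart p v y (a + 1 / norm v * s)" for s
    have l0: "0 \<le> l" using ab by (simp add: l_def)
    have mem: "a + 1 / norm v * s \<in> {a..b} \<longleftrightarrow> s \<in> {0..l}" for s
      using v by (auto simp: l_def field_simps)
    have li: "line_integral \<sigma> \<gamma> l = ennreal (norm v) * (\<integral>\<^sup>+ t\<in>{a..b}. \<sigma> (chart p v y t) \<partial>lborel)"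
      if [measurable]: "\<sigma> \<in> borel_measurable borel" for \<sigma>
    proof -
      have "(\<integral>\<^sup>+ t\<in>{a..b}. \<sigma> (chart p v y t) \<partial>lborel) = ennreal (1 / norm v) * line_integral \<sigma> \<gamma> l"
        unfolding line_integral_def
        by (subst nn_integral_real_affine[where c = "1 / norm v" and t = a])
          (use v mem in \<open>auto simp: \<gamma>_def indicator_def intro!: arg_cong2[where f = "(*)"] nn_integral_cong\<close>)
      then show ?thesis
        using v by (simp add: mult.assoc[symmetric] flip: ennreal_mult)
    qed
    have "dist (\<gamma> s) (\<gamma> t) = \<bar>s - t\<bar>" for s t
    proof -
      have "\<gamma> s - \<gamma> t = of_real ((s - t) / norm v) * v"
        by (simp add: \<gamma>_def chart_def algebra_simps diff_divide_distrib)
      then have "norm (\<gamma> s - \<gamma> t) = \<bar>(s - t) / norm v\<bar> * norm v"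
        by (simp only: norm_mult norm_of_real)
      then show ?thesis using v by (simp add: dist_norm)
    qed
    then have "arclength_curve_in S \<gamma> l"
      unfolding arclength_curve_in_def
      using l0 ab(2) mem by (auto simp: \<gamma>_def curve_length_isometric simp del: atLeastAtMost_iff)
    moreover have "(\<gamma>, l) \<notin> \<Gamma>"
    proof
      assume "(\<gamma>, l) \<in> \<Gamma>"
      then have "1 \<le> line_integral (\<rho> n) \<gamma> l" by (rule adm)
      also have "\<dots> \<le> I n y"
        unfolding li[OF \<open>\<And>n. \<rho> n \<in> _\<close>] I_def
        using ab(2) by (intro mult_left_mono nn_integral_mono) (auto simp: indicator_def)
      finally show False using n by simp
    qed
    ultimately have "ennreal (dist (u (\<gamma> 0)) (u (\<gamma> l))) \<le> line_integral g \<gamma> l"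
      by (rule \<Gamma>(2))
    then show "ennreal (dist (u (chart p v y a)) (u (chart p v y b)))
      \<le> (\<integral>\<^sup>+ t\<in>{a..b}. ennreal (norm v) * g (chart p v y t) \<partial>lborel)"
      using v by (subst (asm) li) (auto simp: \<gamma>_def l_def mult.assoc nn_integral_cmult)
  qed
qed

section \<open>Lebesgue points and absolutely continuous functions\<close>

text \<open>Multiplied out, so that no quotient of extended reals occurs, and stated in any
  dimension because it is applied both on lines and in the plane.\<close>

definition lebesgue_pt :: "('n::euclidean_space \<Rightarrow> real) \<Rightarrow> 'n \<Rightarrow> bool" where
  "lebesgue_pt h z \<longleftrightarrow> (\<forall>e>0. \<exists>\<delta>>0. \<forall>r. 0 < r \<and> r < \<delta> \<longrightarrow>
     (\<integral>\<^sup>+ w\<in>cball z r. ennreal \<bar>h w - h z\<bar> \<partial>lborel) \<le> ennreal (e * measure lborel (cball z r)))"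

text \<open>By dominated convergence the excess of \<open>f\<close> over a large constant
  \<open>n\<close> has small integral; what lies below \<open>n\<close> contributes at most
  \<open>n\<close> times the measure of \<open>A\<close>.\<close>

lemma nn_integral_absolutely_continuous:
  fixes f :: "'a \<Rightarrow> ennreal"
  assumes [measurable]: "f \<in> borel_measurable M" and fin: "(\<integral>\<^sup>+ x. f x \<partial>M) < \<infinity>" and "0 < e"
  shows "\<exists>d>0. \<forall>A\<in>sets M. emeasure M A < ennreal d \<longrightarrow> (\<integral>\<^sup>+ x\<in>A. f x \<partial>M) < ennreal e"
proof -
  define F where "F n x = f x - min (f x) (of_nat n)" for n x
  have [measurable]: "F n \<in> borel_measurable M" for n unfolding F_def by measurable
  have "AE x in M. f x \<noteq> \<infinity>"
    using fin by (intro nn_integral_PInf_AE) auto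
  then have "AE x in M. (\<lambda>n. F n x) \<longlonglongrightarrow> 0"
  proof eventually_elim
    case (elim x)
    then obtain r where r: "f x = ennreal r" "0 \<le> r" by (cases "f x") auto
    obtain N where N: "r \<le> real N" using real_arch_simple by blast
    have "F n x = 0" if "n \<ge> N" for n
    proof -
      have "f x \<le> of_nat n"
        using N that r by (simp add: ennreal_of_nat_eq_real_of_nat)
      then show ?thesis using r by (simp add: F_def min_def ennreal_minus_if)
    qed
    then show ?case
      by (intro tendsto_eventually eventually_sequentiallyI[of N]) auto
  qed
  then have "(\<lambda>n. \<integral>\<^sup>+ x. F n x \<partial>M) \<longlonglongrightarrow> (\<integral>\<^sup>+ x. 0 \<partial>M)"
    using fin by (intro nn_integral_dominated_convergence[where w = f]) (auto simp: F_def diff_le_self_ennreal)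
  then have "(\<lambda>n. \<integral>\<^sup>+ x. F n x \<partial>M) \<longlonglongrightarrow> 0" by simp
  then have "\<forall>\<^sub>F n in sequentially. (\<integral>\<^sup>+ x. F n x \<partial>M) < ennreal (e / 2)"
    using \<open>0 < e\<close> by (intro order_tendstoD) auto
  then obtain n where n: "(\<integral>\<^sup>+ x. F n x \<partial>M) < ennreal (e / 2)"
    by (auto simp: eventually_sequentially)
  define d where "d = e / (2 * (real n + 1))"
  show ?thesis
  proof (intro exI[of _ d] conjI ballI impI)
    show "0 < d" using \<open>0 < e\<close> by (simp add: d_def)
    fix A assume [measurable]: "A \<in> sets M" and A: "emeasure M A < ennreal d"
    have "(\<integral>\<^sup>+ x\<in>A. f x \<partial>M) \<le> (\<integral>\<^sup>+ x. F n x + of_nat n * indicator A x \<partial>M)"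
    proof (intro nn_integral_mono)
      fix x
      have "f x \<le> F n x + of_nat n"
        unfolding F_def by (cases "f x \<le> of_nat n") (auto simp: min_def diff_add_cancel_ennreal intro: add_increasing)
      then show "f x * indicator A x \<le> F n x + of_nat n * indicator A x"
        by (auto simp: indicator_def)
    qed
    also have "\<dots> = (\<integral>\<^sup>+ x. F n x \<partial>M) + of_nat n * emeasure M A"
      by (subst nn_integral_add) (auto simp: nn_integral_cmult)
    also have "\<dots> < ennreal (e / 2) + ennreal (e / 2)"
    proof (rule add_strict_mono[OF n])
      have "of_nat n * emeasure M A \<le> ennreal (real n) * ennreal d"
        using A by (intro mult_mono) (auto simp: ennreal_of_nat_eq_real_of_nat)
      also have "\<dots> < ennreal (e / 2)"
        using \<open>0 < e\<close> by (auto simp: d_def field_simps ennreal_less_iff simp flip: ennreal_mult)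
      finally show "of_nat n * emeasure M A < ennreal (e / 2)" .
    qed
    also have "\<dots> = ennreal e" using \<open>0 < e\<close> by (simp flip: ennreal_plus)
    finally show "(\<integral>\<^sup>+ x\<in>A. f x \<partial>M) < ennreal e" .
  qed
qed

text \<open>If the upper density of \<open>\<integral>\<bar>h - q\<bar>\<close> at every point of \<open>A\<close> exceeds a bound for
  \<open>\<bar>h - q\<bar>\<close> on \<open>A\<close>, then a Vitali cover by balls witnessing this shows that \<open>A\<close> is null.\<close>
lemma Vitali_density_null:
  fixes k :: "'n::euclidean_space \<Rightarrow> ennreal"
  assumes [measurable]: "k \<in> borel_measurable borel"
    and fin: "(\<integral>\<^sup>+ w\<in>V. k w \<partial>lborel) < \<infinity>" and [measurable]: "V \<in> sets borel"
    and V: "open V" "A \<subseteq> V" and finV: "emeasure lborel V < \<infinity>"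
    and A: "A \<in> sets borel" "\<And>x. x \<in> A \<Longrightarrow> k x \<le> ennreal a" "0 \<le> a" "a < b"
    and dense: "\<And>x d. x \<in> A \<Longrightarrow> 0 < d \<Longrightarrow> \<exists>r. 0 < r \<and> r < d \<and>
      ennreal (b * measure lborel (cball x r)) \<le> (\<integral>\<^sup>+ w\<in>cball x r. k w \<partial>lborel)"
  shows "emeasure lborel A = 0"
proof (rule ccontr)
  assume nz: "emeasure lborel A \<noteq> 0"
  have [measurable]: "A \<in> sets borel" by fact
  define m where "m = measure lborel A"
  have Afin: "emeasure lborel A < \<infinity>"
    using V(2) finV emeasure_mono[of A V lborel] by (auto simp: less_top[symmetric] top_unique)
  then have Am: "emeasure lborel A = ennreal m"
    by (simp add: m_def emeasure_eq_ennreal_measure less_top[symmetric])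
  with nz have mpos: "0 < m" by (auto simp: m_def zero_less_measure_iff)
  \<comment> \<open>Half of the available gap: the disjoint balls force an integral of at least
    \<open>b * m\<close> over \<open>U\<close>, while the choice of \<open>U\<close> allows at most
    \<open>a * m + e\<close>.\<close>
  define e where "e = (b - a) * m / 2"
  have epos: "0 < e" using A mpos by (simp add: e_def)
  obtain d where d: "0 < d" "\<And>B. B \<in> sets borel \<Longrightarrow> emeasure lborel B < ennreal d \<Longrightarrow>
      (\<integral>\<^sup>+ w\<in>B. k w * indicator V w \<partial>lborel) < ennreal e"
    using nn_integral_absolutely_continuous[of "\<lambda>w. k w * indicator V w" lborel e] fin epos by auto
  have "A \<in> sets lebesgue" by simp
  then obtain T where T: "open T" "A \<subseteq> T" "T - A \<in> lmeasurable" "emeasure lebesgue (T - A) < ennreal d"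
    using sets_lebesgue_outer_open[OF _ d(1), of A] by blast
  define U where "U = T \<inter> V"
  have U: "open U" "A \<subseteq> U" "U \<subseteq> V" using T V by (auto simp: U_def)
  have [measurable]: "U \<in> sets borel" using U by simp
  have [measurable]: "T \<in> sets borel" using T by simp
  have "emeasure lborel (U - A) \<le> emeasure lborel (T - A)"
    by (intro emeasure_mono) (auto simp: U_def)
  also have "\<dots> < ennreal d" using T(4) by simp
  finally have UA: "(\<integral>\<^sup>+ w\<in>U - A. k w * indicator V w \<partial>lborel) < ennreal e"
    by (intro d) auto
  have "(\<integral>\<^sup>+ w\<in>U. k w \<partial>lborel) \<le>
      (\<integral>\<^sup>+ w. ennreal a * indicator A w + k w * indicator V w * indicator (U - A) w \<partial>lborel)"
    using A(2) U by (intro nn_integral_mono) (auto simp: indicator_def)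
  also have "\<dots> = ennreal a * emeasure lborel A + (\<integral>\<^sup>+ w\<in>U - A. k w * indicator V w \<partial>lborel)"
    by (subst nn_integral_add) (auto simp: nn_integral_cmult)
  also have "\<dots> \<le> ennreal a * ennreal m + ennreal e"
    using UA Am by (intro add_mono) auto
  finally have Uup: "(\<integral>\<^sup>+ w\<in>U. k w \<partial>lborel) \<le> ennreal (a * m + e)"
    using A mpos epos by (simp flip: ennreal_mult ennreal_plus)
  define K where "K = {(x, r). 0 < r \<and> cball x r \<subseteq> U \<and>
      ennreal (b * measure lborel (cball x r)) \<le> (\<integral>\<^sup>+ w\<in>cball x r. k w \<partial>lborel)}"
  have cover: "\<exists>i. i \<in> K \<and> x \<in> cball (fst i) (snd i) \<and> snd i < \<delta>" if x: "x \<in> A" "0 < \<delta>" for x \<delta>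
  proof -
    obtain s where s: "0 < s" "cball x s \<subseteq> U" using U x by (meson open_contains_cball subsetD)
    obtain r where r: "0 < r" "r < min s \<delta>"
        "ennreal (b * measure lborel (cball x r)) \<le> (\<integral>\<^sup>+ w\<in>cball x r. k w \<partial>lborel)"
      using dense[OF x(1), of "min s \<delta>"] s x by auto
    have "cball x r \<subseteq> cball x s" using r by (simp add: subset_cball)
    with r s show ?thesis by (intro exI[of _ "(x, r)"]) (auto simp: K_def)
  qed
  obtain C where C: "countable C" "C \<subseteq> K"
     "pairwise (\<lambda>i j. disjnt (cball (fst i) (snd i)) (cball (fst j) (snd j))) C"
     "negligible (A - (\<Union>i \<in> C. cball (fst i) (snd i)))"
  proof (rule Vitali_covering_theorem_cballs[of K snd A fst])
    show "0 < snd i" if "i \<in> K" for i using that by (auto simp: K_def)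
    show "\<exists>i. i \<in> K \<and> x \<in> cball (fst i) (snd i) \<and> snd i < d" if "x \<in> A" "0 < d" for x d
      using that by (rule cover)
  qed
  let ?B = "\<lambda>i. cball (fst i) (snd i)"
  have disj: "disjoint_family_on ?B C"
    using C(3) by (auto simp: disjoint_family_on_def pairwise_def disjnt_def)
  have UBm[measurable]: "(\<Union>i\<in>C. ?B i) \<in> sets borel"
    using C(1) by (intro sets.countable_UN') auto
  have "emeasure lborel (A - (\<Union>i\<in>C. ?B i)) = 0"
    using C(4) by (simp add: negligible_iff_null_sets null_sets_def)
  moreover have "emeasure lborel A \<le> emeasure lborel (A - (\<Union>i\<in>C. ?B i)) + emeasure lborel (\<Union>i\<in>C. ?B i)"
    by (rule order_trans[OF emeasure_mono emeasure_subadditive]) auto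
  ultimately have "ennreal m \<le> emeasure lborel (\<Union>i\<in>C. ?B i)" using Am by simp
  also have "\<dots> = (\<integral>\<^sup>+ i. emeasure lborel (?B i) \<partial>count_space C)"
    by (rule emeasure_UN_countable[OF _ C(1) disj]) auto
  finally have mle: "ennreal m \<le> (\<integral>\<^sup>+ i. emeasure lborel (?B i) \<partial>count_space C)" .
  have bpos: "0 < b" using A by simp
  have "ennreal (b * m) = ennreal b * ennreal m"
    using bpos mpos by (simp add: ennreal_mult)
  also have "\<dots> \<le> (\<integral>\<^sup>+ i. ennreal b * emeasure lborel (?B i) \<partial>count_space C)"
    using mle by (subst nn_integral_cmult) (auto intro: mult_left_mono)
  also have "\<dots> \<le> (\<integral>\<^sup>+ i. (\<integral>\<^sup>+ w\<in>?B i. k w \<partial>lborel) \<partial>count_space C)"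
  proof (intro nn_integral_mono)
    fix i assume "i \<in> space (count_space C)"
    then have "i \<in> K" using C by auto
    then have "ennreal (b * measure lborel (?B i)) \<le> (\<integral>\<^sup>+ w\<in>?B i. k w \<partial>lborel)"
      by (auto simp: K_def)
    moreover have "ennreal b * emeasure lborel (?B i) = ennreal (b * measure lborel (?B i))"
      using bpos emeasure_lborel_cball_finite[of "fst i" "snd i"]
      by (simp add: emeasure_eq_ennreal_measure ennreal_mult)
    ultimately show "ennreal b * emeasure lborel (?B i) \<le> (\<integral>\<^sup>+ w\<in>?B i. k w \<partial>lborel)" by simp
  qed
  also have "\<dots> = (\<integral>\<^sup>+ w\<in>(\<Union>i\<in>C. ?B i). k w \<partial>lborel)"
  proof -
    have "emeasure (density lborel k) (\<Union>i\<in>C. ?B i)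
        = (\<integral>\<^sup>+ i. emeasure (density lborel k) (?B i) \<partial>count_space C)"
      by (rule emeasure_UN_countable[OF _ C(1) disj]) auto
    then show ?thesis by (simp add: emeasure_density)
  qed
  also have "\<dots> \<le> (\<integral>\<^sup>+ w\<in>U. k w \<partial>lborel)"
  proof -
    have "(\<Union>i\<in>C. ?B i) \<subseteq> U" using C(2) by (force simp: K_def)
    then show ?thesis by (intro nn_integral_mono mult_left_mono indicator_leI) (erule subsetD, auto)
  qed
  also note Uup
  finally have "b * m \<le> a * m + e" using A mpos epos by (subst (asm) ennreal_le_iff) auto
  moreover have "b * m - a * m = 2 * e" by (simp add: e_def algebra_simps)
  ultimately show False using epos by linarith
qed

text \<open>Comparing \<open>h\<close> with rational constants \<open>q\<close> reduces failure to
  countably many sets \<open>A n q k\<close>, on which \<open>\<bar>h - q\<bar>\<close> is at most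
  1/(k+1) although its means over small balls reach 2/(k+1). Rational radii make these sets Borel,
  and \<open>Vitali_density_null\<close> makes them null.\<close>

theorem AE_lebesgue_pt:
  fixes h :: "'n::euclidean_space \<Rightarrow> real"
  assumes [measurable]: "h \<in> borel_measurable borel"
    and fin: "(\<integral>\<^sup>+ w. ennreal \<bar>h w\<bar> \<partial>lborel) < \<infinity>"
  shows "AE z in lborel. lebesgue_pt h z"
proof -
  define I where "I q r x = (\<integral>\<^sup>+ w\<in>cball x r. ennreal \<bar>h w - q\<bar> \<partial>lborel)" for q r :: real and x
  have [measurable]: "I q r \<in> borel_measurable borel" for q r
  proof -
    have "{p :: 'n \<times> 'n. dist (fst p) (snd p) \<le> r} \<in> sets borel"
      by (intro borel_closed closed_Collect_le continuous_intros)
    then have [measurable]: "{p :: 'n \<times> 'n. dist (fst p) (snd p) \<le> r} \<in> sets (lborel \<Otimes>\<^sub>M lborel)"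
      by (simp only: lborel_prod sets_lborel)
    have "(\<lambda>x. \<integral>\<^sup>+ w. ennreal \<bar>h w - q\<bar> * indicator {p. dist (fst p) (snd p) \<le> r} (x, w) \<partial>lborel)
        \<in> borel_measurable lborel"
      by (rule lborel.borel_measurable_nn_integral) (simp add: case_prod_beta)
    moreover have "I q r = (\<lambda>x. \<integral>\<^sup>+ w. ennreal \<bar>h w - q\<bar> * indicator {p. dist (fst p) (snd p) \<le> r} (x, w) \<partial>lborel)"
      unfolding I_def by (intro ext nn_integral_cong) (auto simp: indicator_def)
    ultimately show ?thesis by simp
  qed
  define vol where "vol r = measure lborel (cball (0::'n) r)" for r
  have vol: "measure lborel (cball x r) = vol r" if "0 \<le> r" for x :: 'n and r
    using that by (simp add: vol_def content_cball)
  define A where "A n q k = {x \<in> ball (0::'n) (real n). \<bar>h x - q\<bar> \<le> 1 / real (Suc k) \<and>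
     (\<forall>j::nat. \<exists>s::rat. 0 < s \<and> of_rat s < 1 / real (Suc j) \<and>
       ennreal (2 / real (Suc k) * vol (of_rat s)) \<le> I q (of_rat s) x)}"
    for n k :: nat and q :: real
  have "A n q k \<in> sets borel" for n q k
  proof -
    have "A n q k = ball 0 (real n) \<inter> {x \<in> space borel. \<bar>h x - q\<bar> \<le> 1 / real (Suc k)} \<inter>
     (\<Inter>j::nat. \<Union>s::rat\<in>{s. 0 < s \<and> of_rat s < 1 / real (Suc j)}.
       {x \<in> space borel. ennreal (2 / real (Suc k) * vol (of_rat s)) \<le> I q (of_rat s) x})"
      by (auto simp: A_def)
    also have "\<dots> \<in> sets borel"
      by (intro sets.Int sets.countable_INT sets.countable_UN') (auto intro!: countableI_type)
    finally show ?thesis .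
  qed
  have null: "emeasure lborel (A n q k) = 0" for n q k
  proof (rule Vitali_density_null[where k = "\<lambda>w. ennreal \<bar>h w - q\<bar>" and V = "ball 0 (real n)"
        and a = "1 / real (Suc k)" and b = "2 / real (Suc k)"])
    have [measurable]: "ball (0::'n) (real n) \<in> sets borel" by simp
    have "(\<integral>\<^sup>+ w\<in>ball 0 (real n). ennreal \<bar>h w - q\<bar> \<partial>lborel)
        \<le> (\<integral>\<^sup>+ w. ennreal \<bar>h w\<bar> + ennreal \<bar>q\<bar> * indicator (ball 0 (real n)) w \<partial>lborel)"
      by (intro nn_integral_mono) (auto simp: indicator_def simp flip: ennreal_plus)
    also have "\<dots> = (\<integral>\<^sup>+ w. ennreal \<bar>h w\<bar> \<partial>lborel) + ennreal \<bar>q\<bar> * emeasure lborel (ball (0::'n) (real n))"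
      by (subst nn_integral_add) (auto simp: nn_integral_cmult)
    also have "\<dots> < \<infinity>"
      using fin emeasure_lborel_ball_finite[of "0::'n" "real n"] by (simp add: ennreal_mult_less_top)
    finally show "(\<integral>\<^sup>+ w\<in>ball 0 (real n). ennreal \<bar>h w - q\<bar> \<partial>lborel) < \<infinity>" .
    show "emeasure lborel (ball (0::'n) (real n)) < \<infinity>"
      using emeasure_lborel_ball_finite[of "0::'n" "real n"] by simp
    fix x d assume x: "x \<in> A n q k" and d: "(0::real) < d"
    obtain j where j: "1 / real (Suc j) < d" using d nat_approx_posE by blast
    from x obtain s :: rat where s: "0 < s" "of_rat s < 1 / real (Suc j)"
        "ennreal (2 / real (Suc k) * vol (of_rat s)) \<le> I q (of_rat s) x"
      unfolding A_def by blast
    then show "\<exists>r>0. r < d \<and> ennreal (2 / real (Suc k) * measure lborel (cball x r))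
        \<le> (\<integral>\<^sup>+ w\<in>cball x r. ennreal \<bar>h w - q\<bar> \<partial>lborel)"
      using j vol[of "of_rat s" x] by (intro exI[of _ "of_rat s"]) (auto simp: I_def simp del: of_nat_Suc)
  qed (use \<open>\<And>n q k. A n q k \<in> sets borel\<close> in \<open>auto simp: A_def divide_strict_right_mono intro!: ennreal_leI\<close>)
  have "AE z in lborel. z \<notin> A n q k" for n q k
    using null \<open>\<And>n q k. A n q k \<in> sets borel\<close> by (intro AE_not_in) (auto simp: null_sets_def)
  then have "AE z in lborel. \<forall>n. \<forall>q\<in>\<rat>. \<forall>k. z \<notin> A n q k"
    by (simp add: AE_all_countable AE_ball_countable countable_rat)
  then show ?thesis
  proof eventually_elim
    case (elim z)
    show ?case
    proof (rule ccontr)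
      assume "\<not> lebesgue_pt h z"
      then obtain e where e: "0 < e" and bad: "\<And>\<delta>. 0 < \<delta> \<Longrightarrow> \<exists>r>0. r < \<delta> \<and>
          ennreal (e * measure lborel (cball z r)) < I (h z) r z"
        by (auto simp: lebesgue_pt_def I_def not_le)
      \<comment> \<open>The margin \<open>4 * a < e\<close> pays for two losses: replacing
        \<open>h z\<close> by \<open>q\<close> costs \<open>a\<close>, and enlarging
        \<open>r\<close> to a rational radius lowers the remaining 3a to the density 2a required in
        \<open>A n q k\<close>.\<close>
      obtain k where k: "1 / real (Suc k) < e / 4" using e nat_approx_posE[of "e / 4"] by auto
      define a where "a = 1 / real (Suc k)"
      have a: "0 < a" "4 * a < e" using k by (auto simp: a_def)
      obtain q where q: "q \<in> \<rat>" "h z < q" "q < h z + a"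
        using Rats_dense_in_real[of "h z" "h z + a"] a by auto
      obtain n where n: "norm z < real n" using reals_Archimedean2 by blast
      have "z \<in> A n q k"
        unfolding A_def
      proof (intro CollectI conjI allI)
        show "z \<in> ball 0 (real n)" using n by simp
        show "\<bar>h z - q\<bar> \<le> 1 / real (Suc k)" using q by (auto simp: a_def)
        fix j :: nat
        obtain r where r: "0 < r" "r < 1 / real (Suc j)" "ennreal (e * vol r) < I (h z) r z"
          using bad[of "1 / real (Suc j)"] vol by force
        have [measurable]: "cball z r \<in> sets borel" by simp
        have cont: "continuous (at_right r) (\<lambda>s. 2 * a * (unit_ball_vol (real DIM('n)) * s ^ DIM('n)))"
          by (intro continuous_intros)
        have volr: "vol s = unit_ball_vol (real DIM('n)) * s ^ DIM('n)" if "0 \<le> s" for s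
          using that by (simp add: vol_def content_cball)
        have volpos: "0 < vol r"
          using r by (simp add: volr)
        have "\<forall>\<^sub>F s in at_right r. 2 * a * (unit_ball_vol (real DIM('n)) * s ^ DIM('n)) < 3 * a * vol r"
          by (rule order_tendstoD(2)[OF cont[unfolded continuous_within]])
            (use a volpos r in \<open>simp add: volr\<close>)
        then obtain b where b: "b > r" "\<And>s. r < s \<Longrightarrow> s < b \<Longrightarrow>
            2 * a * (unit_ball_vol (real DIM('n)) * s ^ DIM('n)) < 3 * a * vol r"
          by (auto simp: eventually_at_right_field)
        obtain s where s: "s \<in> \<rat>" "r < s" "s < min b (1 / real (Suc j))"
          using Rats_dense_in_real[of r "min b (1 / real (Suc j))"] b(1) r(2) by auto
        have "2 * a * vol s \<le> 3 * a * vol r" using b(2)[of s] s r by (simp add: volr)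
        have "ennreal (3 * a * vol r) + ennreal (a * vol r) \<le> ennreal (e * vol r)"
          using a volpos by (simp flip: ennreal_plus add: algebra_simps)
        also have "\<dots> \<le> I (h z) r z" using r by simp
        also have "\<dots> \<le> (\<integral>\<^sup>+ w. ennreal \<bar>h w - q\<bar> * indicator (cball z r) w + ennreal a * indicator (cball z r) w \<partial>lborel)"
          unfolding I_def using q
          by (intro nn_integral_mono) (auto simp: indicator_def simp flip: ennreal_plus)
        also have "\<dots> = I q r z + ennreal a * emeasure lborel (cball z r)"
          unfolding I_def by (subst nn_integral_add) (auto simp: nn_integral_cmult)
        also have "emeasure lborel (cball z r) = ennreal (vol r)"
          using r emeasure_lborel_cball_finite[of z r] by (simp add: emeasure_eq_ennreal_measure vol)
        also have "ennreal a * ennreal (vol r) = ennreal (a * vol r)"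
          using a volpos by (simp add: ennreal_mult)
        finally have "ennreal (3 * a * vol r) \<le> I q r z" by simp
        also have "\<dots> \<le> I q s z"
          unfolding I_def using s by (intro nn_integral_mono) (auto simp: indicator_def)
        finally have "ennreal (2 * a * vol s) \<le> I q s z"
          using \<open>2 * a * vol s \<le> _\<close> by (meson ennreal_leI order_trans)
        moreover obtain s' where "s = of_rat s'" using s(1) by (auto simp: Rats_def)
        ultimately show "\<exists>s::rat. 0 < s \<and> of_rat s < 1 / real (Suc j) \<and>
            ennreal (2 / real (Suc k) * vol (of_rat s)) \<le> I q (of_rat s) z"
          using s r zero_less_of_rat_iff[of s', where 'a = real]
          by (intro exI[of _ s']) (auto simp: a_def simp del: zero_less_of_rat_iff)
      qed
      with elim q show False by blast
    qed
  qed
qed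

section \<open>Absolutely continuous functions through Stieltjes measures\<close>

lemma interval_measure_sum:
  fixes P P' :: "real \<Rightarrow> real"
  assumes P: "\<And>x y. x \<le> y \<Longrightarrow> P x \<le> P y" "\<And>a. continuous (at_right a) P"
    and P': "\<And>x y. x \<le> y \<Longrightarrow> P' x \<le> P' y" "\<And>a. continuous (at_right a) P'"
    and [measurable]: "k \<in> borel_measurable borel"
    and eq: "\<And>a b. a \<le> b \<Longrightarrow> (\<integral>\<^sup>+ t\<in>{a<..b}. k t \<partial>lborel) = ennreal (P b - P a + (P' b - P' a))"
    and A: "A \<in> sets borel"
  shows "emeasure (interval_measure P) A + emeasure (interval_measure P') A = (\<integral>\<^sup>+ t\<in>A. k t \<partial>lborel)"
proof -
  define M where "M = measure_of UNIV (sets borel)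
      (\<lambda>A. emeasure (interval_measure P) A + emeasure (interval_measure P') A)"
  have sM: "sets M = sets borel"
    unfolding M_def using sets.sigma_sets_eq[of "borel :: real measure"] by (subst sets_measure_of) auto
  have eM: "emeasure M B = emeasure (interval_measure P) B + emeasure (interval_measure P') B"
    if "B \<in> sets borel" for B
    unfolding M_def
  proof (rule emeasure_measure_of_sigma[OF _ _ _ that])
    show "sigma_algebra UNIV (sets (borel :: real measure))"
      using sets.sigma_algebra_axioms[of "borel :: real measure"] by simp
    show "countably_additive (sets borel)
        (\<lambda>A. emeasure (interval_measure P) A + emeasure (interval_measure P') A)"
    proof (rule countably_additiveI)
      fix B :: "nat \<Rightarrow> real set"
      assume B: "range B \<subseteq> sets borel" "disjoint_family B"
      then show "(\<Sum>i. emeasure (interval_measure P) (B i) + emeasure (interval_measure P') (B i))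
          = emeasure (interval_measure P) (\<Union>i. B i) + emeasure (interval_measure P') (\<Union>i. B i)"
        by (subst suminf_add[symmetric]) (auto simp: suminf_emeasure)
    qed
  qed (simp add: positive_def)
  have "M = density lborel k"
  proof (rule measure_eqI_generator_eq[where \<Omega> = UNIV and E = "range (\<lambda>(a, b). {a <.. b::real})"
        and A = "\<lambda>i. {- real i <.. real i}"])
    show "Int_stable (range (\<lambda>(a, b). {a <.. b::real}))"
      by (auto simp: Int_stable_def)
    show "sets M = sigma_sets UNIV (range (\<lambda>(a, b). {a <.. b::real}))"
      unfolding sM by (subst borel_sigma_sets_Ioc) auto
    then show "sets (density lborel k) = sigma_sets UNIV (range (\<lambda>(a, b). {a <.. b::real}))"
      using sM by simp
    have *: "emeasure M {a<..b} = ennreal (P b - P a + (P' b - P' a))" if "a \<le> b" for a b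
      using that P P'
      by (simp add: eM emeasure_interval_measure_Ioc flip: ennreal_plus)
    show "emeasure M X = emeasure (density lborel k) X" if X: "X \<in> range (\<lambda>(a, b). {a <.. b::real})" for X
    proof -
      from X obtain a b where ab: "X = {a<..b}" by auto
      show ?thesis
      proof (cases "a \<le> b")
        case True
        then show ?thesis using eq[OF True] by (simp add: ab * emeasure_density)
      next
        case False
        then show ?thesis by (simp add: ab)
      qed
    qed
    show "emeasure M {- real i <.. real i} \<noteq> \<infinity>" for i
      by (subst *) auto
    show "(\<Union>i. {- real i <.. real i}) = UNIV"
    proof (intro equalityI subsetI UNIV_I)
      fix x :: real
      obtain n where "\<bar>x\<bar> < real n" using reals_Archimedean2 by blast
      then show "x \<in> (\<Union>i. {- real i <.. real i})" by (intro UN_I[of n]) auto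
    qed
  qed auto
  then have "emeasure M A = emeasure (density lborel k) A" by simp
  then show ?thesis using A by (simp add: eM emeasure_density)
qed

text \<open>With \<open>G\<close> the primitive of \<open>g\<close>, both \<open>G + F\<close> and
  \<open>G - F\<close> are increasing, and their Stieltjes measures add up to \<open>2 * g\<close>
  times Lebesgue measure. Hence the measure of \<open>G + F\<close> is absolutely continuous, and
  its Radon-Nikodym density minus \<open>g\<close> is a density for \<open>F\<close>.\<close>

lemma ac_density:
  fixes F g :: "real \<Rightarrow> real"
  assumes [measurable]: "g \<in> borel_measurable borel" and g0: "\<And>t. 0 \<le> g t"
    and fin: "(\<integral>\<^sup>+ t. ennreal (g t) \<partial>lborel) < \<infinity>"
    and F: "\<And>a b. a \<le> b \<Longrightarrow> ennreal \<bar>F b - F a\<bar> \<le> (\<integral>\<^sup>+ t\<in>{a..b}. ennreal (g t) \<partial>lborel)"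
  shows "\<exists>p. integrable lborel p \<and> (\<forall>a b. a \<le> b \<longrightarrow> F b - F a = (LINT t:{a<..b}|lborel. p t))"
proof -
  have gint: "integrable lborel g"
    using fin g0 by (intro integrableI_nonneg) auto
  define G where "G x = (LINT t:{..x}|lborel. g t)" for x
  have sint: "set_integrable lborel S g" if "S \<in> sets borel" for S
    using that gint integrable_mult_indicator[of S lborel g] by (simp add: set_integrable_def)
  have Gd: "G b - G a = (LINT t:{a<..b}|lborel. g t)" if "a \<le> b" for a b
  proof -
    have "{..b} = {..a} \<union> {a<..b}" using that by auto
    then have "G b = G a + (LINT t:{a<..b}|lborel. g t)"
      unfolding G_def by (simp, subst set_integral_Un) (auto intro!: sint)
    then show ?thesis by simp
  qed
  have Gn: "ennreal (G b - G a) = (\<integral>\<^sup>+ t\<in>{a<..b}. ennreal (g t) \<partial>lborel)" if "a \<le> b" for a b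
    unfolding Gd[OF that] set_lebesgue_integral_def
    using sint[of "{a<..b}"] g0
    by (subst nn_integral_eq_integral[symmetric])
      (auto simp: set_integrable_def indicator_def intro!: nn_integral_cong)
  have Gmono: "G a \<le> G b" if "a \<le> b" for a b
  proof -
    have "0 \<le> (LINT t:{a<..b}|lborel. g t)"
      unfolding set_lebesgue_integral_def using g0 by (intro Bochner_Integration.integral_nonneg) auto
    then show ?thesis using Gd[OF that] by simp
  qed
  have Icc: "(\<integral>\<^sup>+ t\<in>{a..b}. ennreal (g t) \<partial>lborel) = (\<integral>\<^sup>+ t\<in>{a<..b}. ennreal (g t) \<partial>lborel)" for a b
    by (intro nn_integral_cong_AE, use AE_lborel_singleton[of a] in eventually_elim)
      (auto simp: indicator_def)
  have Fd: "\<bar>F b - F a\<bar> \<le> G b - G a" if "a \<le> b" for a b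
    using F[OF that] Gmono[OF that] unfolding Icc Gn[OF that, symmetric] by simp
  define P P' where "P x = G x + F x" and "P' x = G x - F x" for x
  have mono: "P x \<le> P y" "P' x \<le> P' y" if "x \<le> y" for x y
    using Fd[OF that] by (auto simp: P_def P'_def abs_le_iff)
  have Gc: "continuous (at_right a) G" "continuous (at_right a) F" for a
  proof -
    have *: "\<exists>d>0. \<forall>b. a < b \<and> b < a + d \<longrightarrow> G b - G a < e" if e: "0 < e" for e
    proof -
      obtain d where d: "0 < d" "\<And>B. B \<in> sets borel \<Longrightarrow> emeasure lborel B < ennreal d \<Longrightarrow>
          (\<integral>\<^sup>+ t\<in>B. ennreal (g t) \<partial>lborel) < ennreal e"
        using nn_integral_absolutely_continuous[of "\<lambda>t. ennreal (g t)" lborel e] fin e by auto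
      have "G b - G a < e" if "a < b" "b < a + d" for b
      proof -
        have "ennreal (G b - G a) < ennreal e"
          using that d by (subst Gn) (auto simp: ennreal_lessI)
        then show ?thesis using Gmono[of a b] that by (simp add: ennreal_less_iff)
      qed
      with d(1) show ?thesis by blast
    qed
    show "continuous (at_right a) G"
      unfolding continuous_within tendsto_iff eventually_at_right_field
    proof (intro allI impI)
      fix e :: real assume "0 < e"
      from *[OF this] obtain d where d: "d > 0" "\<And>b. a < b \<Longrightarrow> b < a + d \<Longrightarrow> G b - G a < e" by blast
      then show "\<exists>b>a. \<forall>y>a. y < b \<longrightarrow> dist (G y) (G a) < e"
        using Gmono[of a] by (intro exI[of _ "a + d"]) (auto simp: dist_real_def)
    qed
    show "continuous (at_right a) F"
      unfolding continuous_within tendsto_iff eventually_at_right_field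
    proof (intro allI impI)
      fix e :: real assume "0 < e"
      from *[OF this] obtain d where d: "d > 0" "\<And>b. a < b \<Longrightarrow> b < a + d \<Longrightarrow> G b - G a < e" by blast
      then show "\<exists>b>a. \<forall>y>a. y < b \<longrightarrow> dist (F y) (F a) < e"
      proof (intro exI[of _ "a + d"] conjI allI impI)
        fix y assume "a < y" "y < a + d"
        then show "dist (F y) (F a) < e"
          using Fd[of a y] d(2)[of y] by (simp add: dist_real_def)
      qed (use d in simp)
    qed
  qed
  have cont: "continuous (at_right a) P" "continuous (at_right a) P'" for a
    unfolding P_def P'_def by (intro continuous_intros Gc)+
  have sum: "emeasure (interval_measure P) A + emeasure (interval_measure P') A
      = (\<integral>\<^sup>+ t\<in>A. 2 * ennreal (g t) \<partial>lborel)" if "A \<in> sets borel" for A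
  proof (rule interval_measure_sum[OF mono(1) cont(1) mono(2) cont(2) _ _ that])
    fix a b :: real assume ab: "a \<le> b"
    have "(\<integral>\<^sup>+ t\<in>{a<..b}. 2 * ennreal (g t) \<partial>lborel) = 2 * ennreal (G b - G a)"
      unfolding Gn[OF ab] by (simp add: nn_integral_cmult mult.assoc)
    also have "\<dots> = ennreal (P b - P a + (P' b - P' a))"
      unfolding P_def P'_def using ennreal_mult'[of 2 "G b - G a"] by (simp add: algebra_simps)
    finally show "(\<integral>\<^sup>+ t\<in>{a<..b}. 2 * ennreal (g t) \<partial>lborel) = ennreal (P b - P a + (P' b - P' a))" .
  qed auto
  then have le: "emeasure (interval_measure P) A \<le> (\<integral>\<^sup>+ t\<in>A. 2 * ennreal (g t) \<partial>lborel)"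
    if "A \<in> sets borel" for A
    using that by (metis le_iff_add)
  have "absolutely_continuous lborel (interval_measure P)"
    unfolding absolutely_continuous_def
  proof
    fix A :: "real set" assume A: "A \<in> null_sets lborel"
    then have "(\<integral>\<^sup>+ t\<in>A. 2 * ennreal (g t) \<partial>lborel) = 0"
      by (intro nn_integral_null_set)
    with A le[of A] show "A \<in> null_sets (interval_measure P)" by (auto simp: null_sets_def)
  qed
  then obtain f where [measurable]: "f \<in> borel_measurable borel"
    and f: "density lborel f = interval_measure P"
    using sigma_finite_measure.Radon_Nikodym[OF lborel.sigma_finite_measure_axioms, of "interval_measure P"]
    by auto
  have "(\<integral>\<^sup>+ t. f t \<partial>lborel) = emeasure (interval_measure P) UNIV"
    unfolding f[symmetric] by (simp add: emeasure_density)
  also have "\<dots> \<le> 2 * (\<integral>\<^sup>+ t. ennreal (g t) \<partial>lborel)"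
    using le[of UNIV] by (simp add: nn_integral_cmult)
  also have "\<dots> < \<infinity>" using fin by (simp add: ennreal_mult_less_top)
  finally have ffin: "(\<integral>\<^sup>+ t. f t \<partial>lborel) < \<infinity>" .
  define q where "q t = enn2real (f t)" for t
  have [measurable]: "q \<in> borel_measurable borel" unfolding q_def by measurable
  have fq: "AE t in lborel. f t = ennreal (q t)"
    using nn_integral_PInf_AE[of f lborel] ffin by (auto elim!: eventually_mono simp: q_def less_top)
  have qint: "integrable lborel q"
  proof (rule integrableI_nonneg)
    have "(\<integral>\<^sup>+ t. ennreal (q t) \<partial>lborel) = (\<integral>\<^sup>+ t. f t \<partial>lborel)"
      using fq by (intro nn_integral_cong_AE) (auto elim: eventually_mono)
    then show "(\<integral>\<^sup>+ t. ennreal (q t) \<partial>lborel) < \<infinity>" using ffin by simp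
  qed (auto simp: q_def)
  have sq: "set_integrable lborel S q" if "S \<in> sets borel" for S
    using that qint integrable_mult_indicator[of S lborel q] by (simp add: set_integrable_def)
  have "F b - F a = (LINT t:{a<..b}|lborel. q t - g t)" if ab: "a \<le> b" for a b
  proof -
    have "ennreal (P b - P a) = emeasure (interval_measure P) {a<..b}"
      using ab mono cont by (simp add: emeasure_interval_measure_Ioc)
    also have "\<dots> = (\<integral>\<^sup>+ t\<in>{a<..b}. f t \<partial>lborel)"
      unfolding f[symmetric] by (simp add: emeasure_density)
    also have "\<dots> = (\<integral>\<^sup>+ t. ennreal (indicator {a<..b} t * q t) \<partial>lborel)"
      using fq by (intro nn_integral_cong_AE) (auto elim!: eventually_mono simp: indicator_def)
    also have "\<dots> = ennreal (LINT t:{a<..b}|lborel. q t)"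
      unfolding set_lebesgue_integral_def using sq[of "{a<..b}"]
      by (subst nn_integral_eq_integral) (auto simp: set_integrable_def q_def)
    finally have "P b - P a = (LINT t:{a<..b}|lborel. q t)"
      using mono(1)[OF ab]
      by (subst (asm) ennreal_inj) (auto simp: set_lebesgue_integral_def q_def intro!: integral_nonneg)
    then have "F b - F a = (LINT t:{a<..b}|lborel. q t) - (LINT t:{a<..b}|lborel. g t)"
      using Gd[OF ab] by (simp add: P_def)
    also have "\<dots> = (LINT t:{a<..b}|lborel. q t - g t)"
      by (rule set_integral_diff(2)[symmetric]) (auto intro!: sint sq)
    finally show ?thesis .
  qed
  moreover have "integrable lborel (\<lambda>t. q t - g t)" using qint gint by simp
  ultimately show ?thesis by blast
qed

section \<open>Differentiation at Lebesgue points of the line\<close>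

definition lin_deriv :: "(real \<Rightarrow> real) \<Rightarrow> real \<Rightarrow> real \<Rightarrow> bool" where
  "lin_deriv F t D \<longleftrightarrow> (\<forall>e>0. \<exists>\<delta>>0. \<forall>r. \<bar>r\<bar> < \<delta> \<longrightarrow> \<bar>F (t + r) - F t - D * r\<bar> \<le> e * \<bar>r\<bar>)"

lemma lebesgue_pt_real:
  assumes "lebesgue_pt h (t::real)" "0 < e"
  shows "\<exists>\<delta>>0. \<forall>r. \<bar>r\<bar> < \<delta> \<longrightarrow>
    (\<integral>\<^sup>+ s\<in>cball t \<bar>r\<bar>. ennreal \<bar>h s - h t\<bar> \<partial>lborel) \<le> ennreal (e * \<bar>r\<bar>)"
proof -
  from assms obtain \<delta> where \<delta>: "0 < \<delta>" "\<And>r. 0 < r \<Longrightarrow> r < \<delta> \<Longrightarrow>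
      (\<integral>\<^sup>+ w\<in>cball t r. ennreal \<bar>h w - h t\<bar> \<partial>lborel) \<le> ennreal (e / 2 * measure lborel (cball t r))"
    unfolding lebesgue_pt_def by (meson half_gt_zero)
  show ?thesis
  proof (intro exI conjI allI impI)
    show "0 < \<delta>" by (rule \<delta>(1))
    fix r :: real assume r: "\<bar>r\<bar> < \<delta>"
    show "(\<integral>\<^sup>+ s\<in>cball t \<bar>r\<bar>. ennreal \<bar>h s - h t\<bar> \<partial>lborel) \<le> ennreal (e * \<bar>r\<bar>)"
    proof (cases "r = 0")
      case True
      have "(\<integral>\<^sup>+ s\<in>cball t \<bar>r\<bar>. ennreal \<bar>h s - h t\<bar> \<partial>lborel) = (\<integral>\<^sup>+ s. 0 \<partial>(lborel :: real measure))"
        by (intro nn_integral_cong) (auto simp: True indicator_def)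
      then show ?thesis by simp
    next
      case False
      then show ?thesis using \<delta>(2)[of "\<bar>r\<bar>"] r by (simp add: cball_eq_atLeastAtMost)
    qed
  qed
qed

text \<open>The hypothesis on \<open>F\<close> compares its increments with those of the linear
  function of slope \<open>h t\<close>; at a Lebesgue point the error is small relative to the
  length of the interval.\<close>

lemma lebesgue_pt_lin_deriv:
  assumes "lebesgue_pt h t" "\<alpha> < t" "t < \<beta>"
    and F: "\<And>a b. \<alpha> \<le> a \<Longrightarrow> a \<le> b \<Longrightarrow> b \<le> \<beta> \<Longrightarrow>
      ennreal \<bar>F b - F a - h t * (b - a)\<bar> \<le> (\<integral>\<^sup>+ s\<in>{a..b}. ennreal \<bar>h s - h t\<bar> \<partial>lborel)"
  shows "lin_deriv F t (h t)"
  unfolding lin_deriv_def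
proof (intro allI impI)
  fix e :: real assume "0 < e"
  then obtain \<delta> where \<delta>: "0 < \<delta>" "\<And>r. \<bar>r\<bar> < \<delta> \<Longrightarrow>
      (\<integral>\<^sup>+ s\<in>cball t \<bar>r\<bar>. ennreal \<bar>h s - h t\<bar> \<partial>lborel) \<le> ennreal (e * \<bar>r\<bar>)"
    using lebesgue_pt_real[OF assms(1), of e] by blast
  have "\<bar>F (t + r) - F t - h t * r\<bar> \<le> e * \<bar>r\<bar>" if r: "\<bar>r\<bar> < min \<delta> (min (t - \<alpha>) (\<beta> - t))" for r
  proof -
    define a b where "a = min t (t + r)" and "b = max t (t + r)"
    have "ennreal \<bar>F (t + r) - F t - h t * r\<bar> = ennreal \<bar>F b - F a - h t * (b - a)\<bar>"
      by (rule arg_cong[where f = ennreal]) (cases "0 \<le> r"; auto simp: a_def b_def abs_if algebra_simps)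
    also have "\<dots> \<le> (\<integral>\<^sup>+ s\<in>{a..b}. ennreal \<bar>h s - h t\<bar> \<partial>lborel)"
      using r by (intro F) (auto simp: a_def b_def)
    also have "\<dots> \<le> (\<integral>\<^sup>+ s\<in>cball t \<bar>r\<bar>. ennreal \<bar>h s - h t\<bar> \<partial>lborel)"
      by (intro nn_integral_mono mult_left_mono indicator_leI) (auto simp: a_def b_def dist_real_def)
    also have "\<dots> \<le> ennreal (e * \<bar>r\<bar>)" using \<delta>(2) r by simp
    finally show ?thesis using \<open>0 < e\<close> by (subst (asm) ennreal_le_iff) auto
  qed
  then show "\<exists>\<delta>>0. \<forall>r. \<bar>r\<bar> < \<delta> \<longrightarrow> \<bar>F (t + r) - F t - h t * r\<bar> \<le> e * \<bar>r\<bar>"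
    using \<delta>(1) assms(2,3) by (intro exI[of _ "min \<delta> (min (t - \<alpha>) (\<beta> - t))"]) auto
qed

text \<open>Counterpart for curves in a metric space: the speed is bounded from above by the value
  of the length density at a Lebesgue point.\<close>

lemma lebesgue_pt_dist_bound:
  fixes \<phi> :: "real \<Rightarrow> 'a::metric_space"
  assumes "lebesgue_pt h t" "\<alpha> < t" "t < \<beta>" and h[measurable]: "h \<in> borel_measurable borel" and h0: "\<And>s. 0 \<le> h s"
    and F: "\<And>a b. \<alpha> \<le> a \<Longrightarrow> a \<le> b \<Longrightarrow> b \<le> \<beta> \<Longrightarrow>
      ennreal (dist (\<phi> a) (\<phi> b)) \<le> (\<integral>\<^sup>+ s\<in>{a..b}. ennreal (h s) \<partial>lborel)"
    and "0 < e"
  obtains \<delta> where "0 < \<delta>" "\<And>r. \<bar>r\<bar> < \<delta> \<Longrightarrow> dist (\<phi> (t + r)) (\<phi> t) \<le> (h t + e) * \<bar>r\<bar>"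
proof -
  obtain \<delta> where \<delta>: "0 < \<delta>" "\<And>r. \<bar>r\<bar> < \<delta> \<Longrightarrow>
      (\<integral>\<^sup>+ s\<in>cball t \<bar>r\<bar>. ennreal \<bar>h s - h t\<bar> \<partial>lborel) \<le> ennreal (e * \<bar>r\<bar>)"
    using lebesgue_pt_real[OF assms(1) \<open>0 < e\<close>] by blast
  have "dist (\<phi> (t + r)) (\<phi> t) \<le> (h t + e) * \<bar>r\<bar>" if r: "\<bar>r\<bar> < min \<delta> (min (t - \<alpha>) (\<beta> - t))" for r
  proof -
    define a b where "a = min t (t + r)" and "b = max t (t + r)"
    have "ennreal (dist (\<phi> (t + r)) (\<phi> t)) = ennreal (dist (\<phi> a) (\<phi> b))"
      by (cases "0 \<le> r") (auto simp: a_def b_def dist_commute)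
    also have "\<dots> \<le> (\<integral>\<^sup>+ s\<in>{a..b}. ennreal (h s) \<partial>lborel)"
      using r by (intro F) (auto simp: a_def b_def)
    also have "\<dots> \<le> (\<integral>\<^sup>+ s. ennreal \<bar>h s - h t\<bar> * indicator (cball t \<bar>r\<bar>) s
        + ennreal (h t) * indicator {a..b} s \<partial>lborel)"
      using h0 by (intro nn_integral_mono)
        (auto simp: a_def b_def dist_real_def indicator_def simp flip: ennreal_plus)
    also have "\<dots> = (\<integral>\<^sup>+ s\<in>cball t \<bar>r\<bar>. ennreal \<bar>h s - h t\<bar> \<partial>lborel) + ennreal (h t) * emeasure lborel {a..b}"
      by (subst nn_integral_add) (auto simp: nn_integral_cmult cball_eq_atLeastAtMost)
    also have "emeasure lborel {a..b} = ennreal \<bar>r\<bar>"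
      by (cases "0 \<le> r") (auto simp: a_def b_def)
    also have "(\<integral>\<^sup>+ s\<in>cball t \<bar>r\<bar>. ennreal \<bar>h s - h t\<bar> \<partial>lborel) + ennreal (h t) * ennreal \<bar>r\<bar>
        \<le> ennreal (e * \<bar>r\<bar>) + ennreal (h t) * ennreal \<bar>r\<bar>"
      using \<delta>(2) r by (intro add_right_mono) simp
    also have "\<dots> = ennreal ((h t + e) * \<bar>r\<bar>)"
      using h0[of t] \<open>0 < e\<close> by (simp add: algebra_simps flip: ennreal_mult ennreal_plus)
    finally show ?thesis using h0[of t] \<open>0 < e\<close> by (subst (asm) ennreal_le_iff) auto
  qed
  then show thesis
    using \<delta>(1) assms(2,3) by (intro that[of "min \<delta> (min (t - \<alpha>) (\<beta> - t))"]) auto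
qed

text \<open>The last inequality is the fundamental theorem of calculus for \<open>F - c t\<close>, stated so that
  no integrability of \<open>p\<close> has to be carried around.\<close>
lemma ac_derivative:
  fixes F g :: "real \<Rightarrow> real"
  assumes [measurable]: "g \<in> borel_measurable borel" and g0: "\<And>t. 0 \<le> g t" and "\<alpha> < \<beta>"
    and fin: "(\<integral>\<^sup>+ t\<in>{\<alpha>..\<beta>}. ennreal (g t) \<partial>lborel) < \<infinity>"
    and F: "\<And>a b. \<alpha> \<le> a \<Longrightarrow> a \<le> b \<Longrightarrow> b \<le> \<beta> \<Longrightarrow>
      ennreal \<bar>F b - F a\<bar> \<le> (\<integral>\<^sup>+ t\<in>{a..b}. ennreal (g t) \<partial>lborel)"
  obtains p where "p \<in> borel_measurable borel"
    "AE t in lborel. \<alpha> < t \<and> t < \<beta> \<longrightarrow> lin_deriv F t (p t) \<and> \<bar>p t\<bar> \<le> g t"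
    "\<And>a b c. \<alpha> \<le> a \<Longrightarrow> a \<le> b \<Longrightarrow> b \<le> \<beta> \<Longrightarrow>
      ennreal \<bar>F b - F a - c * (b - a)\<bar> \<le> (\<integral>\<^sup>+ t\<in>{a..b}. ennreal \<bar>p t - c\<bar> \<partial>lborel)"
proof -
  \<comment> \<open>Clamping the argument to \<open>[\<alpha>, \<beta>]\<close> and cutting off
    \<open>g\<close> turn the local hypothesis into the global one that \<open>ac_density\<close>
    expects.\<close>
  define cl where "cl t = max \<alpha> (min \<beta> t)" for t
  define F' where "F' t = F (cl t)" for t
  define g' where "g' t = indicator {\<alpha>..\<beta>} t * g t" for t
  have [measurable]: "g' \<in> borel_measurable borel" unfolding g'_def by measurable
  have g'0: "0 \<le> g' t" for t using g0 by (simp add: g'_def)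
  have eg': "ennreal (g' t) = ennreal (g t) * indicator {\<alpha>..\<beta>} t" for t
    by (auto simp: g'_def indicator_def)
  have g'fin: "(\<integral>\<^sup>+ t. ennreal (g' t) \<partial>lborel) < \<infinity>" using fin by (simp add: eg')
  have F': "ennreal \<bar>F' b - F' a\<bar> \<le> (\<integral>\<^sup>+ t\<in>{a..b}. ennreal (g' t) \<partial>lborel)" if "a \<le> b" for a b
  proof (cases "cl a = cl b")
    case True
    then show ?thesis by (simp add: F'_def)
  next
    case False
    have "ennreal \<bar>F' b - F' a\<bar> \<le> (\<integral>\<^sup>+ t\<in>{cl a..cl b}. ennreal (g t) \<partial>lborel)"
      unfolding F'_def using that \<open>\<alpha> < \<beta>\<close> by (intro F) (auto simp: cl_def)
    also have "\<dots> \<le> (\<integral>\<^sup>+ t\<in>{a..b}. ennreal (g' t) \<partial>lborel)"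
      using that False \<open>\<alpha> < \<beta>\<close> unfolding eg' cl_def
      by (intro nn_integral_mono) (auto simp: indicator_def max_def min_def split: if_splits)
    finally show ?thesis .
  qed
  obtain p where p: "integrable lborel p" "\<And>a b. a \<le> b \<Longrightarrow> F' b - F' a = (LINT t:{a<..b}|lborel. p t)"
    using ac_density[of g' F', OF _ g'0 g'fin F'] by auto
  have [measurable]: "p \<in> borel_measurable borel" using p(1) by simp
  have ftc: "ennreal \<bar>F' b - F' a - c * (b - a)\<bar> \<le> (\<integral>\<^sup>+ t\<in>{a..b}. ennreal \<bar>p t - c\<bar> \<partial>lborel)"
    if ab: "a \<le> b" for a b c
  proof -
    have sp: "set_integrable lborel {a<..b} p"
      using p(1) integrable_mult_indicator[of "{a<..b}" lborel p] by (simp add: set_integrable_def)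
    have sc: "set_integrable lborel {a<..b} (\<lambda>_. c)"
      unfolding set_integrable_def by (intro integrable_scaleR_left integrable_real_indicator) (use ab in auto)
    have "F' b - F' a - c * (b - a) = (LINT t:{a<..b}|lborel. p t - c)"
      unfolding p(2)[OF ab] using ab by (subst set_integral_diff(2)[OF sp sc]) (auto simp: set_lebesgue_integral_def)
    then have "ennreal \<bar>F' b - F' a - c * (b - a)\<bar> = ennreal (norm (LINT t:{a<..b}|lborel. p t - c))"
      by simp
    also have "\<dots> \<le> (\<integral>\<^sup>+ t. ennreal (norm (indicator {a<..b} t *\<^sub>R (p t - c))) \<partial>lborel)"
      unfolding set_lebesgue_integral_def
      using set_integral_diff(1)[OF sp sc] by (intro integral_norm_bound_ennreal) (simp add: set_integrable_def)
    also have "\<dots> \<le> (\<integral>\<^sup>+ t\<in>{a..b}. ennreal \<bar>p t - c\<bar> \<partial>lborel)"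
      by (intro nn_integral_mono) (auto simp: indicator_def)
    finally show ?thesis .
  qed
  have ftcF: "ennreal \<bar>F b - F a - c * (b - a)\<bar> \<le> (\<integral>\<^sup>+ t\<in>{a..b}. ennreal \<bar>p t - c\<bar> \<partial>lborel)"
    if "\<alpha> \<le> a" "a \<le> b" "b \<le> \<beta>" for a b c
  proof -
    have "cl a = a" "cl b = b" using that by (auto simp: cl_def)
    then show ?thesis using ftc[of a b c] that by (simp add: F'_def)
  qed
  have "AE t in lborel. lebesgue_pt p t"
    using p(1) by (intro AE_lebesgue_pt) (auto simp: integrable_iff_bounded)
  moreover have "AE t in lborel. lebesgue_pt g' t"
    using g'fin g'0 by (intro AE_lebesgue_pt) auto
  ultimately have "AE t in lborel. \<alpha> < t \<and> t < \<beta> \<longrightarrow> lin_deriv F t (p t) \<and> \<bar>p t\<bar> \<le> g t"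
  proof eventually_elim
    case (elim t)
    show ?case
    proof (intro impI conjI)
      assume t: "\<alpha> < t \<and> t < \<beta>"
      then show d: "lin_deriv F t (p t)"
        using elim(1) ftcF by (intro lebesgue_pt_lin_deriv[of p t \<alpha> \<beta>]) auto
      have gt: "g' t = g t" using t by (simp add: g'_def)
      \<comment> \<open>At a common Lebesgue point of \<open>p\<close> and \<open>g'\<close> the
        difference quotients of \<open>F\<close> tend to \<open>p t\<close>, and in the limit they
        are bounded by \<open>g t\<close>.\<close>
      show "\<bar>p t\<bar> \<le> g t"
      proof (rule field_le_epsilon)
        fix e :: real assume "0 < e"
        then have e2: "0 < e / 2" by simp
        obtain \<delta>1 where \<delta>1: "0 < \<delta>1" "\<And>r. \<bar>r\<bar> < \<delta>1 \<Longrightarrow> \<bar>F (t + r) - F t - p t * r\<bar> \<le> e / 2 * \<bar>r\<bar>"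
          using d e2 unfolding lin_deriv_def by blast
        obtain \<delta>2 where \<delta>2: "0 < \<delta>2" "\<And>r. \<bar>r\<bar> < \<delta>2 \<Longrightarrow> dist (F' (t + r)) (F' t) \<le> (g' t + e / 2) * \<bar>r\<bar>"
          using t F' \<open>0 < e\<close> by (rule_tac lebesgue_pt_dist_bound[OF elim(2), of \<alpha> \<beta> F' "e/2"])
            (auto simp: g'0 dist_real_def abs_minus_commute)
        define r where "r = min (min \<delta>1 \<delta>2) (\<beta> - t) / 2"
        have r: "0 < r" "r < \<delta>1" "r < \<delta>2" "t + r < \<beta>"
          using t \<delta>1(1) \<delta>2(1) by (auto simp: r_def min_def field_simps)
        have "\<bar>F (t + r) - F t\<bar> \<le> (g t + e / 2) * r"
          using \<delta>2(2)[of r] r t by (simp add: F'_def cl_def dist_real_def gt min_def max_def)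
        moreover have "\<bar>F (t + r) - F t - p t * r\<bar> \<le> e / 2 * r"
          using \<delta>1(2)[of r] r by simp
        ultimately have "\<bar>p t * r\<bar> \<le> (g t + e) * r" by (auto simp: algebra_simps abs_if split: if_splits)
        then show "\<bar>p t\<bar> \<le> g t + e" using r by (simp add: abs_mult)
      qed
    qed
  qed
  then show thesis using ftcF by (intro that[of p]) auto
qed

section \<open>Directional derivatives\<close>

lemma ball_borel [measurable]: "ball x r \<in> sets borel" and cball_borel [measurable]: "cball x r \<in> sets borel"
  by simp_all

text \<open>Unifies two notions. With \<open>b = 0\<close> it says that \<open>\<phi>\<close>,
  vanishing at 0, has derivative \<open>a\<close> there; with \<open>a = 0\<close> it bounds the
  upper limit of \<open>\<bar>\<phi> r\<bar> / \<bar>r\<bar>\<close> by \<open>b\<close>.\<close>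

definition deriv_bound :: "(real \<Rightarrow> real) \<Rightarrow> real \<Rightarrow> real \<Rightarrow> bool" where
  "deriv_bound \<phi> a b \<longleftrightarrow>
     (\<forall>e>0. \<exists>\<delta>>0. \<forall>r. \<bar>r\<bar> < \<delta> \<longrightarrow> \<bar>\<phi> r - a * r\<bar> \<le> (b + e) * \<bar>r\<bar>)"

lemma lin_deriv_iff: "lin_deriv F t D \<longleftrightarrow> deriv_bound (\<lambda>r. F (t + r) - F t) D 0"
  by (simp add: lin_deriv_def deriv_bound_def)

lemma continuous_le_from_rat:
  fixes f g :: "real \<Rightarrow> real"
  assumes "continuous_on UNIV f" "continuous_on UNIV g"
    and rat: "\<And>q::rat. \<bar>of_rat q\<bar> < \<delta> \<Longrightarrow> f (of_rat q) \<le> g (of_rat q)" and "\<bar>r\<bar> < \<delta>"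
  shows "f r \<le> g r"
proof (rule ccontr)
  assume "\<not> f r \<le> g r"
  then have "r \<in> {s. g s < f s} \<inter> {-\<delta><..<\<delta>}" using \<open>\<bar>r\<bar> < \<delta>\<close> by auto
  moreover have "open ({s. g s < f s} \<inter> {-\<delta><..<\<delta>})"
    using assms(1,2) by (intro open_Int open_Collect_less) auto
  ultimately obtain e where e: "0 < e" "ball r e \<subseteq> {s. g s < f s} \<inter> {-\<delta><..<\<delta>}"
    by (meson openE)
  obtain q where "q \<in> \<rat>" "r < q" "q < r + e" using Rats_dense_in_real[of r "r + e"] e by auto
  then obtain q' where "q = of_rat q'" "of_rat q' \<in> ball r e" by (auto simp: Rats_def dist_real_def)
  from subsetD[OF e(2) this(2)] have "\<bar>of_rat q'\<bar> < \<delta>" "g (of_rat q') < f (of_rat q')"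
    by (simp_all del: abs_of_rat add: abs_less_iff)
  with rat[of q'] show False by simp
qed

text \<open>All quantifiers become countable: \<open>e\<close> runs through 1/(k+1), the scale
  through 1/(n+1), and \<open>r\<close> through the rationals, the last by continuity in
  \<open>r\<close>.\<close>

lemma sets_deriv_bound:
  fixes \<phi> :: "complex \<Rightarrow> real \<Rightarrow> real"
  assumes meas: "\<And>r. (\<lambda>z. \<phi> z r) \<in> borel_measurable borel"
    and cont: "\<And>z. continuous_on UNIV (\<phi> z)"
    and [measurable]: "A \<in> borel_measurable borel" "B \<in> borel_measurable borel"
  shows "{z. deriv_bound (\<phi> z) (A z) (B z)} \<in> sets borel"
proof -
  have "{z. deriv_bound (\<phi> z) (A z) (B z)} = (\<Inter>k::nat. \<Union>n::nat. \<Inter>q::rat\<in>{q. \<bar>of_rat q\<bar> < 1 / real (Suc n)}.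
      {z \<in> space borel. \<bar>\<phi> z (of_rat q) - A z * of_rat q\<bar> \<le> (B z + 1 / real (Suc k)) * \<bar>of_rat q\<bar>})" (is "?L = ?R")
  proof (intro equalityI subsetI)
    fix z assume "z \<in> ?L"
    then have z: "\<And>e. 0 < e \<Longrightarrow> \<exists>\<delta>>0. \<forall>r. \<bar>r\<bar> < \<delta> \<longrightarrow> \<bar>\<phi> z r - A z * r\<bar> \<le> (B z + e) * \<bar>r\<bar>"
      by (simp add: deriv_bound_def)
    show "z \<in> ?R"
    proof (rule INT_I)
      fix k :: nat
      obtain \<delta> where \<delta>: "0 < \<delta>" "\<And>r. \<bar>r\<bar> < \<delta> \<Longrightarrow> \<bar>\<phi> z r - A z * r\<bar> \<le> (B z + 1 / real (Suc k)) * \<bar>r\<bar>"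
        using z[of "1 / real (Suc k)"] by auto
      obtain n where n: "1 / real (Suc n) < \<delta>" using \<delta>(1) nat_approx_posE by blast
      show "z \<in> (\<Union>n::nat. \<Inter>q::rat\<in>{q. \<bar>of_rat q\<bar> < 1 / real (Suc n)}.
          {z \<in> space borel. \<bar>\<phi> z (of_rat q) - A z * of_rat q\<bar> \<le> (B z + 1 / real (Suc k)) * \<bar>of_rat q\<bar>})"
      proof (intro UN_I[OF UNIV_I, where a = n] INT_I)
        fix q :: rat assume "q \<in> {q. \<bar>of_rat q\<bar> < 1 / real (Suc n)}"
        then have "\<bar>of_rat q\<bar> < 1 / real (Suc n)" by (rule CollectD)
        from \<delta>(2)[OF less_trans[OF this n]]
        show "z \<in> {z \<in> space borel. \<bar>\<phi> z (of_rat q) - A z * of_rat q\<bar> \<le> (B z + 1 / real (Suc k)) * \<bar>of_rat q\<bar>}"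
          by (simp only: space_borel mem_Collect_eq UNIV_I simp_thms)
      qed
    qed
  next
    fix z assume z: "z \<in> ?R"
    show "z \<in> ?L"
      unfolding deriv_bound_def
    proof (intro CollectI allI impI)
      fix e :: real assume "0 < e"
      then obtain k where k: "1 / real (Suc k) < e" using nat_approx_posE by blast
      from INT_D[OF z UNIV_I, of k] obtain n where
        n': "z \<in> (\<Inter>q::rat\<in>{q. \<bar>of_rat q\<bar> < 1 / real (Suc n)}.
          {z \<in> space borel. \<bar>\<phi> z (of_rat q) - A z * of_rat q\<bar> \<le> (B z + 1 / real (Suc k)) * \<bar>of_rat q\<bar>})"
        by (elim UN_E)
      have n: "\<bar>\<phi> z (of_rat q) - A z * of_rat q\<bar> \<le> (B z + 1 / real (Suc k)) * \<bar>of_rat q\<bar>"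
        if "\<bar>of_rat q\<bar> < 1 / real (Suc n)" for q :: rat
      proof -
        have "q \<in> {q. \<bar>of_rat q\<bar> < 1 / real (Suc n)}" using that by (simp only: mem_Collect_eq)
        from INT_D[OF n' this] show ?thesis by (simp only: mem_Collect_eq)
      qed
      have "\<bar>\<phi> z r - A z * r\<bar> \<le> (B z + e) * \<bar>r\<bar>" if "\<bar>r\<bar> < 1 / real (Suc n)" for r
      proof -
        have "\<bar>\<phi> z r - A z * r\<bar> \<le> (B z + 1 / real (Suc k)) * \<bar>r\<bar>"
          proof (rule continuous_le_from_rat[where f = "\<lambda>r. \<bar>\<phi> z r - A z * r\<bar>"
                and g = "\<lambda>r. (B z + 1 / real (Suc k)) * \<bar>r\<bar>" and \<delta> = "1 / real (Suc n)" and r = r])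
          show "continuous_on UNIV (\<lambda>r. \<bar>\<phi> z r - A z * r\<bar>)" by (intro continuous_intros cont)
          show "continuous_on UNIV (\<lambda>r. (B z + 1 / real (Suc k)) * \<bar>r\<bar>)" by (intro continuous_intros)
        qed (rule n that, assumption?)+
        also have "\<dots> \<le> (B z + e) * \<bar>r\<bar>"
          using k by (intro mult_right_mono) auto
        finally show ?thesis .
      qed
      then show "\<exists>\<delta>>0. \<forall>r. \<bar>r\<bar> < \<delta> \<longrightarrow> \<bar>\<phi> z r - A z * r\<bar> \<le> (B z + e) * \<bar>r\<bar>"
        by (intro exI[of _ "1 / real (Suc n)"]) auto
    qed
  qed
  also have "\<dots> \<in> sets borel"
  proof -
    have W: "{z \<in> space borel. \<bar>\<phi> z (of_rat q) - A z * of_rat q\<bar> \<le> (B z + 1 / real (Suc k)) * \<bar>of_rat q\<bar>} \<in> sets borel"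
      for q :: rat and k :: nat
    proof -
      have [measurable]: "(\<lambda>z. \<phi> z (of_rat q)) \<in> borel_measurable borel" by (rule meas)
      show ?thesis by measurable
    qed
    show ?thesis
      by (rule sets.countable_INT''[OF _ countableI_type sets.countable_UN''[OF countableI_type
            sets.countable_INT''[OF _ countableI_type W]]]) simp_all
  qed
  finally show ?thesis .
qed

lemma deriv_bound_0_limit:
  assumes "deriv_bound \<phi> a 0"
  shows "(\<lambda>n. \<phi> (1 / real (Suc n)) * real (Suc n)) \<longlonglongrightarrow> a"
proof (rule LIMSEQ_I)
  fix e :: real assume "0 < e"
  then obtain \<delta> where \<delta>: "0 < \<delta>" "\<And>r. \<bar>r\<bar> < \<delta> \<Longrightarrow> \<bar>\<phi> r - a * r\<bar> \<le> e / 2 * \<bar>r\<bar>"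
    using assms unfolding deriv_bound_def by (metis add_0 half_gt_zero)
  obtain n0 where n0: "1 / real (Suc n0) < \<delta>" using \<delta>(1) nat_approx_posE by blast
  have "norm (\<phi> (1 / real (Suc n)) * real (Suc n) - a) < e" if "n \<ge> n0" for n
  proof -
    define r where "r = 1 / real (Suc n)"
    have r: "0 < r" "r < \<delta>"
      using that le_less_trans[OF _ n0, of r] by (auto simp: r_def divide_left_mono)
    have "\<phi> r / r - a = (\<phi> r - a * r) / r" using r by (simp add: field_simps)
    then have "\<bar>\<phi> r / r - a\<bar> \<le> e / 2"
      using \<delta>(2)[of r] r by (simp add: divide_le_eq)
    then show ?thesis using \<open>0 < e\<close> by (simp add: r_def)
  qed
  then show "\<exists>no. \<forall>n\<ge>no. norm (\<phi> (1 / real (Suc n)) * real (Suc n) - a) < e" by blast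
qed

definition rat_point :: "rat \<times> rat \<Rightarrow> complex" where
  "rat_point i = Complex (of_rat (fst i)) (of_rat (snd i))"

lemma rat_point_dense:
  assumes "0 < e"
  shows "\<exists>i. dist (rat_point i) z < e"
proof -
  obtain a where a: "a \<in> \<rat>" "Re z < a" "a < Re z + e / 2" using Rats_dense_in_real[of "Re z" "Re z + e / 2"] assms by auto
  obtain b where b: "b \<in> \<rat>" "Im z < b" "b < Im z + e / 2" using Rats_dense_in_real[of "Im z" "Im z + e / 2"] assms by auto
  obtain a' b' where ab: "a = of_rat a'" "b = of_rat b'" using a b by (auto simp: Rats_def)
  have "dist (rat_point (a', b')) z \<le> \<bar>a - Re z\<bar> + \<bar>b - Im z\<bar>"
    using cmod_le[of "Complex a b - z"] by (simp add: rat_point_def ab dist_norm)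
  then show ?thesis using a b by (intro exI[of _ "(a', b')"]) auto
qed

text \<open>What is retained of the Sobolev hypothesis. Continuity of \<open>U\<close> on the whole
  plane makes the sets defined through \<open>U\<close> Borel, and \<open>\<gamma>\<close> is
  real-valued and zero off the disc, so that it can be integrated over entire lines and over the
  plane.\<close>

locale line_sobolev =
  fixes U :: "complex \<Rightarrow> 'a::metric_space" and \<gamma> :: "complex \<Rightarrow> real"
  assumes cont_U: "continuous_on UNIV U"
    and \<gamma>_borel [measurable]: "\<gamma> \<in> borel_measurable borel"
    and \<gamma>_nonneg: "\<And>z. 0 \<le> \<gamma> z"
    and \<gamma>_outside: "\<And>z. z \<notin> ball 0 1 \<Longrightarrow> \<gamma> z = 0"
    and \<gamma>_L2: "(\<integral>\<^sup>+ z. ennreal (\<gamma> z) ^ 2 \<partial>lborel) < \<infinity>"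
    and lines: "\<And>p v. unimodular p v \<Longrightarrow> AE y in lborel. \<forall>a b. a \<le> b \<longrightarrow>
      (\<forall>t\<in>{a..b}. chart p v y t \<in> ball 0 1) \<longrightarrow>
      ennreal (dist (U (chart p v y a)) (U (chart p v y b)))
        \<le> (\<integral>\<^sup>+ t\<in>{a..b}. ennreal (norm v * \<gamma> (chart p v y t)) \<partial>lborel)"
begin

lemma continuous_U [continuous_intros]: "continuous_on S f \<Longrightarrow> continuous_on S (\<lambda>x. U (f x))"
  using continuous_on_compose2[OF cont_U] by blast

text \<open>By density of the rational points, the \<open>coord i\<close> embed the image of \<open>U\<close> isometrically into
  the bounded functions.\<close>
definition coord :: "rat \<times> rat \<Rightarrow> complex \<Rightarrow> real" where
  "coord i z = dist (U z) (U (rat_point i))"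

lemma continuous_coord [continuous_intros]:
  "continuous_on S f \<Longrightarrow> continuous_on S (\<lambda>x. coord i (f x))"
  unfolding coord_def by (intro continuous_intros)

lemma coord_borel [measurable]: "coord i \<in> borel_measurable borel"
  by (intro borel_measurable_continuous_onI continuous_intros)

lemma coord_diff_le: "\<bar>coord i z - coord i w\<bar> \<le> dist (U z) (U w)"
  using dist_triangle[of "U z" "U (rat_point i)" "U w"] dist_triangle[of "U w" "U (rat_point i)" "U z"]
  by (simp add: coord_def dist_commute abs_le_iff)

text \<open>For a rational point close to \<open>z\<close>, \<open>coord i z\<close> is nearly 0 and
  \<open>coord i w\<close> is nearly the distance in question.\<close>

lemma dist_U_le_coord:
  assumes "\<And>i. \<bar>coord i z - coord i w\<bar> \<le> c"
  shows "dist (U z) (U w) \<le> c"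
proof (rule field_le_epsilon)
  fix e :: real assume "0 < e"
  have "isCont U z" using cont_U by (simp add: continuous_on_eq_continuous_at)
  then obtain d where d: "0 < d" "\<And>x. dist x z < d \<Longrightarrow> dist (U x) (U z) < e / 2"
    using \<open>0 < e\<close> unfolding continuous_at_eps_delta by (meson half_gt_zero)
  obtain i where "dist (rat_point i) z < d" using rat_point_dense d(1) by blast
  then have i: "dist (U (rat_point i)) (U z) < e / 2" by (rule d(2))
  have "dist (U z) (U w) \<le> dist (U (rat_point i)) (U z) + dist (U (rat_point i)) (U w)"
    by (rule dist_triangle3)
  then show "dist (U z) (U w) \<le> c + e"
    using i assms[of i] by (simp add: coord_def dist_commute)
qed

text \<open>Directional derivative of \<open>coord i\<close> along \<open>v\<close>, taken as a
  limit over the steps 1/(n+1): this makes it total and Borel before any differentiability is known,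
  and \<open>ddir_eq\<close> identifies it wherever the derivative exists.\<close>

definition ddir :: "complex \<Rightarrow> rat \<times> rat \<Rightarrow> complex \<Rightarrow> real" where
  "ddir v i z = lim (\<lambda>n. (coord i (z + of_real (1 / real (Suc n)) * v) - coord i z) * real (Suc n))"

lemma ddir_borel [measurable]: "ddir v i \<in> borel_measurable borel"
  unfolding ddir_def by measurable

lemma ddir_eq:
  assumes "deriv_bound (\<lambda>r. coord i (z + of_real r * v) - coord i z) D 0"
  shows "ddir v i z = D"
  unfolding ddir_def using deriv_bound_0_limit[OF assms] by (rule limI)

lemma \<gamma>_L1: "(\<integral>\<^sup>+ z. ennreal (\<gamma> z) \<partial>lborel) < \<infinity>"
proof -
  have "(\<integral>\<^sup>+ z. ennreal (\<gamma> z) \<partial>lborel) \<le> (\<integral>\<^sup>+ z. indicator (ball 0 1) z + ennreal (\<gamma> z) ^ 2 \<partial>lborel)"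
  proof (intro nn_integral_mono)
    fix z
    have "\<gamma> z \<le> 1 + (\<gamma> z)\<^sup>2"
      using zero_le_power2[of "\<gamma> z - 1"] \<gamma>_nonneg[of z] unfolding power2_diff by simp
    then show "ennreal (\<gamma> z) \<le> indicator (ball 0 1) z + ennreal (\<gamma> z) ^ 2"
      using \<gamma>_outside[of z] \<gamma>_nonneg[of z]
      by (cases "z \<in> ball 0 1") (auto simp: indicator_def ennreal_power ennreal_leI simp flip: ennreal_plus ennreal_1)
  qed
  also have "\<dots> = emeasure lborel (ball (0::complex) 1) + (\<integral>\<^sup>+ z. ennreal (\<gamma> z) ^ 2 \<partial>lborel)"
    by (subst nn_integral_add) simp_all
  also have "\<dots> < \<infinity>" using \<gamma>_L2 emeasure_lborel_ball_finite[of "0::complex" 1] by simp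
  finally show ?thesis .
qed

lemma AE_line_L1:
  assumes um: "unimodular p v"
  shows "AE y in lborel. (\<integral>\<^sup>+ t. ennreal (\<gamma> (chart p v y t)) \<partial>lborel) < \<infinity>"
proof -
  have "(\<integral>\<^sup>+ y. \<integral>\<^sup>+ t. ennreal (\<gamma> (chart p v y t)) \<partial>lborel \<partial>lborel) < \<infinity>"
    using \<gamma>_L1 by (subst unimodularD[OF um, symmetric]) auto
  then have "AE y in lborel. (\<integral>\<^sup>+ t. ennreal (\<gamma> (chart p v y t)) \<partial>lborel) \<noteq> \<infinity>"
    by (intro nn_integral_PInf_AE) auto
  then show ?thesis by eventually_elim (simp add: less_top)
qed

lemma chart_segment:
  "chart p v y t + of_real r * v = chart p v y (t + r)"
  by (simp add: chart_def algebra_simps)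

text \<open>\<open>ac_derivative\<close>, applied to \<open>coord i\<close> on segments inside the
  disc. The free constant \<open>c\<close> has two uses: \<open>c = 0\<close> bounds increments by
  the derivative, and \<open>c\<close> equal to the derivative at a fixed point measures the
  deviation from linearity.\<close>

lemma line_derivative:
  assumes um: "unimodular p v"
  shows "AE y in lborel.
    (\<forall>a b i c. a \<le> b \<longrightarrow> (\<forall>t\<in>{a..b}. chart p v y t \<in> ball 0 1) \<longrightarrow>
      ennreal \<bar>coord i (chart p v y b) - coord i (chart p v y a) - c * (b - a)\<bar>
        \<le> (\<integral>\<^sup>+ t\<in>{a..b}. ennreal \<bar>ddir v i (chart p v y t) - c\<bar> \<partial>lborel)) \<and>
    (AE t in lborel. chart p v y t \<in> ball 0 1 \<longrightarrow> (\<forall>i.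
      deriv_bound (\<lambda>r. coord i (chart p v y t + of_real r * v) - coord i (chart p v y t)) (ddir v i (chart p v y t)) 0 \<and>
      \<bar>ddir v i (chart p v y t)\<bar> \<le> norm v * \<gamma> (chart p v y t)))"
  using lines[OF um] AE_line_L1[OF um]
proof eventually_elim
  case (elim y)
  let ?c = "chart p v y"
  define Q where "Q i t \<longleftrightarrow> deriv_bound (\<lambda>r. coord i (?c t + of_real r * v) - coord i (?c t)) (ddir v i (?c t)) 0 \<and>
      \<bar>ddir v i (?c t)\<bar> \<le> norm v * \<gamma> (?c t)" for i t
  have local: "(AE t in lborel. a < t \<and> t < b \<longrightarrow> Q i t) \<and>
      (\<forall>c. ennreal \<bar>coord i (?c b) - coord i (?c a) - c * (b - a)\<bar>
        \<le> (\<integral>\<^sup>+ t\<in>{a..b}. ennreal \<bar>ddir v i (?c t) - c\<bar> \<partial>lborel))"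
    if ab: "a < b" "\<forall>t\<in>{a..b}. ?c t \<in> ball 0 1" for a b i
  proof -
    obtain q where q: "q \<in> borel_measurable borel"
      "AE t in lborel. a < t \<and> t < b \<longrightarrow> lin_deriv (\<lambda>t. coord i (?c t)) t (q t) \<and> \<bar>q t\<bar> \<le> norm v * \<gamma> (?c t)"
      "\<And>a' b' c. a \<le> a' \<Longrightarrow> a' \<le> b' \<Longrightarrow> b' \<le> b \<Longrightarrow>
        ennreal \<bar>coord i (?c b') - coord i (?c a') - c * (b' - a')\<bar> \<le> (\<integral>\<^sup>+ t\<in>{a'..b'}. ennreal \<bar>q t - c\<bar> \<partial>lborel)"
    proof (rule ac_derivative[of "\<lambda>t. norm v * \<gamma> (?c t)" a b "\<lambda>t. coord i (?c t)"])
      have "(\<integral>\<^sup>+ t\<in>{a..b}. ennreal (norm v * \<gamma> (?c t)) \<partial>lborel) \<le> ennreal (norm v) * (\<integral>\<^sup>+ t. ennreal (\<gamma> (?c t)) \<partial>lborel)"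
        by (subst nn_integral_cmult[symmetric])
          (auto simp: indicator_def ennreal_mult' intro!: nn_integral_mono)
      also have "\<dots> < \<infinity>" using elim(2) by (simp add: ennreal_mult_less_top)
      finally show "(\<integral>\<^sup>+ t\<in>{a..b}. ennreal (norm v * \<gamma> (?c t)) \<partial>lborel) < \<infinity>" .
      fix a' b' assume *: "a \<le> a'" "a' \<le> b'" "b' \<le> b"
      have "ennreal \<bar>coord i (?c b') - coord i (?c a')\<bar> \<le> ennreal (dist (U (?c a')) (U (?c b')))"
        using coord_diff_le[of i "?c b'" "?c a'"] by (intro ennreal_leI) (simp add: dist_commute)
      also have "\<dots> \<le> (\<integral>\<^sup>+ t\<in>{a'..b'}. ennreal (norm v * \<gamma> (?c t)) \<partial>lborel)"
        using elim(1) * ab(2) by auto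
      finally show "ennreal \<bar>coord i (?c b') - coord i (?c a')\<bar> \<le> \<dots>" .
    qed (use ab \<gamma>_nonneg in auto)
    have "AE t in lborel. a < t \<and> t < b \<longrightarrow> Q i t \<and> q t = ddir v i (?c t)"
      using q(2)
    proof (eventually_elim, intro impI)
      fix t assume h: "a < t \<and> t < b \<longrightarrow> lin_deriv (\<lambda>t. coord i (?c t)) t (q t) \<and> \<bar>q t\<bar> \<le> norm v * \<gamma> (?c t)"
        and t: "a < t \<and> t < b"
      then have db: "deriv_bound (\<lambda>r. coord i (?c t + of_real r * v) - coord i (?c t)) (q t) 0"
        by (simp add: lin_deriv_iff chart_segment)
      from ddir_eq[OF this] db h t show "Q i t \<and> q t = ddir v i (?c t)"
        by (simp add: Q_def)
    qed
    moreover have "AE t in lborel. t \<noteq> a" "AE t in lborel. t \<noteq> b"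
      by (rule AE_lborel_singleton)+
    ultimately have ae: "AE t in lborel. t \<in> {a..b} \<longrightarrow> Q i t \<and> q t = ddir v i (?c t)"
      by eventually_elim auto
    have "ennreal \<bar>coord i (?c b) - coord i (?c a) - c * (b - a)\<bar>
        \<le> (\<integral>\<^sup>+ t\<in>{a..b}. ennreal \<bar>ddir v i (?c t) - c\<bar> \<partial>lborel)" for c
    proof -
      have "(\<integral>\<^sup>+ t\<in>{a..b}. ennreal \<bar>q t - c\<bar> \<partial>lborel) = (\<integral>\<^sup>+ t\<in>{a..b}. ennreal \<bar>ddir v i (?c t) - c\<bar> \<partial>lborel)"
        by (intro nn_integral_cong_AE, use ae in eventually_elim) (auto simp: indicator_def)
      then show ?thesis using q(3)[of a b c] ab(1) by simp
    qed
    moreover have "AE t in lborel. a < t \<and> t < b \<longrightarrow> Q i t"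
      using ae by eventually_elim auto
    ultimately show ?thesis by blast
  qed
  \<comment> \<open>The part of the line in the open disc is a union of countably many rational
    intervals, so the exceptional sets of the individual segments combine to one null set.\<close>
  have "AE t in lborel. \<forall>\<alpha> \<beta> :: rat. \<forall>i. \<alpha> < \<beta> \<longrightarrow> (\<forall>s\<in>{of_rat \<alpha>..of_rat \<beta>}. ?c s \<in> ball 0 1) \<longrightarrow>
      of_rat \<alpha> < t \<and> t < of_rat \<beta> \<longrightarrow> Q i t"
    unfolding AE_all_countable
  proof (intro allI)
    fix \<alpha> \<beta> :: rat and i
    show "AE t in lborel. \<alpha> < \<beta> \<longrightarrow> (\<forall>s\<in>{of_rat \<alpha>..of_rat \<beta>}. ?c s \<in> ball 0 1) \<longrightarrow>
      of_rat \<alpha> < t \<and> t < of_rat \<beta> \<longrightarrow> Q i t"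
      using local[of "of_rat \<alpha>" "of_rat \<beta>" i]
      by (cases "\<alpha> < \<beta> \<and> (\<forall>s\<in>{of_rat \<alpha>..of_rat \<beta>}. ?c s \<in> ball 0 1)") (auto simp: of_rat_less)
  qed
  then have "AE t in lborel. ?c t \<in> ball 0 1 \<longrightarrow> (\<forall>i. Q i t)"
  proof (eventually_elim, intro impI allI)
    fix t i assume h: "\<forall>\<alpha> \<beta> :: rat. \<forall>i. \<alpha> < \<beta> \<longrightarrow> (\<forall>s\<in>{of_rat \<alpha>..of_rat \<beta>}. ?c s \<in> ball 0 1) \<longrightarrow>
      of_rat \<alpha> < t \<and> t < of_rat \<beta> \<longrightarrow> Q i t" and t: "?c t \<in> ball 0 1"
    have "open (?c -` ball 0 1)"
      by (intro open_vimage continuous_intros) auto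
    then obtain e where e: "0 < e" "ball t e \<subseteq> ?c -` ball 0 1" using t by (meson openE vimageI)
    obtain \<alpha> where \<alpha>: "\<alpha> \<in> \<rat>" "t - e < \<alpha>" "\<alpha> < t" using Rats_dense_in_real[of "t - e" t] e by auto
    obtain \<beta> where \<beta>: "\<beta> \<in> \<rat>" "t < \<beta>" "\<beta> < t + e" using Rats_dense_in_real[of t "t + e"] e by auto
    obtain \<alpha>' \<beta>' where ab: "\<alpha> = of_rat \<alpha>'" "\<beta> = of_rat \<beta>'" using \<alpha> \<beta> by (auto simp: Rats_def)
    have "{\<alpha>..\<beta>} \<subseteq> ball t e" using \<alpha> \<beta> by (auto simp: dist_real_def)
    then have "\<forall>s\<in>{\<alpha>..\<beta>}. ?c s \<in> ball 0 1" using e by auto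
    moreover have "\<alpha>' < \<beta>'" using \<alpha> \<beta> ab by (metis less_trans of_rat_less)
    ultimately show "Q i t" using h \<alpha> \<beta> unfolding ab by blast
  qed
  moreover have "\<forall>a b i c. a \<le> b \<longrightarrow> (\<forall>t\<in>{a..b}. ?c t \<in> ball 0 1) \<longrightarrow>
      ennreal \<bar>coord i (?c b) - coord i (?c a) - c * (b - a)\<bar>
        \<le> (\<integral>\<^sup>+ t\<in>{a..b}. ennreal \<bar>ddir v i (?c t) - c\<bar> \<partial>lborel)"
  proof (intro allI impI)
    fix a b i c assume "a \<le> b" "\<forall>t\<in>{a..b}. ?c t \<in> ball 0 1"
    then show "ennreal \<bar>coord i (?c b) - coord i (?c a) - c * (b - a)\<bar>
        \<le> (\<integral>\<^sup>+ t\<in>{a..b}. ennreal \<bar>ddir v i (?c t) - c\<bar> \<partial>lborel)"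
      using local[of a b i] by (cases "a = b") auto
  qed
  ultimately show ?case unfolding Q_def by blast
qed

text \<open>The candidate for the metric speed of \<open>U\<close> in direction \<open>v\<close>.
  The supremum in \<open>ennreal\<close> is Borel in any case; \<open>enn2real\<close> turns an
  infinite supremum into 0, hence the next facts assume a common bound on the
  \<open>ddir\<close>.\<close>

definition slope :: "complex \<Rightarrow> complex \<Rightarrow> real" where
  "slope v z = enn2real (SUP i. ennreal \<bar>ddir v i z\<bar>)"

lemma slope_borel [measurable]: "slope v \<in> borel_measurable borel"
  unfolding slope_def by measurable

lemma slope_nonneg: "0 \<le> slope v z"
  by (simp add: slope_def)

lemma
  assumes "\<And>i. \<bar>ddir v i z\<bar> \<le> c"
  shows abs_ddir_le_slope: "\<bar>ddir v i z\<bar> \<le> slope v z"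
    and slope_le: "slope v z \<le> c"
    and slope_approx: "0 < e \<Longrightarrow> \<exists>i. slope v z - e < \<bar>ddir v i z\<bar>"
proof -
  have c: "0 \<le> c" using assms[of i] by simp
  have le: "(SUP i. ennreal \<bar>ddir v i z\<bar>) \<le> ennreal c"
    by (intro SUP_least ennreal_leI assms)
  then have fin: "(SUP i. ennreal \<bar>ddir v i z\<bar>) < top"
    using ennreal_less_top le_less_trans by blast
  then have eq: "ennreal (slope v z) = (SUP i. ennreal \<bar>ddir v i z\<bar>)"
    by (simp add: slope_def)
  have "ennreal \<bar>ddir v i z\<bar> \<le> ennreal (slope v z)" unfolding eq by (rule SUP_upper) simp
  then show "\<bar>ddir v i z\<bar> \<le> slope v z" by (simp add: slope_nonneg)
  show "slope v z \<le> c" using le c unfolding eq[symmetric] by simp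
  show "\<exists>i. slope v z - e < \<bar>ddir v i z\<bar>" if "0 < e"
  proof (rule ccontr)
    assume "\<not> ?thesis"
    then have h: "\<bar>ddir v j z\<bar> \<le> slope v z - e" for j
      by (intro leI) blast
    have "ennreal (slope v z) \<le> ennreal (slope v z - e)" unfolding eq
      using h by (intro SUP_least ennreal_leI) auto
    moreover have "0 \<le> slope v z - e" using h[of i] by (meson abs_ge_zero order_trans)
    ultimately show False using that by simp
  qed
qed

lemma AE_ddir:
  assumes um: "unimodular p v"
  shows "AE z in lborel. z \<in> ball 0 1 \<longrightarrow> (\<forall>i.
      deriv_bound (\<lambda>r. coord i (z + of_real r * v) - coord i z) (ddir v i z) 0 \<and>
      \<bar>ddir v i z\<bar> \<le> norm v * \<gamma> z)"
proof (rule AE_from_chart[OF um])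
  let ?D = "\<lambda>i. {z. deriv_bound (\<lambda>r. coord i (z + of_real r * v) - coord i z) (ddir v i z) 0}"
  have D: "?D i \<in> sets borel" for i
  proof (rule sets_deriv_bound)
    show "(\<lambda>z. coord i (z + of_real r * v) - coord i z) \<in> borel_measurable borel" for r by measurable
    show "continuous_on UNIV (\<lambda>r. coord i (z + of_real r * v) - coord i z)" for z
      by (intro continuous_intros)
  qed simp_all
  have "{z. \<not> (z \<in> ball 0 1 \<longrightarrow> (\<forall>i.
      deriv_bound (\<lambda>r. coord i (z + of_real r * v) - coord i z) (ddir v i z) 0 \<and>
      \<bar>ddir v i z\<bar> \<le> norm v * \<gamma> z))}
    = ball 0 1 \<inter> (\<Union>i. (UNIV - ?D i) \<union> {z \<in> space borel. norm v * \<gamma> z < \<bar>ddir v i z\<bar>})"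
    by (auto simp: not_le)
  also have "\<dots> \<in> sets borel"
  proof (rule sets.Int)
    have "UNIV - ?D i \<in> sets borel" for i
      using sets.compl_sets[OF D[of i]] by simp
    moreover have "{z \<in> space borel. norm v * \<gamma> z < \<bar>ddir v i z\<bar>} \<in> sets borel" for i
      by measurable
    ultimately show "(\<Union>i. (UNIV - ?D i) \<union> {z \<in> space borel. norm v * \<gamma> z < \<bar>ddir v i z\<bar>}) \<in> sets borel"
      by (intro sets.countable_UN'' countableI_type sets.Un)
  qed simp
  finally show "{z. \<not> (z \<in> ball 0 1 \<longrightarrow> (\<forall>i.
      deriv_bound (\<lambda>r. coord i (z + of_real r * v) - coord i z) (ddir v i z) 0 \<and>
      \<bar>ddir v i z\<bar> \<le> norm v * \<gamma> z))} \<in> sets borel" .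
  show "AE y in lborel. AE t in lborel. chart p v y t \<in> ball 0 1 \<longrightarrow> (\<forall>i.
      deriv_bound (\<lambda>r. coord i (chart p v y t + of_real r * v) - coord i (chart p v y t)) (ddir v i (chart p v y t)) 0 \<and>
      \<bar>ddir v i (chart p v y t)\<bar> \<le> norm v * \<gamma> (chart p v y t))"
    using line_derivative[OF um] by eventually_elim blast
qed

text \<open>The increments of every coordinate along the line are at most the integral of
  \<open>slope\<close>, hence so are distances, by \<open>dist_U_le_coord\<close>. At Lebesgue
  points of \<open>slope\<close> on the line this gives the upper estimate; the lower one is
  supplied by a single coordinate in \<open>metric_derivative_slant\<close>.\<close>

lemma AE_slope:
  assumes um: "unimodular p v"
  shows "AE z in lborel. z \<in> ball 0 1 \<longrightarrow>
    deriv_bound (\<lambda>r. dist (U (z + of_real r * v)) (U z)) 0 (slope v z)"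
proof (rule AE_from_chart[OF um])
  let ?P = "\<lambda>z. deriv_bound (\<lambda>r. dist (U (z + of_real r * v)) (U z)) 0 (slope v z)"
  have P: "{z. ?P z} \<in> sets borel"
  proof (rule sets_deriv_bound)
    show "(\<lambda>z. dist (U (z + of_real r * v)) (U z)) \<in> borel_measurable borel" for r
      by (intro borel_measurable_continuous_onI continuous_intros)
    show "continuous_on UNIV (\<lambda>r. dist (U (z + of_real r * v)) (U z))" for z
      by (intro continuous_intros)
  qed simp_all
  have "{z. \<not> (z \<in> ball 0 1 \<longrightarrow> ?P z)} = ball 0 1 \<inter> (UNIV - {z. ?P z})" by auto
  also have "\<dots> \<in> sets borel"
    using sets.compl_sets[OF P] by (intro sets.Int) simp_all
  finally show "{z. \<not> (z \<in> ball 0 1 \<longrightarrow> ?P z)} \<in> sets borel" .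
  show "AE y in lborel. AE t in lborel. chart p v y t \<in> ball 0 1 \<longrightarrow> ?P (chart p v y t)"
    using line_derivative[OF um] AE_line_L1[OF um]
  proof eventually_elim
    case (elim y)
    let ?c = "chart p v y"
    define h where "h t = indicator (ball 0 1) (?c t) * slope v (?c t)" for t
    have [measurable]: "h \<in> borel_measurable borel" unfolding h_def by measurable
    have h0: "0 \<le> h t" for t by (simp add: h_def slope_nonneg)
    have bd: "AE t in lborel. ?c t \<in> ball 0 1 \<longrightarrow> (\<forall>i. \<bar>ddir v i (?c t)\<bar> \<le> norm v * \<gamma> (?c t))"
      using elim(1)[THEN conjunct2] by eventually_elim blast
    have hle: "AE t in lborel. h t \<le> norm v * \<gamma> (?c t)"
      using bd
    proof eventually_elim
      case (elim t)
      then show ?case using slope_le[of v "?c t" "norm v * \<gamma> (?c t)"] \<gamma>_nonneg[of "?c t"]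
        by (auto simp: h_def indicator_def)
    qed
    have "(\<integral>\<^sup>+ t. ennreal \<bar>h t\<bar> \<partial>lborel) \<le> (\<integral>\<^sup>+ t. ennreal (norm v) * ennreal (\<gamma> (?c t)) \<partial>lborel)"
      by (intro nn_integral_mono_AE, use hle in eventually_elim)
        (use h0 in \<open>auto simp: ennreal_leI simp flip: ennreal_mult'\<close>)
    also have "\<dots> < \<infinity>" using elim(2) by (simp add: nn_integral_cmult ennreal_mult_less_top)
    finally have "AE t in lborel. lebesgue_pt h t" by (intro AE_lebesgue_pt) auto
    then show ?case
    proof (eventually_elim, intro impI)
      fix t assume lp: "lebesgue_pt h t" and t: "?c t \<in> ball 0 1"
      have "open (?c -` ball 0 1)"
        by (intro open_vimage continuous_intros) auto
      then obtain d where d: "0 < d" "cball t d \<subseteq> ?c -` ball 0 1"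
        using t by (meson open_contains_cball vimageI)
      have cb: "cball t d = {t - d..t + d}" by (rule cball_eq_atLeastAtMost)
      show "?P (?c t)"
        unfolding deriv_bound_def
      proof (intro allI impI)
        fix e :: real assume "0 < e"
        obtain \<delta> where \<delta>: "0 < \<delta>" "\<And>r. \<bar>r\<bar> < \<delta> \<Longrightarrow> dist (U (?c (t + r))) (U (?c t)) \<le> (h t + e) * \<bar>r\<bar>"
        proof (rule lebesgue_pt_dist_bound[OF lp, of "t - d" "t + d" "\<lambda>s. U (?c s)" e])
          fix a b assume ab: "t - d \<le> a" "a \<le> b" "b \<le> t + d"
          have seg: "\<forall>s\<in>{a..b}. ?c s \<in> ball 0 1"
          proof
            fix s assume "s \<in> {a..b}"
            with ab have "s \<in> cball t d" unfolding cb by auto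
            with d(2) show "?c s \<in> ball 0 1" by blast
          qed
          have ci: "ennreal \<bar>coord i (?c b) - coord i (?c a)\<bar> \<le> (\<integral>\<^sup>+ s\<in>{a..b}. ennreal (h s) \<partial>lborel)" for i
          proof -
            have "ennreal \<bar>coord i (?c b) - coord i (?c a) - 0 * (b - a)\<bar>
                \<le> (\<integral>\<^sup>+ s\<in>{a..b}. ennreal \<bar>ddir v i (?c s) - 0\<bar> \<partial>lborel)"
              using elim(1)[THEN conjunct1] ab(2) seg by blast
            also have "\<dots> \<le> (\<integral>\<^sup>+ s\<in>{a..b}. ennreal (h s) \<partial>lborel)"
            proof (intro nn_integral_mono_AE, use bd in eventually_elim)
              case (elim s)
              show ?case
              proof (cases "s \<in> {a..b}")
                case True
                then have "?c s \<in> ball 0 1" using seg by blast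
                with elim abs_ddir_le_slope[of v "?c s" "norm v * \<gamma> (?c s)" i]
                show ?thesis by (auto simp: h_def ennreal_leI indicator_def)
              qed auto
            qed
            finally show ?thesis by simp
          qed
          show "ennreal (dist (U (?c a)) (U (?c b))) \<le> (\<integral>\<^sup>+ s\<in>{a..b}. ennreal (h s) \<partial>lborel)" (is "_ \<le> ?I")
          proof (cases "?I = top")
            case False
            then have I: "?I = ennreal (enn2real ?I)" by (simp add: less_top)
            have "\<bar>coord i (?c a) - coord i (?c b)\<bar> \<le> enn2real ?I" for i
              using ci[of i] by (subst (asm) I) (simp add: abs_minus_commute)
            then have "dist (U (?c a)) (U (?c b)) \<le> enn2real ?I" by (rule dist_U_le_coord)
            then show ?thesis by (subst I) (rule ennreal_leI)
          qed simp
        qed (use d h0 \<open>0 < e\<close> in auto)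
        then show "\<exists>\<delta>>0. \<forall>r. \<bar>r\<bar> < \<delta> \<longrightarrow>
            \<bar>dist (U (?c t + of_real r * v)) (U (?c t)) - 0 * r\<bar> \<le> (slope v (?c t) + e) * \<bar>r\<bar>"
          using t by (intro exI[of _ \<delta>]) (simp add: chart_segment h_def)
      qed
    qed
  qed
qed

end

section \<open>Existence of the approximate metric derivative\<close>

lemma chart_vertical: "chart 1 \<i> x y = Complex x y"
  by (simp add: chart_def complex_eq_iff)

text \<open>Chebyshev on an interval: if all points satisfying \<open>P\<close> had values above
  \<open>2 * c\<close>, the integral would be at least twice the allowed amount. It selects good
  lines throughout.\<close>

lemma exists_small_AE:
  fixes K :: "real \<Rightarrow> ennreal"
  assumes "AE x in lborel. P x" "a < b" "0 < c"
    and "(\<integral>\<^sup>+ x\<in>{a..b}. K x \<partial>lborel) \<le> ennreal (c * (b - a))"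
  shows "\<exists>x\<in>{a..b}. P x \<and> K x \<le> ennreal (2 * c)"
proof (rule ccontr)
  assume neg: "\<not> ?thesis"
  have "ennreal (2 * c * (b - a)) = (\<integral>\<^sup>+ x\<in>{a..b}. ennreal (2 * c) \<partial>lborel)"
    using assms(2,3) by (subst nn_integral_cmult_indicator) (auto simp flip: ennreal_mult)
  also have "\<dots> \<le> (\<integral>\<^sup>+ x\<in>{a..b}. K x \<partial>lborel)"
    by (intro nn_integral_mono_AE, use assms(1) in eventually_elim)
      (use neg in \<open>auto simp: indicator_def not_le intro: less_imp_le\<close>)
  also note assms(4)
  finally show False using assms(2,3) by simp
qed

text \<open>The square of half-side \<open>r\<close> lies in the disc of radius
  \<open>2 * r\<close>, whose area is 4 pi r^2. The iterated form allows a single good vertical line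
  to be chosen afterwards.\<close>

lemma lebesgue_pt_plane:
  fixes h :: "complex \<Rightarrow> real"
  assumes "lebesgue_pt h z" and [measurable]: "h \<in> borel_measurable borel" and "0 < e"
  shows "\<exists>\<delta>>0. \<forall>r. 0 < r \<and> r < \<delta> \<longrightarrow>
    (\<integral>\<^sup>+ x\<in>{Re z - r..Re z + r}. (\<integral>\<^sup>+ y\<in>{Im z - r..Im z + r}. ennreal \<bar>h (Complex x y) - h z\<bar> \<partial>lborel) \<partial>lborel)
      \<le> ennreal (e * r\<^sup>2)"
proof -
  from assms obtain \<delta> where \<delta>: "0 < \<delta>" "\<And>r. 0 < r \<Longrightarrow> r < \<delta> \<Longrightarrow>
      (\<integral>\<^sup>+ w\<in>cball z r. ennreal \<bar>h w - h z\<bar> \<partial>lborel) \<le> ennreal (e / (4 * pi) * measure lborel (cball z r))"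
    unfolding lebesgue_pt_def by (metis divide_pos_pos mult_pos_pos pi_gt_zero zero_less_numeral)
  show ?thesis
  proof (intro exI[of _ "\<delta> / 2"] conjI allI impI)
    fix r assume r: "0 < r \<and> r < \<delta> / 2"
    have "(\<integral>\<^sup>+ x\<in>{Re z - r..Re z + r}. (\<integral>\<^sup>+ y\<in>{Im z - r..Im z + r}. ennreal \<bar>h (Complex x y) - h z\<bar> \<partial>lborel) \<partial>lborel)
      \<le> (\<integral>\<^sup>+ x. (\<integral>\<^sup>+ y. ennreal \<bar>h (Complex x y) - h z\<bar> * indicator (cball z (2 * r)) (Complex x y) \<partial>lborel) \<partial>lborel)"
    proof (intro nn_integral_mono)
      fix x
      have sub: "Complex x y \<in> cball z (2 * r)" if "x \<in> {Re z - r..Re z + r}" "y \<in> {Im z - r..Im z + r}" for y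
        using that cmod_le[of "z - Complex x y"] by (auto simp: dist_norm)
      show "(\<integral>\<^sup>+ y\<in>{Im z - r..Im z + r}. ennreal \<bar>h (Complex x y) - h z\<bar> \<partial>lborel) * indicator {Re z - r..Re z + r} x
        \<le> (\<integral>\<^sup>+ y. ennreal \<bar>h (Complex x y) - h z\<bar> * indicator (cball z (2 * r)) (Complex x y) \<partial>lborel)"
      proof (cases "x \<in> {Re z - r..Re z + r}")
        case True
        then show ?thesis
          using sub[OF True] by (auto intro!: nn_integral_mono mult_left_mono indicator_leI simp del: mem_cball)
      qed auto
    qed
    also have "\<dots> = (\<integral>\<^sup>+ w\<in>cball z (2 * r). ennreal \<bar>h w - h z\<bar> \<partial>lborel)"
      by (subst nn_integral_complex(1)) auto
    also have "\<dots> \<le> ennreal (e / (4 * pi) * measure lborel (cball z (2 * r)))"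
      using r by (intro \<delta>) auto
    also have "e / (4 * pi) * measure lborel (cball z (2 * r)) = e * r\<^sup>2"
      using r by (simp add: content_cball power2_eq_square unit_ball_vol_2)
    finally show "(\<integral>\<^sup>+ x\<in>{Re z - r..Re z + r}. (\<integral>\<^sup>+ y\<in>{Im z - r..Im z + r}. ennreal \<bar>h (Complex x y) - h z\<bar> \<partial>lborel) \<partial>lborel)
      \<le> ennreal (e * r\<^sup>2)" .
  qed (use \<delta> in auto)
qed

lemma area_ball: "0 \<le> r \<Longrightarrow> measure lebesgue (ball (z::complex) r) = pi * r\<^sup>2"
  using content_ball[of r z] by (simp add: unit_ball_vol_2)

lemma density_tendsto_0:
  fixes B :: "real \<Rightarrow> complex set" and z :: complex
  assumes B: "\<And>\<tau>. 0 < \<tau> \<Longrightarrow> \<exists>\<delta>>0. \<forall>r. 0 < r \<and> r < \<delta> \<longrightarrow> emeasure lebesgue (B r) \<le> ennreal (\<tau> * r\<^sup>2)"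
  shows "((\<lambda>r. measure lebesgue (B r) / measure lebesgue (ball z r)) \<longlongrightarrow> 0) (at_right 0)"
  unfolding tendsto_iff eventually_at_right_field
proof (intro allI impI)
  fix e :: real assume e: "0 < e"
  from B[OF e] obtain \<delta> where \<delta>: "0 < \<delta>"
      "\<And>r. 0 < r \<Longrightarrow> r < \<delta> \<Longrightarrow> emeasure lebesgue (B r) \<le> ennreal (e * r\<^sup>2)"
    by blast
  have "dist (measure lebesgue (B r) / measure lebesgue (ball z r)) 0 < e" if r: "0 < r" "r < \<delta>" for r
  proof -
    have "measure lebesgue (B r) \<le> e * r\<^sup>2"
      unfolding measure_def using \<delta>(2)[OF r] e by (intro enn2real_leI) simp_all
    then have "measure lebesgue (B r) / measure lebesgue (ball z r) \<le> e * r\<^sup>2 / (pi * r\<^sup>2)"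
      unfolding area_ball[OF less_imp_le[OF r(1)]] by (intro divide_right_mono) simp_all
    also have "\<dots> = e / pi" using r by simp
    also have "\<dots> < e" using e pi_gt3 by (simp add: divide_less_eq)
    finally show ?thesis by simp
  qed
  with \<delta>(1) show "\<exists>b>0. \<forall>r>0. r < b \<longrightarrow> dist (measure lebesgue (B r) / measure lebesgue (ball z r)) 0 < e"
    by blast
qed

section \<open>Regular points and the seminorm formed by the differentials\<close>

context line_sobolev
begin

declare split_paired_All [simp del] split_paired_Ex [simp del]

abbreviation "slant m \<equiv> Complex 1 (real_of_rat m)"

text \<open>Only rational slopes are listed, so that countably many conditions have to hold
  simultaneously. The vertical derivative is cut off at the disc to be integrable over the
  plane.\<close>

definition regular_pt :: "complex \<Rightarrow> bool" where
  "regular_pt z \<longleftrightarrow> z \<in> ball 0 1 \<and> lebesgue_pt \<gamma> z \<and>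
     (\<forall>i. lebesgue_pt (\<lambda>w. indicator (ball 0 1) w * ddir \<i> i w) z) \<and>
     (\<forall>i. \<bar>ddir \<i> i z\<bar> \<le> \<gamma> z) \<and>
     (\<forall>m i. deriv_bound (\<lambda>r. coord i (z + of_real r * slant m) - coord i z) (ddir (slant m) i z) 0) \<and>
     (\<forall>m i. \<bar>ddir (slant m) i z\<bar> \<le> norm (slant m) * \<gamma> z) \<and>
     (\<forall>m. deriv_bound (\<lambda>r. dist (U (z + of_real r * slant m)) (U z)) 0 (slope (slant m) z))"

lemma AE_regular_pt: "AE z in lborel. z \<in> ball 0 1 \<longrightarrow> regular_pt z"
proof -
  have "AE z in lborel. lebesgue_pt \<gamma> z"
    using \<gamma>_L1 \<gamma>_nonneg by (intro AE_lebesgue_pt) auto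
  moreover note AE_ddir[OF unimodular_vertical]
  moreover have "AE z in lborel. \<forall>i. lebesgue_pt (\<lambda>w. indicator (ball 0 1) w * ddir \<i> i w) z"
    unfolding AE_all_countable
  proof
    fix i
    have "(\<integral>\<^sup>+ w. ennreal \<bar>indicator (ball 0 1) w * ddir \<i> i w\<bar> \<partial>lborel) \<le> (\<integral>\<^sup>+ w. ennreal (\<gamma> w) \<partial>lborel)"
      by (intro nn_integral_mono_AE, use AE_ddir[OF unimodular_vertical] in eventually_elim)
        (auto simp: indicator_def intro!: ennreal_leI)
    also note \<gamma>_L1
    finally show "AE z in lborel. lebesgue_pt (\<lambda>w. indicator (ball 0 1) w * ddir \<i> i w) z"
      by (intro AE_lebesgue_pt) auto
  qed
  moreover have "AE z in lborel. \<forall>m::rat. z \<in> ball 0 1 \<longrightarrow> (\<forall>i.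
      deriv_bound (\<lambda>r. coord i (z + of_real r * slant m) - coord i z) (ddir (slant m) i z) 0 \<and>
      \<bar>ddir (slant m) i z\<bar> \<le> norm (slant m) * \<gamma> z)"
    unfolding AE_all_countable by (intro allI AE_ddir[OF unimodular_slope])
  moreover have "AE z in lborel. \<forall>m::rat. z \<in> ball 0 1 \<longrightarrow>
      deriv_bound (\<lambda>r. dist (U (z + of_real r * slant m)) (U z)) 0 (slope (slant m) z)"
    unfolding AE_all_countable by (intro allI AE_slope[OF unimodular_slope])
  ultimately show ?thesis
  proof eventually_elim
    case (elim z)
    show ?case
      unfolding regular_pt_def
      by (rule impI, intro conjI allI) (use elim in \<open>auto simp: norm_ii\<close>)
  qed
qed

text \<open>Compare \<open>coord i\<close> at \<open>z\<close> and at \<open>z + s\<close> along two paths: the horizontal segment, and the segment of slope \<open>m\<close>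
  followed by a vertical one. The fundamental theorem of calculus on a well-chosen vertical line
  applies since \<open>z\<close> is a Lebesgue point of \<open>ddir \<i> i\<close>.\<close>
lemma ddir_slant:
  assumes z: "regular_pt z"
  shows "ddir (slant m) i z = ddir (slant 0) i z + of_rat m * ddir \<i> i z"
proof -
  define c where "c = ddir (slant m) i z - ddir (slant 0) i z - of_rat m * ddir \<i> i z"
  define M where "M = 1 + \<bar>real_of_rat m\<bar>"
  have M: "1 \<le> M" by (simp add: M_def)
  define G where "G w = indicator (ball 0 1) w * ddir \<i> i w" for w
  have [measurable]: "G \<in> borel_measurable borel" unfolding G_def by measurable
  have zD: "z \<in> ball 0 1" using z by (simp add: regular_pt_def)
  have Gz: "G z = ddir \<i> i z" using zD by (simp add: G_def)
  have "\<bar>c\<bar> \<le> e" if "0 < e" for e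
  proof -
    obtain d0 where d0: "0 < d0" "cball z d0 \<subseteq> ball 0 1"
      using zD by (meson open_ball open_contains_cball)
    obtain d1 where d1: "0 < d1" "\<And>r. \<bar>r\<bar> < d1 \<Longrightarrow>
        \<bar>coord i (z + of_real r * slant m) - coord i z - ddir (slant m) i z * r\<bar> \<le> (0 + e / 8) * \<bar>r\<bar>"
      using z \<open>0 < e\<close> unfolding regular_pt_def deriv_bound_def by (metis divide_pos_pos zero_less_numeral)
    obtain d2 where d2: "0 < d2" "\<And>r. \<bar>r\<bar> < d2 \<Longrightarrow>
        \<bar>coord i (z + of_real r * slant 0) - coord i z - ddir (slant 0) i z * r\<bar> \<le> (0 + e / 8) * \<bar>r\<bar>"
      using z \<open>0 < e\<close> unfolding regular_pt_def deriv_bound_def by (metis divide_pos_pos zero_less_numeral)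
    \<comment> \<open>Makes the mean of \<open>K\<close> over \<open>[Re z + r/2, Re z + r]\<close>
      at most e r/8, so that some \<open>x\<close> there has \<open>K x\<close> at most e r/4.
      Together with e r/8 for each of the two difference quotients this is e r/2, hence at most
      \<open>e * s\<close> because \<open>s\<close> is at least r/2. The factor \<open>M\<close>
      leaves room for the vertical piece up to slope \<open>m\<close>.\<close>
    define e' where "e' = e / (16 * M\<^sup>2)"
    have e': "0 < e'" using \<open>0 < e\<close> M by (simp add: e'_def)
    have "G = (\<lambda>w. indicator (ball 0 1) w * ddir \<i> i w)" by (simp add: G_def fun_eq_iff)
    then have "lebesgue_pt G z" using z by (simp add: regular_pt_def)
    then obtain d3 where d3: "0 < d3" "\<And>r. 0 < r \<Longrightarrow> r < d3 \<Longrightarrow>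
        (\<integral>\<^sup>+ x\<in>{Re z - r..Re z + r}. (\<integral>\<^sup>+ y\<in>{Im z - r..Im z + r}. ennreal \<bar>G (Complex x y) - G z\<bar> \<partial>lborel) \<partial>lborel)
      \<le> ennreal (e' * r\<^sup>2)"
      using lebesgue_pt_plane[of G z e'] e' by auto
    define r where "r = min (min d0 d3) (min d1 d2) / (4 * M)"
    have rp: "0 < r" using d0 d1 d2 d3 M by (simp add: r_def)
    have *: "min (min d0 d3) (min d1 d2) = 4 * M * r" using M by (simp add: r_def)
    have rM: "r \<le> M * r" using M rp by simp
    have r: "2 * (M * r) \<le> d0" "M * r < d3" "r < d1" "r < d2"
    proof -
      have "4 * M * r \<le> d0" "4 * M * r \<le> d3" "4 * M * r \<le> d1" "4 * M * r \<le> d2"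
        unfolding *[symmetric] by simp_all
      then show "2 * (M * r) \<le> d0" "M * r < d3" "r < d1" "r < d2"
        using rM rp by linarith+
    qed
    define K where "K x = (\<integral>\<^sup>+ y\<in>{Im z - M * r..Im z + M * r}. ennreal \<bar>G (Complex x y) - G z\<bar> \<partial>lborel)" for x
    have "(\<integral>\<^sup>+ x\<in>{Re z + r / 2..Re z + r}. K x \<partial>lborel) \<le> (\<integral>\<^sup>+ x\<in>{Re z - M * r..Re z + M * r}. K x \<partial>lborel)"
    proof -
      have "{Re z + r / 2..Re z + r} \<subseteq> {Re z - M * r..Re z + M * r}"
        using rM rp unfolding atLeastatMost_subset_iff by linarith
      then show ?thesis by (intro nn_integral_mono mult_left_mono indicator_leI) auto
    qed
    also have "\<dots> \<le> ennreal (e' * (M * r)\<^sup>2)"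
      unfolding K_def using r M rp by (intro d3) auto
    also have "e' * (M * r)\<^sup>2 = e * r / 8 * ((Re z + r) - (Re z + r / 2))"
      using M by (simp add: e'_def power2_eq_square field_simps)
    finally obtain x where x: "x \<in> {Re z + r / 2..Re z + r}" "K x \<le> ennreal (2 * (e * r / 8))"
      and ftc: "\<And>a b. a \<le> b \<Longrightarrow> (\<forall>t\<in>{a..b}. Complex x t \<in> ball 0 1) \<Longrightarrow>
        ennreal \<bar>coord i (Complex x b) - coord i (Complex x a) - G z * (b - a)\<bar>
          \<le> (\<integral>\<^sup>+ t\<in>{a..b}. ennreal \<bar>ddir \<i> i (Complex x t) - G z\<bar> \<partial>lborel)"
      using exists_small_AE[OF line_derivative[OF unimodular_vertical, unfolded chart_vertical],
          of "Re z + r / 2" "Re z + r" "e * r / 8" K] rp \<open>0 < e\<close> by auto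
    define s where "s = x - Re z"
    define q where "q = real_of_rat m"
    have s: "r / 2 \<le> s" "s \<le> r" using x by (auto simp: s_def)
    have qs: "\<bar>q * s\<bar> \<le> M * r"
    proof -
      have "\<bar>q * s\<bar> \<le> \<bar>q\<bar> * r" unfolding abs_mult using s rp by (intro mult_left_mono) auto
      also have "\<dots> \<le> M * r" using rp by (simp add: M_def q_def algebra_simps)
      finally show ?thesis .
    qed
    have A: "z + of_real s * slant m = Complex x (Im z + q * s)"
      by (simp add: s_def q_def complex_eq_iff)
    have B: "z + of_real s * slant 0 = Complex x (Im z)"
      by (simp add: s_def complex_eq_iff)
    define a b where "a = min (Im z) (Im z + q * s)" and "b = max (Im z) (Im z + q * s)"
    have ab: "a \<le> b" "{a..b} \<subseteq> {Im z - M * r..Im z + M * r}"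
      using qs by (auto simp: a_def b_def)
    have seg: "\<forall>t\<in>{a..b}. Complex x t \<in> ball 0 1"
    proof
      fix t assume "t \<in> {a..b}"
      then have "\<bar>t - Im z\<bar> \<le> M * r" using ab by auto
      moreover have "\<bar>x - Re z\<bar> \<le> M * r" using s rp rM unfolding s_def by linarith
      ultimately have "Complex x t \<in> cball z d0"
        using cmod_le[of "z - Complex x t"] r(1) by (auto simp: dist_norm abs_minus_commute)
      then show "Complex x t \<in> ball 0 1" using d0 by blast
    qed
    have "ennreal \<bar>coord i (Complex x b) - coord i (Complex x a) - G z * (b - a)\<bar>
          \<le> (\<integral>\<^sup>+ t\<in>{a..b}. ennreal \<bar>ddir \<i> i (Complex x t) - G z\<bar> \<partial>lborel)"
      using ab seg by (intro ftc)
    also have "\<dots> \<le> K x"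
      unfolding K_def
    proof (intro nn_integral_mono)
      fix t
      show "ennreal \<bar>ddir \<i> i (Complex x t) - G z\<bar> * indicator {a..b} t
        \<le> ennreal \<bar>G (Complex x t) - G z\<bar> * indicator {Im z - M * r..Im z + M * r} t"
      proof (cases "t \<in> {a..b}")
        case True
        then have "t \<in> {Im z - M * r..Im z + M * r}" "G (Complex x t) = ddir \<i> i (Complex x t)"
          using seg ab by (auto simp: G_def)
        with True show ?thesis by simp
      qed simp
    qed
    also note x(2)
    finally have v: "\<bar>coord i (Complex x b) - coord i (Complex x a) - G z * (b - a)\<bar> \<le> e * r / 4"
      using rp \<open>0 < e\<close> by (subst (asm) ennreal_le_iff) auto
    have v': "\<bar>coord i (Complex x (Im z + q * s)) - coord i (Complex x (Im z)) - G z * (q * s)\<bar> \<le> e * r / 4"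
    proof (cases "0 \<le> q * s")
      case True
      then show ?thesis using v by (simp add: a_def b_def)
    next
      case False
      then have "a = Im z + q * s" "b = Im z" by (auto simp: a_def b_def)
      then have "\<bar>- (coord i (Complex x (Im z + q * s)) - coord i (Complex x (Im z)) - G z * (q * s))\<bar> \<le> e * r / 4"
        using v by (simp add: algebra_simps)
      then show ?thesis by (simp only: abs_minus_cancel)
    qed
    have es: "e / 8 * \<bar>s\<bar> \<le> e * r / 8" using s rp \<open>0 < e\<close> by simp
    have "\<bar>coord i (Complex x (Im z + q * s)) - coord i z - ddir (slant m) i z * s\<bar> \<le> e * r / 8"
      using d1(2)[of s] s r rp es unfolding A by simp
    moreover have "\<bar>coord i (Complex x (Im z)) - coord i z - ddir (slant 0) i z * s\<bar> \<le> e * r / 8"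
      using d2(2)[of s] s r rp es unfolding B by simp
    moreover have "c * s = ddir (slant m) i z * s - ddir (slant 0) i z * s - G z * (q * s)"
      by (simp add: c_def Gz q_def algebra_simps)
    ultimately have "\<bar>c * s\<bar> \<le> e * r / 2"
      using v' by linarith
    also have "\<dots> \<le> e * s" using s \<open>0 < e\<close> by simp
    finally show "\<bar>c\<bar> \<le> e" using s rp by (simp add: abs_mult)
  qed
  note ce = this
  have "\<bar>c\<bar> \<le> 0"
  proof (rule field_le_epsilon)
    fix e :: real assume "0 < e"
    then show "\<bar>c\<bar> \<le> 0 + e" using ce[of e] by (simp only: add_0)
  qed
  then have "c = 0" by simp
  then show ?thesis by (simp add: c_def)
qed

text \<open>Supremum of the linear forms given by the gradients of the \<open>coord i\<close>, in
  the basis of the horizontal and the vertical direction; as such it is a seminorm. On rational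
  slopes \<open>ddir_slant\<close> identifies it with \<open>slope\<close>.\<close>

definition tangent :: "complex \<Rightarrow> complex \<Rightarrow> real" where
  "tangent z w = (SUP i. \<bar>ddir (slant 0) i z * Re w + ddir \<i> i z * Im w\<bar>)"

context
  fixes z assumes z: "regular_pt z"
begin

lemma ddir_0_le: "\<bar>ddir (slant 0) i z\<bar> \<le> \<gamma> z"
proof -
  have "norm (slant 0) = 1" by (simp add: cmod_def)
  then show ?thesis using z unfolding regular_pt_def by (metis mult_1)
qed

lemma tangent_bound: "\<bar>ddir (slant 0) i z * Re w + ddir \<i> i z * Im w\<bar> \<le> \<gamma> z * (\<bar>Re w\<bar> + \<bar>Im w\<bar>)"
proof -
  have "\<bar>ddir (slant 0) i z * Re w\<bar> \<le> \<gamma> z * \<bar>Re w\<bar>"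
    unfolding abs_mult using ddir_0_le by (intro mult_right_mono) auto
  moreover have "\<bar>ddir \<i> i z * Im w\<bar> \<le> \<gamma> z * \<bar>Im w\<bar>"
    unfolding abs_mult using z by (intro mult_right_mono) (auto simp: regular_pt_def)
  ultimately show ?thesis by (simp add: distrib_left)
qed

lemma tangent_bdd: "bdd_above (range (\<lambda>i. \<bar>ddir (slant 0) i z * Re w + ddir \<i> i z * Im w\<bar>))"
  using tangent_bound by (intro bdd_aboveI2)

lemma tangent_upper: "\<bar>ddir (slant 0) i z * Re w + ddir \<i> i z * Im w\<bar> \<le> tangent z w"
  unfolding tangent_def by (rule cSUP_upper[OF UNIV_I tangent_bdd])

lemma tangent_le_\<gamma>: "tangent z w \<le> \<gamma> z * (\<bar>Re w\<bar> + \<bar>Im w\<bar>)"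
  unfolding tangent_def by (rule cSUP_least[OF UNIV_not_empty tangent_bound])

lemma tangent_le_norm: "tangent z w \<le> 2 * \<gamma> z * norm w"
proof -
  have "\<gamma> z * (\<bar>Re w\<bar> + \<bar>Im w\<bar>) \<le> \<gamma> z * (2 * norm w)"
    using abs_Re_le_cmod[of w] abs_Im_le_cmod[of w] \<gamma>_nonneg by (intro mult_left_mono) auto
  with tangent_le_\<gamma>[of w] show ?thesis by (simp add: ac_simps)
qed

lemma tangent_add: "tangent z (w + w') \<le> tangent z w + tangent z w'"
  unfolding tangent_def[of z "w + w'"]
proof (rule cSUP_least)
  fix i
  have "ddir (slant 0) i z * Re (w + w') + ddir \<i> i z * Im (w + w')
    = (ddir (slant 0) i z * Re w + ddir \<i> i z * Im w) + (ddir (slant 0) i z * Re w' + ddir \<i> i z * Im w')"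
    by (simp add: algebra_simps)
  then show "\<bar>ddir (slant 0) i z * Re (w + w') + ddir \<i> i z * Im (w + w')\<bar> \<le> tangent z w + tangent z w'"
    using tangent_upper[of i w] tangent_upper[of i w'] by linarith
qed simp

lemma tangent_scale: "tangent z (of_real c * w) = \<bar>c\<bar> * tangent z w"
proof -
  have *: "tangent z (of_real c * w) \<le> \<bar>c\<bar> * tangent z w" for c w
    unfolding tangent_def[of z "of_real c * w"]
  proof (rule cSUP_least)
    fix i
    have "\<bar>ddir (slant 0) i z * Re (of_real c * w) + ddir \<i> i z * Im (of_real c * w)\<bar>
      = \<bar>c\<bar> * \<bar>ddir (slant 0) i z * Re w + ddir \<i> i z * Im w\<bar>"
      unfolding abs_mult[symmetric] by (simp add: algebra_simps)
    then show "\<bar>ddir (slant 0) i z * Re (of_real c * w) + ddir \<i> i z * Im (of_real c * w)\<bar> \<le> \<bar>c\<bar> * tangent z w"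
      using tangent_upper[of i w] by (simp add: mult_left_mono)
  qed simp
  show ?thesis
  proof (cases "c = 0")
    case True
    then show ?thesis by (simp add: tangent_def)
  next
    case False
    have "\<bar>c\<bar> * tangent z w = \<bar>c\<bar> * tangent z (of_real (inverse c) * (of_real c * w))"
      using False by (simp add: mult.assoc[symmetric] flip: of_real_mult)
    also have "\<dots> \<le> \<bar>c\<bar> * (\<bar>inverse c\<bar> * tangent z (of_real c * w))"
      by (intro mult_left_mono *) simp
    also have "\<dots> = tangent z (of_real c * w)" using False by (simp flip: abs_mult mult.assoc)
    finally show ?thesis using *[of c w] by linarith
  qed
qed

lemma tangent_nonneg: "0 \<le> tangent z w"
  using tangent_upper[of "(0, 0)" w] by linarith

lemma seminorm_tangent: "seminorm_on_plane (tangent z)"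
  unfolding seminorm_on_plane_def using tangent_nonneg tangent_add tangent_scale by blast

lemma tangent_slant: "tangent z (slant m) = slope (slant m) z"
proof (rule antisym)
  have bd: "\<bar>ddir (slant m) i z\<bar> \<le> norm (slant m) * \<gamma> z" for i
    using z by (simp add: regular_pt_def)
  have eq: "\<bar>ddir (slant 0) i z * Re (slant m) + ddir \<i> i z * Im (slant m)\<bar> = \<bar>ddir (slant m) i z\<bar>" for i
    unfolding ddir_slant[OF z, of m i] by (simp add: mult.commute)
  show "tangent z (slant m) \<le> slope (slant m) z"
    unfolding tangent_def eq by (intro cSUP_least abs_ddir_le_slope[OF bd]) simp
  show "slope (slant m) z \<le> tangent z (slant m)"
    using tangent_upper[of _ "slant m"] unfolding eq by (rule slope_le)
qed

text \<open>The upper half is part of \<open>regular_pt\<close>. For the lower half one coordinate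
  is chosen whose derivative nearly attains \<open>slope\<close>; its increments never exceed
  distances.\<close>

lemma metric_derivative_slant:
  assumes "0 < e"
  obtains \<delta> where "0 < \<delta>" "\<And>x. \<bar>x\<bar> < \<delta> \<Longrightarrow>
    \<bar>dist (U (z + of_real x * slant m)) (U z) - slope (slant m) z * \<bar>x\<bar>\<bar> \<le> e * \<bar>x\<bar>"
proof -
  have bd: "\<bar>ddir (slant m) i z\<bar> \<le> norm (slant m) * \<gamma> z" for i
    using z by (simp add: regular_pt_def)
  obtain i where i: "slope (slant m) z - e / 2 < \<bar>ddir (slant m) i z\<bar>"
    using slope_approx[OF bd, of "e / 2"] assms by auto
  have "deriv_bound (\<lambda>r. dist (U (z + of_real r * slant m)) (U z)) 0 (slope (slant m) z)"
    using z by (simp add: regular_pt_def)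
  then obtain d1 where d1: "0 < d1" "\<And>r. \<bar>r\<bar> < d1 \<Longrightarrow>
      \<bar>dist (U (z + of_real r * slant m)) (U z) - 0 * r\<bar> \<le> (slope (slant m) z + e) * \<bar>r\<bar>"
    using assms unfolding deriv_bound_def by blast
  have "deriv_bound (\<lambda>r. coord i (z + of_real r * slant m) - coord i z) (ddir (slant m) i z) 0"
    using z by (simp add: regular_pt_def)
  then obtain d2 where d2: "0 < d2" "\<And>r. \<bar>r\<bar> < d2 \<Longrightarrow>
      \<bar>coord i (z + of_real r * slant m) - coord i z - ddir (slant m) i z * r\<bar> \<le> (0 + e / 2) * \<bar>r\<bar>"
    using assms unfolding deriv_bound_def by (meson half_gt_zero)
  show thesis
  proof (rule that[of "min d1 d2"])
    fix x :: real assume x: "\<bar>x\<bar> < min d1 d2"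
    let ?d = "dist (U (z + of_real x * slant m)) (U z)"
    have "?d \<le> (slope (slant m) z + e) * \<bar>x\<bar>" using d1(2)[of x] x by simp
    moreover have "(slope (slant m) z - e / 2) * \<bar>x\<bar> \<le> \<bar>ddir (slant m) i z\<bar> * \<bar>x\<bar>"
      using i by (intro mult_right_mono) auto
    moreover have "\<bar>ddir (slant m) i z\<bar> * \<bar>x\<bar> \<le> \<bar>coord i (z + of_real x * slant m) - coord i z\<bar> + e / 2 * \<bar>x\<bar>"
    proof -
      have *: "\<bar>A - B\<bar> \<le> C \<Longrightarrow> \<bar>B\<bar> \<le> \<bar>A\<bar> + C" for A B C :: real by linarith
      show ?thesis using *[OF d2(2)[of x]] x by (simp add: abs_mult)
    qed
    moreover have "\<bar>coord i (z + of_real x * slant m) - coord i z\<bar> \<le> ?d" by (rule coord_diff_le)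
    ultimately show "\<bar>?d - slope (slant m) z * \<bar>x\<bar>\<bar> \<le> e * \<bar>x\<bar>"
      by (simp add: algebra_simps abs_le_iff) linarith
  qed (use d1 d2 in simp)
qed

text \<open>A point \<open>w\<close> is reached from \<open>z\<close> by a segment whose slope belongs to a finite net, on which the metric
  derivative is known, followed by a short vertical segment, on which \<open>\<gamma>\<close> has small integral
  unless \<open>Re w\<close> lies in a set of small measure.\<close>
lemma ap_md_tangent: "ap_md (ball 0 1) U z (tangent z)"
  unfolding ap_md_def
proof (intro conjI allI impI seminorm_tangent)
  fix \<epsilon> :: real assume eps: "0 < \<epsilon>"
  let ?B = "\<lambda>r. {y \<in> ball 0 1 \<inter> ball z r. \<epsilon> * norm (y - z) < \<bar>dist (U y) (U z) - tangent z (y - z)\<bar>}"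
  have zD: "z \<in> ball 0 1" using z by (simp add: regular_pt_def)
  obtain d0 where d0: "0 < d0" "cball z d0 \<subseteq> ball 0 1"
    using zD by (meson open_ball open_contains_cball)
  obtain N where N: "N \<in> null_sets lborel" "\<And>X a b. X \<notin> N \<Longrightarrow> a \<le> b \<Longrightarrow>
      (\<forall>t\<in>{a..b}. Complex X t \<in> ball 0 1) \<Longrightarrow>
      ennreal (dist (U (Complex X a)) (U (Complex X b))) \<le> (\<integral>\<^sup>+ t\<in>{a..b}. ennreal (\<gamma> (Complex X t)) \<partial>lborel)"
  proof -
    have *: "AE X in lborel. \<forall>a b. a \<le> b \<longrightarrow> (\<forall>t\<in>{a..b}. Complex X t \<in> ball 0 1) \<longrightarrow>
      ennreal (dist (U (Complex X a)) (U (Complex X b))) \<le> (\<integral>\<^sup>+ t\<in>{a..b}. ennreal (\<gamma> (Complex X t)) \<partial>lborel)"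
      using lines[OF unimodular_vertical] by (simp add: chart_vertical)
    show thesis
      by (rule AE_E3[OF *], rule that) (auto simp: space_lborel)
  qed
  have main: "\<exists>\<delta>>0. \<forall>r. 0 < r \<and> r < \<delta> \<longrightarrow> emeasure lebesgue (?B r) \<le> ennreal (\<tau> * r\<^sup>2)" if \<tau>: "0 < \<tau>" for \<tau>
  proof -
    \<comment> \<open>Half-width, relative to \<open>r\<close>, of a vertical strip about
      \<open>z\<close> that is discarded. Outside it the slopes to be approximated are at most
      \<open>1 / \<kappa>\<close>, and the distance to \<open>z\<close> exceeds
      \<open>\<kappa> * r\<close>.\<close>
    define \<kappa> where "\<kappa> = \<tau> / 8"
    have \<kappa>: "0 < \<kappa>" using \<tau> by (simp add: \<kappa>_def)
    \<comment> \<open>Common accuracy for the slopes, the metric derivative and the vertical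
      integrals. The accumulated error \<open>(2 * \<gamma> z + 2) * \<eta> * r\<close> must stay
      below \<open>\<epsilon> * \<kappa> * r\<close>.\<close>
    define \<eta> where "\<eta> = min 1 (\<epsilon> * \<kappa> / (2 * \<gamma> z + 2))"
    have g0: "0 \<le> \<gamma> z" by (rule \<gamma>_nonneg)
    have \<eta>: "0 < \<eta>" "\<eta> \<le> 1" "(2 * \<gamma> z + 2) * \<eta> \<le> \<epsilon> * \<kappa>"
    proof -
      show "0 < \<eta>" using eps \<kappa> g0 by (simp add: \<eta>_def)
      have "(2 * \<gamma> z + 2) * \<eta> \<le> (2 * \<gamma> z + 2) * (\<epsilon> * \<kappa> / (2 * \<gamma> z + 2))"
        using g0 by (intro mult_left_mono) (auto simp: \<eta>_def)
      then show "(2 * \<gamma> z + 2) * \<eta> \<le> \<epsilon> * \<kappa>" using g0 by simp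
    qed (simp add: \<eta>_def)
    obtain h where h: "h \<in> \<rat>" "0 < h" "h < \<eta>" using Rats_dense_in_real[OF \<eta>(1)] by auto
    then obtain h' where h': "h = real_of_rat h'" by (auto simp: Rats_def)
    obtain J :: nat where J: "1 / \<kappa> / h \<le> real J" using real_arch_simple by blast
    \<comment> \<open>Rational slopes with spacing below \<open>\<eta>\<close> that reach beyond
      \<open>1 / \<kappa>\<close> in both directions; the extra 1 absorbs the rounding by the
      floor.\<close>
    define M where "M = (\<lambda>j. of_int j * h') ` {- int J - 1..int J + 1}"
    have finM: "finite M" by (simp add: M_def)
    have net: "\<exists>m\<in>M. \<bar>\<rho> - real_of_rat m\<bar> \<le> \<eta>" if "\<bar>\<rho>\<bar> \<le> 1 / \<kappa>" for \<rho>
    proof -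
      define j where "j = \<lfloor>\<rho> / h\<rfloor>"
      have j: "real_of_int j \<le> \<rho> / h" "\<rho> / h < real_of_int j + 1" by (simp_all add: j_def)
      have "\<bar>\<rho> / h\<bar> \<le> real J"
        using that h(2) J divide_right_mono[of "\<bar>\<rho>\<bar>" "1 / \<kappa>" h] by (simp add: abs_divide)
      then have "real_of_int j \<le> real J" "- real J - 1 \<le> real_of_int j" using j by linarith+
      then have "j \<in> {- int J - 1..int J + 1}" by auto
      then have "of_int j * h' \<in> M" by (auto simp: M_def)
      moreover have "\<bar>\<rho> - real_of_int j * h\<bar> \<le> \<eta>"
        using j h by (simp add: field_simps abs_le_iff)
      ultimately show ?thesis by (intro bexI[of _ "of_int j * h'"]) (auto simp: h' of_rat_mult)
    qed
    have "\<exists>\<delta>>0. \<forall>m\<in>M. \<forall>x. \<bar>x\<bar> < \<delta> \<longrightarrow>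
        \<bar>dist (U (z + of_real x * slant m)) (U z) - slope (slant m) z * \<bar>x\<bar>\<bar> \<le> \<eta> * \<bar>x\<bar>"
      using finM
    proof (induction M)
      case empty
      then show ?case by (intro exI[of _ 1]) auto
    next
      case (insert m M)
      then obtain da where da: "0 < da" "\<forall>m\<in>M. \<forall>x. \<bar>x\<bar> < da \<longrightarrow>
        \<bar>dist (U (z + of_real x * slant m)) (U z) - slope (slant m) z * \<bar>x\<bar>\<bar> \<le> \<eta> * \<bar>x\<bar>" by blast
      obtain db where "0 < db" "\<And>x. \<bar>x\<bar> < db \<Longrightarrow>
        \<bar>dist (U (z + of_real x * slant m)) (U z) - slope (slant m) z * \<bar>x\<bar>\<bar> \<le> \<eta> * \<bar>x\<bar>"
        by (rule metric_derivative_slant[OF \<eta>(1), of m]) blast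
      with da show ?case by (intro exI[of _ "min da db"]) auto
    qed
    then obtain d1 where d1: "0 < d1" "\<And>m x. m \<in> M \<Longrightarrow> \<bar>x\<bar> < d1 \<Longrightarrow>
        \<bar>dist (U (z + of_real x * slant m)) (U z) - slope (slant m) z * \<bar>x\<bar>\<bar> \<le> \<eta> * \<bar>x\<bar>" by blast
    define e' where "e' = \<eta> * \<tau> / 16"
    have e': "0 < e'" using \<eta> \<tau> by (simp add: e'_def)
    have "lebesgue_pt \<gamma> z" using z by (simp add: regular_pt_def)
    then obtain d2 where d2: "0 < d2" "\<And>r. 0 < r \<Longrightarrow> r < d2 \<Longrightarrow>
        (\<integral>\<^sup>+ x\<in>{Re z - r..Re z + r}. (\<integral>\<^sup>+ y\<in>{Im z - r..Im z + r}. ennreal \<bar>\<gamma> (Complex x y) - \<gamma> z\<bar> \<partial>lborel) \<partial>lborel)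
      \<le> ennreal (e' * r\<^sup>2)"
      using lebesgue_pt_plane[of \<gamma> z e'] e' by auto
    show ?thesis
    proof (intro exI[of _ "min (d0 / 3) (min d1 (d2 / 2))"] conjI allI impI)
      show "0 < min (d0 / 3) (min d1 (d2 / 2))" using d0 d1 d2 by simp
      fix r assume rr: "0 < r \<and> r < min (d0 / 3) (min d1 (d2 / 2))"
      then have r: "0 < r" "3 * r < d0" "r < d1" "2 * r < d2" by auto
      define \<Psi> where "\<Psi> X = (\<integral>\<^sup>+ y\<in>{Im z - 2 * r..Im z + 2 * r}. ennreal \<bar>\<gamma> (Complex X y) - \<gamma> z\<bar> \<partial>lborel)" for X
      have [measurable]: "\<Psi> \<in> borel_measurable borel"
      proof -
        have "\<Psi> = (\<lambda>X. \<integral>\<^sup>+ y\<in>{Im z - 2 * r..Im z + 2 * r}. ennreal \<bar>\<gamma> (chart 1 \<i> X y) - \<gamma> z\<bar> \<partial>lborel)"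
          by (simp add: \<Psi>_def fun_eq_iff chart_vertical)
        also have "\<dots> \<in> borel_measurable borel" by measurable
        finally show ?thesis .
      qed
      \<comment> \<open>Vertical lines on which the integral of
        \<open>\<bar>\<gamma> - \<gamma> z\<bar>\<close> is at least \<open>\<eta> * r\<close>. By
        Chebyshev, the choice of \<open>e'\<close> limits their measure to a quarter of
        \<open>\<tau> * r\<close>.\<close>
      define X1 where "X1 = {Re z - 2 * r..Re z + 2 * r} \<inter> {X. 1 \<le> ennreal (1 / (\<eta> * r)) * \<Psi> X}"
      define X where "X = {Re z - \<kappa> * r..Re z + \<kappa> * r} \<union> X1 \<union> N"
      have [measurable]: "X1 \<in> sets borel" "N \<in> sets borel" "X \<in> sets borel"
        using N(1) by (auto simp: X1_def X_def)
      have "emeasure lborel X1 \<le> ennreal (1 / (\<eta> * r)) * (\<integral>\<^sup>+ X\<in>{Re z - 2 * r..Re z + 2 * r}. \<Psi> X \<partial>lborel)"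
        unfolding X1_def Int_def mem_Collect_eq by (rule nn_integral_Markov_inequality) auto
      also have "\<dots> \<le> ennreal (1 / (\<eta> * r)) * ennreal (e' * (2 * r)\<^sup>2)"
        unfolding \<Psi>_def using r by (intro mult_left_mono d2) auto
      also have "\<dots> = ennreal (\<tau> / 4 * r)"
        using r \<eta> \<tau> e' by (simp add: e'_def power2_eq_square field_simps flip: ennreal_mult)
      finally have X1: "emeasure lborel X1 \<le> ennreal (\<tau> / 4 * r)" .
      have "emeasure lborel X \<le> emeasure lborel ({Re z - \<kappa> * r..Re z + \<kappa> * r} \<union> X1) + emeasure lborel N"
        unfolding X_def by (rule emeasure_subadditive) auto
      also have "\<dots> \<le> (emeasure lborel {Re z - \<kappa> * r..Re z + \<kappa> * r} + emeasure lborel X1) + 0"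
        using N(1) by (intro add_mono emeasure_subadditive) auto
      also have "\<dots> \<le> (ennreal (2 * \<kappa> * r) + ennreal (\<tau> / 4 * r)) + 0"
        using r \<kappa> X1 by (intro add_mono) auto
      also have "\<dots> = ennreal (\<tau> / 2 * r)"
        using r \<tau> by (simp add: \<kappa>_def algebra_simps flip: ennreal_plus)
      finally have X: "emeasure lborel X \<le> ennreal (\<tau> / 2 * r)" .
      define Y where "Y = {w. Re w \<in> X \<and> Im w \<in> {Im z - r..Im z + r}}"
      have [measurable]: "Y \<in> sets borel"
      proof -
        have "Y = (Re -` X \<inter> space borel) \<inter> (Im -` {Im z - r..Im z + r} \<inter> space borel)"
          by (auto simp: Y_def)
        also have "\<dots> \<in> sets borel"
          by (intro sets.Int measurable_sets[of Re borel borel] measurable_sets[of Im borel borel]) auto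
        finally show ?thesis .
      qed
      have "emeasure lborel Y = (\<integral>\<^sup>+ w. indicator Y w \<partial>lborel)"
        by (rule nn_integral_indicator[symmetric]) simp
      also have "\<dots> = (\<integral>\<^sup>+ x. \<integral>\<^sup>+ y. indicator Y (Complex x y) \<partial>lborel \<partial>lborel)"
        by (rule nn_integral_complex(1)) simp
      also have "\<dots> = (\<integral>\<^sup>+ x. indicator X x * (\<integral>\<^sup>+ y. indicator {Im z - r..Im z + r} y \<partial>lborel) \<partial>lborel)"
        by (intro nn_integral_cong) (auto simp: Y_def indicator_def)
      also have "\<dots> = emeasure lborel X * ennreal (2 * r)"
        using r by (simp add: nn_integral_multc)
      also have "\<dots> \<le> ennreal (\<tau> / 2 * r) * ennreal (2 * r)"
        by (intro mult_right_mono X) simp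
      also have "\<dots> = ennreal (\<tau> * r\<^sup>2)"
        using r \<tau> by (simp add: power2_eq_square flip: ennreal_mult)
      finally have Y: "emeasure lborel Y \<le> ennreal (\<tau> * r\<^sup>2)" .
      have "?B r \<subseteq> Y"
      proof
        fix w assume w: "w \<in> ?B r"
        define x y where "x = Re w - Re z" and "y = Im w - Im z"
        have nw: "norm (w - z) < r" using w by (simp add: dist_norm norm_minus_commute)
        have x: "\<bar>x\<bar> \<le> norm (w - z)" using abs_Re_le_cmod[of "w - z"] by (simp add: x_def)
        have y: "\<bar>y\<bar> \<le> norm (w - z)" using abs_Im_le_cmod[of "w - z"] by (simp add: y_def)
        have yY: "Im w \<in> {Im z - r..Im z + r}" using y nw by (auto simp: y_def)
        show "w \<in> Y"
        proof (rule ccontr)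
          assume "w \<notin> Y"
          then have nX: "Re w \<notin> X" using yY by (auto simp: Y_def)
          then have \<kappa>x: "\<kappa> * r < \<bar>x\<bar>" by (auto simp: X_def x_def)
          have wN: "Re w \<notin> N" using nX by (auto simp: X_def)
          have xi: "Re w \<in> {Re z - 2 * r..Re z + 2 * r}" using x nw r by (auto simp: x_def)
          have \<Psi>w: "\<Psi> (Re w) \<le> ennreal (\<eta> * r)"
          proof -
            have "ennreal (1 / (\<eta> * r)) * \<Psi> (Re w) < 1" using nX xi by (auto simp: X_def X1_def not_le)
            then have "ennreal (\<eta> * r) * (ennreal (1 / (\<eta> * r)) * \<Psi> (Re w)) \<le> ennreal (\<eta> * r) * 1"
              by (intro mult_left_mono) auto
            moreover have "ennreal (\<eta> * r) * (ennreal (1 / (\<eta> * r)) * \<Psi> (Re w)) = \<Psi> (Re w)"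
              using \<eta> r by (simp add: mult.assoc[symmetric] flip: ennreal_mult)
            ultimately show ?thesis by simp
          qed
          have "0 < \<kappa> * r" using \<kappa> r by simp
          then have x0: "x \<noteq> 0" using \<kappa>x by auto
          have "\<bar>y / x\<bar> \<le> r / (\<kappa> * r)"
            unfolding abs_divide using y nw \<kappa>x \<kappa> r by (intro frac_le) auto
          then have "\<bar>y / x\<bar> \<le> 1 / \<kappa>" using r by simp
          then obtain m where m: "m \<in> M" "\<bar>y / x - real_of_rat m\<bar> \<le> \<eta>" using net by blast
          define q where "q = real_of_rat m"
          have "\<bar>y - q * x\<bar> = \<bar>y / x - q\<bar> * \<bar>x\<bar>"
            using x0 by (simp add: abs_mult[symmetric] left_diff_distrib)
          also have "\<dots> \<le> \<eta> * r"
            using m(2) x nw \<eta> by (intro mult_mono) (auto simp: q_def)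
          finally have yq: "\<bar>y - q * x\<bar> \<le> \<eta> * r" .
          have \<eta>r: "\<eta> * r \<le> r" using \<eta> r by simp
          \<comment> \<open>End of the segment from \<open>z\<close> with the slope of the net; the
            vertical piece from \<open>p\<close> to \<open>w\<close> has length at most
            \<open>\<eta> * r\<close>.\<close>
          define p where "p = Complex (Re w) (Im z + q * x)"
          have p: "z + of_real x * slant m = p" by (simp add: p_def x_def q_def complex_eq_iff)
          define a b where "a = min (Im w) (Im z + q * x)" and "b = max (Im w) (Im z + q * x)"
          have ab: "a \<le> b" "{a..b} \<subseteq> {Im z - 2 * r..Im z + 2 * r}" "b - a = \<bar>y - q * x\<bar>"
          proof -
            have "\<bar>q * x\<bar> \<le> 2 * r" "\<bar>Im w - Im z\<bar> \<le> 2 * r"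
              using yq y nw \<eta>r r unfolding y_def by linarith+
            then show "a \<le> b" "{a..b} \<subseteq> {Im z - 2 * r..Im z + 2 * r}" "b - a = \<bar>y - q * x\<bar>"
              by (auto simp: a_def b_def y_def abs_le_iff)
          qed
          have seg: "\<forall>t\<in>{a..b}. Complex (Re w) t \<in> ball 0 1"
          proof
            fix t assume "t \<in> {a..b}"
            then have "\<bar>Im z - t\<bar> \<le> 2 * r" using ab by auto
            moreover have "\<bar>Re z - Re w\<bar> \<le> r" using x nw by (auto simp: x_def)
            ultimately have "Complex (Re w) t \<in> cball z d0"
              using cmod_le[of "z - Complex (Re w) t"] r(2) by (auto simp: dist_norm)
            then show "Complex (Re w) t \<in> ball 0 1" using d0 by blast
          qed
          have "ennreal (dist (U w) (U p)) = ennreal (dist (U (Complex (Re w) a)) (U (Complex (Re w) b)))"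
            by (auto simp: a_def b_def p_def min_def max_def dist_commute)
          also have "\<dots> \<le> (\<integral>\<^sup>+ t\<in>{a..b}. ennreal (\<gamma> (Complex (Re w) t)) \<partial>lborel)"
            by (rule N(2)[OF wN ab(1) seg])
          also have "\<dots> \<le> (\<integral>\<^sup>+ t. ennreal \<bar>\<gamma> (chart 1 \<i> (Re w) t) - \<gamma> z\<bar> * indicator {Im z - 2 * r..Im z + 2 * r} t
              + ennreal (\<gamma> z) * indicator {a..b} t \<partial>lborel)"
            using ab(2) g0 \<gamma>_nonneg by (intro nn_integral_mono)
              (auto simp: indicator_def chart_vertical subset_iff simp flip: ennreal_plus intro!: ennreal_leI)
          also have "\<dots> = \<Psi> (Re w) + ennreal (\<gamma> z) * emeasure lborel {a..b}"
            unfolding \<Psi>_def by (subst nn_integral_add) (auto simp: nn_integral_cmult chart_vertical)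
          also have "\<dots> \<le> ennreal (\<eta> * r) + ennreal (\<gamma> z) * ennreal (\<eta> * r)"
            using ab yq by (intro add_mono \<Psi>w mult_left_mono) (auto simp: ennreal_leI)
          also have "\<dots> = ennreal ((1 + \<gamma> z) * (\<eta> * r))"
            using g0 \<eta> r by (simp add: distrib_right flip: ennreal_mult ennreal_plus)
          finally have d1': "dist (U w) (U p) \<le> (1 + \<gamma> z) * (\<eta> * r)"
            using g0 \<eta> r by (subst (asm) ennreal_le_iff) auto
          have "\<bar>dist (U p) (U z) - slope (slant m) z * \<bar>x\<bar>\<bar> \<le> \<eta> * \<bar>x\<bar>"
            unfolding p[symmetric] using x nw r by (intro d1 m) auto
          also have "\<dots> \<le> \<eta> * r" using x nw \<eta> by (intro mult_left_mono) auto
          also have "slope (slant m) z * \<bar>x\<bar> = tangent z (of_real x * slant m)"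
            by (simp add: tangent_scale tangent_slant mult.commute)
          finally have d2': "\<bar>dist (U p) (U z) - tangent z (of_real x * slant m)\<bar> \<le> \<eta> * r" .
          have v: "tangent z (of_real c * \<i>) \<le> \<gamma> z * (\<eta> * r)" if "\<bar>c\<bar> \<le> \<eta> * r" for c
            using tangent_le_\<gamma>[of "of_real c * \<i>"] that g0 by (simp add: order_trans[OF _ mult_left_mono])
          have e1: "w - z = of_real x * slant m + of_real (y - q * x) * \<i>"
            by (simp add: complex_eq_iff x_def y_def q_def)
          have t1: "tangent z (w - z) \<le> tangent z (of_real x * slant m) + tangent z (of_real (y - q * x) * \<i>)"
            unfolding e1 by (rule tangent_add)
          have e2: "of_real x * slant m = (w - z) + of_real (- (y - q * x)) * \<i>"
            by (simp add: complex_eq_iff x_def y_def q_def)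
          have t2: "tangent z (of_real x * slant m) \<le> tangent z (w - z) + tangent z (of_real (- (y - q * x)) * \<i>)"
            unfolding e2 by (rule tangent_add)
          have t3: "tangent z (of_real (- (y - q * x)) * \<i>) \<le> \<gamma> z * (\<eta> * r)"
            using yq by (intro v) (simp only: abs_minus_cancel)
          have d3': "\<bar>tangent z (of_real x * slant m) - tangent z (w - z)\<bar> \<le> \<gamma> z * (\<eta> * r)"
            using t1 t2 t3 v[OF yq] by linarith
          have "\<bar>dist (U w) (U z) - dist (U p) (U z)\<bar> \<le> dist (U w) (U p)"
            using dist_triangle[of "U w" "U z" "U p"] dist_triangle[of "U p" "U z" "U w"]
            by (simp add: dist_commute abs_le_iff)
          then have "\<bar>dist (U w) (U z) - tangent z (w - z)\<bar>
              \<le> (1 + \<gamma> z) * (\<eta> * r) + \<eta> * r + \<gamma> z * (\<eta> * r)"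
            using d1' d2' d3' by linarith
          also have "\<dots> = (2 * \<gamma> z + 2) * \<eta> * r" by (simp add: algebra_simps)
          also have "\<dots> \<le> \<epsilon> * \<kappa> * r" using \<eta>(3) r by (intro mult_right_mono) auto
          also have "\<dots> \<le> \<epsilon> * norm (w - z)" using \<kappa>x x eps by simp
          finally show False using w by simp
        qed
      qed
      then have "emeasure lebesgue (?B r) \<le> emeasure lebesgue Y"
        by (intro emeasure_mono) auto
      also have "\<dots> = emeasure lborel Y" by simp
      finally show "emeasure lebesgue (?B r) \<le> ennreal (\<tau> * r\<^sup>2)" using Y by simp
    qed
  qed
  show "((\<lambda>r. measure lebesgue (?B r) / measure lebesgue (ball z r)) \<longlongrightarrow> 0) (at_right 0)"
    by (rule density_tendsto_0[where B = ?B, OF main])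
qed

end

end

section \<open>Quasiconformality and fibres\<close>

lemma dist_diam_le: "(\<And>x y. x \<in> C \<Longrightarrow> y \<in> C \<Longrightarrow> d x y \<le> c) \<Longrightarrow> dist_diam d C \<le> ennreal c"
  unfolding dist_diam_def by (intro SUP_least ennreal_leI)

text \<open>Cover the square by small rectangles with sides along \<open>v\<close> and \<open>\<i> v\<close> whose side lengths
  are proportional to \<open>1 / s v\<close> and \<open>1 / M\<close>.\<close>
lemma hausdorff2_unit_square_le:
  assumes s: "seminorm_on_plane s" and M: "\<And>w. s w \<le> M * norm w"
    and v: "norm v = 1" "s v = m" and m: "0 < m" "m \<le> M"
  shows "hausdorff2 (\<lambda>x y. s (x - y)) {x. 0 \<le> Re x \<and> Re x \<le> 1 \<and> 0 \<le> Im x \<and> Im x \<le> 1}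
    \<le> ennreal (50 * pi * M * m)" (is "hausdorff2 ?d ?Q \<le> _")
  unfolding hausdorff2_def
proof (rule SUP_least)
  fix \<delta> :: real assume "\<delta> \<in> {0<..}"
  then have \<delta>: "0 < \<delta>" by simp
  have M0: "0 < M" using m by linarith
  obtain N0 :: nat where N0: "max (M / m) (2 * M / \<delta>) < real N0" using reals_Archimedean2 by blast
  define N where "N = real N0"
  have N: "M / m < N" "2 * M / \<delta> < N" using N0 by (auto simp: N_def)
  have Npos: "0 < N" using N(1) M0 m by (meson divide_pos_pos less_trans)
  have mN: "1 < m * N / M" using N(1) m M0 by (simp add: field_simps)
  \<comment> \<open>Subdivisions per unit length along \<open>v\<close>. The value m N / M balances
    the two contributions m / A and M / N to the \<open>s\<close>-diameter of a cell.\<close>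
  define A0 where "A0 = nat \<lceil>m * N / M\<rceil>"
  define A where "A = real A0"
  have A: "m * N / M \<le> A" "A < m * N / M + 1"
    using mN by (auto simp: A_def A0_def) linarith+
  have A1: "1 < A" using A mN by linarith
  then have Apos: "0 < A" by linarith
  have N1: "1 \<le> N" using Npos by (simp add: N_def)
  define cell where "cell j k = {w :: complex. of_nat j \<le> (Re (w * cnj v) + 2) * A \<and> (Re (w * cnj v) + 2) * A \<le> of_nat j + 1
      \<and> of_nat k \<le> (Im (w * cnj v) + 2) * N \<and> (Im (w * cnj v) + 2) * N \<le> of_nat k + 1}" for j k :: nat
  \<comment> \<open>The coordinates of the square along \<open>v\<close> and \<open>\<i> * v\<close>
    lie in [-2, 2], which explains the shift by 2 in \<open>cell\<close> and the factors 4; the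
    additional index in each direction takes care of the right end point.\<close>
  define T where "T = (4 * A0 + 1) * (4 * N0 + 1)"
  define C where "C i = (if i < T then cell (i mod (4 * A0 + 1)) (i div (4 * A0 + 1)) else {})" for i
  have vv: "cnj v * v = 1" using v(1) by (simp add: complex_mult_cnj cmod_def complex_eq_iff mult.commute power2_eq_square)
  have dec: "w = of_real (Re (w * cnj v)) * v + of_real (Im (w * cnj v)) * (\<i> * v)" for w
  proof -
    have "w = (w * cnj v) * v" by (simp add: mult.assoc vv)
    also have "w * cnj v = of_real (Re (w * cnj v)) + of_real (Im (w * cnj v)) * \<i>"
      by (simp add: complex_eq_iff)
    finally show ?thesis by (simp add: algebra_simps)
  qed
  have hom: "s (of_real c * x) = \<bar>c\<bar> * s x" for c x
    using s by (simp add: seminorm_on_plane_def)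
  have sv: "s w \<le> \<bar>Re (w * cnj v)\<bar> * m + \<bar>Im (w * cnj v)\<bar> * M" for w
  proof -
    have "s w \<le> s (of_real (Re (w * cnj v)) * v) + s (of_real (Im (w * cnj v)) * (\<i> * v))"
      using s dec[of w] unfolding seminorm_on_plane_def by metis
    also have "\<dots> = \<bar>Re (w * cnj v)\<bar> * m + \<bar>Im (w * cnj v)\<bar> * s (\<i> * v)"
      by (simp only: hom v(2))
    also have "\<dots> \<le> \<bar>Re (w * cnj v)\<bar> * m + \<bar>Im (w * cnj v)\<bar> * M"
      using M[of "\<i> * v"] v(1) by (intro add_left_mono mult_left_mono) (auto simp: norm_mult)
    finally show ?thesis .
  qed
  have diam: "dist_diam ?d (cell j k) \<le> ennreal (2 * M / N)" for j k
  proof (rule dist_diam_le)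
    fix x y assume xy: "x \<in> cell j k" "y \<in> cell j k"
    have r: "(x - y) * cnj v = x * cnj v - y * cnj v" by (simp add: algebra_simps)
    have "\<bar>Re ((x - y) * cnj v) * A\<bar> \<le> 1"
      unfolding r using xy by (auto simp: cell_def algebra_simps abs_le_iff)
    then have "\<bar>Re ((x - y) * cnj v)\<bar> * \<bar>A\<bar> \<le> 1" by (simp only: abs_mult)
    then have a: "\<bar>Re ((x - y) * cnj v)\<bar> \<le> 1 / A"
      using Apos by (subst pos_le_divide_eq) (auto simp only: abs_of_pos)
    have "\<bar>Im ((x - y) * cnj v) * N\<bar> \<le> 1"
      unfolding r using xy by (auto simp: cell_def algebra_simps abs_le_iff)
    then have "\<bar>Im ((x - y) * cnj v)\<bar> * \<bar>N\<bar> \<le> 1" by (simp only: abs_mult)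
    then have b: "\<bar>Im ((x - y) * cnj v)\<bar> \<le> 1 / N"
      using Npos by (subst pos_le_divide_eq) (auto simp only: abs_of_pos)
    have "s (x - y) \<le> 1 / A * m + 1 / N * M"
      using sv[of "x - y"] mult_right_mono[OF a, of m] mult_right_mono[OF b, of M] m M0 by linarith
    also have "1 / A * m \<le> M / N"
      using A(1) Apos Npos M0 by (simp add: field_simps)
    finally show "s (x - y) \<le> 2 * M / N" by simp
  qed
  have cover: "?Q \<subseteq> (\<Union>i. C i)"
  proof
    fix w assume w: "w \<in> ?Q"
    have nw: "norm w \<le> 2" using cmod_le[of w] w by auto
    have "norm (w * cnj v) \<le> 2" using nw v(1) by (simp add: norm_mult)
    then have ab: "\<bar>Re (w * cnj v)\<bar> \<le> 2" "\<bar>Im (w * cnj v)\<bar> \<le> 2"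
      using abs_Re_le_cmod[of "w * cnj v"] abs_Im_le_cmod[of "w * cnj v"] by linarith+
    define a where "a = (Re (w * cnj v) + 2) * A"
    define b where "b = (Im (w * cnj v) + 2) * N"
    have a: "0 \<le> a" "a \<le> 4 * A" using ab Apos by (auto simp: a_def abs_le_iff)
    have b: "0 \<le> b" "b \<le> 4 * N" using ab Npos by (auto simp: b_def abs_le_iff)
    define j where "j = nat \<lfloor>a\<rfloor>"
    define k where "k = nat \<lfloor>b\<rfloor>"
    have j: "real j \<le> a" "a \<le> real j + 1" using a(1) by (auto simp: j_def)
    have k: "real k \<le> b" "b \<le> real k + 1" using b(1) by (auto simp: k_def)
    have "real j \<le> real (4 * A0)" "real k \<le> real (4 * N0)"
      using j k a b by (auto simp: A_def N_def)
    then have jk: "j < 4 * A0 + 1" "k < 4 * N0 + 1" by linarith+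
    define i where "i = k * (4 * A0 + 1) + j"
    have gen: "(k * P + j) mod P = j \<and> (k * P + j) div P = k" if "j < P" for P
      using that by simp
    have i: "i mod (4 * A0 + 1) = j" "i div (4 * A0 + 1) = k"
      using gen[OF jk(1)] unfolding i_def by blast+
    have "i < (k + 1) * (4 * A0 + 1)" using jk by (simp add: i_def)
    also have "\<dots> \<le> T" unfolding T_def mult.commute[of "4 * A0 + 1"] using jk by (intro mult_right_mono) auto
    finally have "w \<in> C i" using j k unfolding C_def i cell_def by (simp add: a_def b_def)
    then show "w \<in> (\<Union>i. C i)" by blast
  qed
  have Cd: "dist_diam ?d (C i) \<le> (if i < T then ennreal (2 * M / N) else 0)" for i
    using diam by (auto simp: C_def dist_diam_def bot_ennreal)
  have "ennreal (2 * M / N) < ennreal \<delta>"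
    using N(2) Npos \<delta> by (intro ennreal_lessI) (auto simp: field_simps)
  then have Cs: "dist_diam ?d (C i) < ennreal \<delta>" for i
    using Cd[of i] \<delta> by (auto split: if_splits)
  have "hausdorff2_pre ?d \<delta> ?Q \<le> (\<Sum>i. ennreal (pi / 4) * dist_diam ?d (C i) ^ 2)"
    unfolding hausdorff2_pre_def using cover Cs by (intro INF_lower) auto
  also have "\<dots> \<le> (\<Sum>i. if i < T then ennreal (pi / 4) * ennreal (2 * M / N) ^ 2 else 0)"
  proof (rule suminf_le)
    fix i
    have "dist_diam ?d (C i) ^ 2 \<le> (if i < T then ennreal (2 * M / N) else 0) ^ 2"
      by (intro power_mono Cd) simp
    then show "ennreal (pi / 4) * dist_diam ?d (C i) ^ 2
        \<le> (if i < T then ennreal (pi / 4) * ennreal (2 * M / N) ^ 2 else 0)"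
      by (auto split: if_splits intro: mult_left_mono)
  qed auto
  also have "\<dots> = (\<Sum>i<T. ennreal (pi / 4) * ennreal (2 * M / N) ^ 2)"
    by (subst suminf_finite[of "{..<T}"]) auto
  also have "\<dots> = ennreal (real T * (pi / 4 * (2 * M / N)\<^sup>2))"
    using M0 Npos by (simp add: ennreal_power ennreal_of_nat_eq_real_of_nat flip: ennreal_mult)
  also have "\<dots> \<le> ennreal (50 * pi * M * m)"
  proof (rule ennreal_leI)
    have "real T = (4 * A + 1) * (4 * N + 1)" by (simp add: T_def A_def N_def algebra_simps)
    also have "\<dots> \<le> (5 * A) * (5 * N)" using A1 N1 by (intro mult_mono) auto
    also have "\<dots> \<le> (5 * (2 * (m * N / M))) * (5 * N)"
    proof -
      have "A \<le> 2 * (m * N / M)"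
        unfolding mult_2 by (rule order_trans[OF less_imp_le[OF A(2)] add_left_mono[OF less_imp_le[OF mN]]])
      then show ?thesis using Npos by (intro mult_right_mono mult_left_mono) auto
    qed
    finally have "real T * (pi / 4 * (2 * M / N)\<^sup>2)
        \<le> (5 * (2 * (m * N / M))) * (5 * N) * (pi / 4 * (2 * M / N)\<^sup>2)"
      by (intro mult_right_mono) auto
    also have "\<dots> = 50 * pi * M * m" using M0 Npos by (simp add: power2_eq_square field_simps)
    finally show "real T * (pi / 4 * (2 * M / N)\<^sup>2) \<le> 50 * pi * M * m" .
  qed
  finally show "hausdorff2_pre ?d \<delta> ?Q \<le> ennreal (50 * pi * M * m)" .
qed

text \<open>Covering the square with cells adapted to the direction of \<open>w\<close> bounds the
  Jacobian by 100 pi g times the stretch in that direction. As the Jacobian is at least g^2 / Q, no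
  direction is stretched by less than g / (100 pi Q).\<close>

lemma seminorm_lower_of_jacobian:
  assumes s: "seminorm_on_plane s" and M: "\<And>w. s w \<le> 2 * g * norm w"
    and g: "0 < g" and Q: "1 \<le> Q" and J: "ennreal g ^ 2 \<le> ennreal Q * jacobian_J s"
  shows "g * norm w \<le> 100 * pi * Q * s w"
proof (cases "w = 0")
  case True
  have "s 0 = 0" using s unfolding seminorm_on_plane_def by (metis abs_zero mult_zero_left of_real_0)
  then show ?thesis using True by simp
next
  case False
  have "0 < ennreal g ^ 2" using g by (simp add: ennreal_power)
  with J have "jacobian_J s \<noteq> 0" by auto
  then have no: "norm_on_plane s" by (auto simp: jacobian_J_def split: if_splits)
  define v where "v = of_real (1 / norm w) * w"
  have nv: "norm v = 1" using False by (simp add: v_def norm_mult norm_divide)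
  have sv: "s v = s w / norm w"
  proof -
    have "s v = \<bar>1 / norm w\<bar> * s w" unfolding v_def using s unfolding seminorm_on_plane_def by blast
    then show ?thesis by simp
  qed
  have pos: "0 < s v"
    using no nv unfolding norm_on_plane_def seminorm_on_plane_def by (metis less_eq_real_def norm_zero zero_neq_one)
  have "jacobian_J s \<le> ennreal (50 * pi * (2 * g) * s v)"
  proof -
    have "s v \<le> 2 * g" using M[of v] nv by simp
    from hausdorff2_unit_square_le[OF s M nv refl pos this] show ?thesis
      unfolding jacobian_J_def if_P[OF no] .
  qed
  then have "ennreal g ^ 2 \<le> ennreal Q * ennreal (50 * pi * (2 * g) * s v)"
    using J by (meson mult_left_mono order_trans zero_le)
  also have "\<dots> = ennreal (Q * (50 * pi * (2 * g) * s v))"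
    using Q g pos by (intro ennreal_mult[symmetric]) auto
  finally have "g\<^sup>2 \<le> Q * (50 * pi * (2 * g) * s v)"
    using Q g pos by (simp add: ennreal_power)
  then have "g * g \<le> g * (100 * pi * Q * s v)" by (simp add: power2_eq_square algebra_simps)
  then have "g \<le> 100 * pi * Q * s v" using g by simp
  then have "g * norm w \<le> 100 * pi * Q * s v * norm w" by (intro mult_right_mono) auto
  then show ?thesis using False by (simp add: sv)
qed

lemma AE_real_translate:
  assumes "AE x in lborel. P (x::real)"
  shows "AE t in lborel. P (a + t)"
proof -
  from assms obtain N where N: "N \<in> sets lborel" "emeasure lborel N = 0" "\<And>z. z \<notin> N \<Longrightarrow> P z"
    by (auto simp: eventually_ae_filter null_sets_def)
  have [measurable]: "N \<in> sets borel" using N(1) by simp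
  have "(\<integral>\<^sup>+ t. indicator N (a + t) \<partial>lborel) = (\<integral>\<^sup>+ x. indicator N x \<partial>lborel)"
    using nn_integral_real_affine[of "indicator N" 1 a] by simp
  also have "\<dots> = 0" using N by simp
  finally have "AE t in lborel. indicator N (a + t) = (0::ennreal)"
    by (subst (asm) nn_integral_0_iff_AE) auto
  then show ?thesis
    by eventually_elim (auto simp: N indicator_def split: if_splits)
qed

lemma nn_integral_complex_translate:
  assumes [measurable]: "h \<in> borel_measurable (borel :: complex measure)"
  shows "(\<integral>\<^sup>+ w. h (z + w) \<partial>lborel) = (\<integral>\<^sup>+ w. h w \<partial>lborel)"
proof -
  have "(\<integral>\<^sup>+ w. h w \<partial>lborel) = (\<integral>\<^sup>+ w. h w \<partial>distr lborel borel ((+) z))"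
    by (simp only: lborel_distr_plus)
  also have "\<dots> = (\<integral>\<^sup>+ w. h (z + w) \<partial>lborel)"
    by (subst nn_integral_distr) auto
  finally show ?thesis by simp
qed

lemma density_small:
  fixes B :: "real \<Rightarrow> complex set" and z :: complex
  assumes lim: "((\<lambda>r. measure lebesgue (B r) / measure lebesgue (ball z r)) \<longlongrightarrow> 0) (at_right 0)" and e: "0 < e"
    and B: "\<And>r. B r \<in> sets borel" "\<And>r. B r \<subseteq> ball z r"
  obtains \<delta> where "0 < \<delta>" "\<And>r. 0 < r \<Longrightarrow> r < \<delta> \<Longrightarrow> emeasure lborel (B r) \<le> ennreal (e * r\<^sup>2)"
proof -
  have "\<forall>\<^sub>F r in at_right 0. measure lebesgue (B r) / measure lebesgue (ball z r) < e / pi"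
    using e by (intro order_tendstoD(2)[OF lim]) simp
  then obtain b where b: "0 < b" "\<And>r. 0 < r \<Longrightarrow> r < b \<Longrightarrow> measure lebesgue (B r) / measure lebesgue (ball z r) < e / pi"
    unfolding eventually_at_right_field by blast
  show thesis
  proof (rule that[OF b(1)])
    fix r assume r: "0 < r" "r < b"
    have "measure lebesgue (B r) / (pi * r\<^sup>2) < e / pi"
      using b(2)[OF r] unfolding area_ball[OF less_imp_le[OF r(1)]] .
    then have "measure lborel (B r) \<le> e * r\<^sup>2"
      using r B(1)[of r] by (simp add: field_simps)
    moreover have "emeasure lborel (B r) \<noteq> top"
    proof -
      have "emeasure lborel (B r) \<le> emeasure lborel (ball z r)" using B by (intro emeasure_mono) auto
      also have "\<dots> < top" using emeasure_lborel_ball_finite[of z r] by simp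
      finally show ?thesis by simp
    qed
    ultimately show "emeasure lborel (B r) \<le> ennreal (e * r\<^sup>2)"
      by (simp add: emeasure_eq_ennreal_measure ennreal_leI)
  qed
qed

context line_sobolev
begin

text \<open>The line estimate in coordinates centred at \<open>z\<close>, so that one parameter
  \<open>t\<close> can serve several directions simultaneously.\<close>

lemma lines_at:
  assumes um: "unimodular p v" and v: "norm v = 1" and z: "z = chart p v y1 t1"
  shows "AE t in lborel. \<forall>a b. a \<le> b \<longrightarrow> (\<forall>s\<in>{a..b}. z + chart p v t s \<in> ball 0 1) \<longrightarrow>
    ennreal (dist (U (z + chart p v t a)) (U (z + chart p v t b)))
      \<le> (\<integral>\<^sup>+ s\<in>{a..b}. ennreal (\<gamma> (z + chart p v t s)) \<partial>lborel)"
  using AE_real_translate[OF lines[OF um], of y1]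
proof (eventually_elim, intro allI impI)
  fix t a b :: real
  assume h: "\<forall>a b. a \<le> b \<longrightarrow> (\<forall>s\<in>{a..b}. chart p v (y1 + t) s \<in> ball 0 1) \<longrightarrow>
      ennreal (dist (U (chart p v (y1 + t) a)) (U (chart p v (y1 + t) b)))
        \<le> (\<integral>\<^sup>+ s\<in>{a..b}. ennreal (norm v * \<gamma> (chart p v (y1 + t) s)) \<partial>lborel)"
    and ab: "a \<le> b" "\<forall>s\<in>{a..b}. z + chart p v t s \<in> ball 0 1"
  have c: "z + chart p v t s = chart p v (y1 + t) (t1 + s)" for s
    by (simp add: z chart_add)
  have "\<forall>s\<in>{t1 + a..t1 + b}. chart p v (y1 + t) s \<in> ball 0 1"
  proof
    fix s assume "s \<in> {t1 + a..t1 + b}"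
    then have "s - t1 \<in> {a..b}" by auto
    with ab(2) have "z + chart p v t (s - t1) \<in> ball 0 1" by blast
    then show "chart p v (y1 + t) s \<in> ball 0 1" by (simp add: c)
  qed
  with h[rule_format, of "t1 + a" "t1 + b"] ab(1)
  have "ennreal (dist (U (chart p v (y1 + t) (t1 + a))) (U (chart p v (y1 + t) (t1 + b))))
      \<le> (\<integral>\<^sup>+ s\<in>{t1 + a..t1 + b}. ennreal (\<gamma> (chart p v (y1 + t) s)) \<partial>lborel)"
    by (simp add: v)
  also have "\<dots> = (\<integral>\<^sup>+ s. ennreal (\<gamma> (chart p v (y1 + t) (t1 + s))) * indicator {t1 + a..t1 + b} (t1 + s) \<partial>lborel)"
    by (subst nn_integral_real_affine[where c = 1 and t = t1]) auto
  also have "\<dots> = (\<integral>\<^sup>+ s\<in>{a..b}. ennreal (\<gamma> (z + chart p v t s)) \<partial>lborel)"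
    unfolding c by (intro nn_integral_cong) (auto simp: indicator_def)
  finally show "ennreal (dist (U (z + chart p v t a)) (U (z + chart p v t b)))
      \<le> (\<integral>\<^sup>+ s\<in>{a..b}. ennreal (\<gamma> (z + chart p v t s)) \<partial>lborel)"
    by (simp only: c)
qed

lemma continuous_tangent:
  assumes z: "regular_pt z"
  shows "continuous_on UNIV (tangent z)"
proof (rule continuous_onI)
  fix w and e :: real assume e: "0 < e"
  have L: "\<bar>tangent z a - tangent z b\<bar> \<le> 2 * \<gamma> z * norm (a - b)" for a b
    using tangent_add[OF z, of "a - b" b] tangent_add[OF z, of "b - a" a]
      tangent_le_norm[OF z, of "a - b"] tangent_le_norm[OF z, of "b - a"]
    by (simp add: norm_minus_commute)
  show "\<exists>d>0. \<forall>w'\<in>UNIV. dist w' w < d \<longrightarrow> dist (tangent z w') (tangent z w) \<le> e"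
  proof (intro exI[of _ "e / (2 * \<gamma> z + 1)"] conjI ballI impI)
    have g: "0 \<le> \<gamma> z" by (rule \<gamma>_nonneg)
    then show "0 < e / (2 * \<gamma> z + 1)" using e by simp
    fix w' assume "dist w' w < e / (2 * \<gamma> z + 1)"
    then have "norm (w' - w) * (2 * \<gamma> z + 1) < e" using g by (simp add: dist_norm pos_less_divide_eq)
    moreover have "2 * \<gamma> z * norm (w' - w) \<le> norm (w' - w) * (2 * \<gamma> z + 1)" by (simp add: algebra_simps)
    ultimately show "dist (tangent z w') (tangent z w) \<le> e"
      using L[of w' w] by (simp add: dist_real_def)
  qed
qed

text \<open>Zero density of the deviation set, unwound into an area bound at every sufficiently
  small radius.\<close>

lemma deviation_small:
  assumes z: "regular_pt z" and "0 < \<epsilon>" "0 < e"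
  obtains \<delta> where "0 < \<delta>" "ball z \<delta> \<subseteq> ball 0 1" "\<And>r. 0 < r \<Longrightarrow> r < \<delta> \<Longrightarrow>
    emeasure lborel {w \<in> ball z r. \<epsilon> * norm (w - z) < \<bar>dist (U w) (U z) - tangent z (w - z)\<bar>} \<le> ennreal (e * r\<^sup>2)"
proof -
  define P where "P w \<longleftrightarrow> \<epsilon> * norm (w - z) < \<bar>dist (U w) (U z) - tangent z (w - z)\<bar>" for w
  have "open {w. P w}"
    unfolding P_def
    by (intro open_Collect_less continuous_intros continuous_on_compose2[OF continuous_tangent[OF z]]) auto
  then have op: "{w \<in> ball 0 1 \<inter> ball z r. P w} \<in> sets borel" for r
    unfolding Collect_conj_eq Collect_mem_eq by (intro borel_open open_Int open_ball)
  have "z \<in> ball 0 1" using z by (simp add: regular_pt_def)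
  then obtain d0 where d0: "0 < d0" "ball z d0 \<subseteq> ball 0 1" by (meson open_ball openE)
  have "((\<lambda>r. measure lebesgue {w \<in> ball 0 1 \<inter> ball z r. P w} / measure lebesgue (ball z r)) \<longlongrightarrow> 0) (at_right 0)"
    using ap_md_tangent[OF z, unfolded ap_md_def, THEN conjunct2, rule_format, OF \<open>0 < \<epsilon>\<close>]
    unfolding P_def .
  then obtain b where b: "0 < b" "\<And>r. 0 < r \<Longrightarrow> r < b \<Longrightarrow>
      emeasure lborel {w \<in> ball 0 1 \<inter> ball z r. P w} \<le> ennreal (e * r\<^sup>2)"
  proof (rule density_small[OF _ \<open>0 < e\<close>])
    show "{w \<in> ball 0 1 \<inter> ball z r. P w} \<in> sets borel" for r by (rule op)
    show "{w \<in> ball 0 1 \<inter> ball z r. P w} \<subseteq> ball z r" for r by auto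
  qed (rule that)
  show thesis
  proof (rule that[of "min b d0"])
    fix r assume r: "0 < r" "r < min b d0"
    have "ball z r \<subseteq> ball z d0" using r by (simp add: subset_ball)
    then have "ball z r \<subseteq> ball 0 1" using d0(2) by (rule order_trans)
    then have "ball 0 1 \<inter> ball z r = ball z r" by (rule Int_absorb1)
    then have "emeasure lborel {w \<in> ball z r. P w} \<le> ennreal (e * r\<^sup>2)"
      using b(2)[of r] r by (simp only: min_less_iff_conj)
    then show "emeasure lborel {w \<in> ball z r. \<epsilon> * norm (w - z) < \<bar>dist (U w) (U z) - tangent z (w - z)\<bar>} \<le> ennreal (e * r\<^sup>2)"
      unfolding P_def .
  next
    show "0 < min b d0" using b(1) d0(1) by simp
    show "ball z (min b d0) \<subseteq> ball 0 1"
      by (rule order_trans[OF subset_ball d0(2)]) simp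
  qed
qed

text \<open>If the fibre through \<open>z\<close> were nondegenerate it would meet every small square centred at \<open>z\<close>,
  although on most points of a good square \<open>U\<close> is far from \<open>U z\<close> and nearly Lipschitz.\<close>
lemma fibre_trivial:
  assumes z: "regular_pt z" and c: "0 < c" "\<And>w. c * norm w \<le> tangent z w"
    and con: "connected {w \<in> cball 0 1. U w = U z}"
    and z': "z' \<in> cball 0 1" "U z' = U z"
  shows "z' = z"
proof (rule ccontr)
  assume "z' \<noteq> z"
  \<comment> \<open>Distance from \<open>z\<close> in the maximum norm: its level sets are
    boundaries of squares, made of segments to which the line estimate applies. The connected fibre
    contains \<open>z\<close> and \<open>z'\<close>, so it meets all level sets between
    them.\<close>
  define mx where "mx w = max \<bar>Re (w - z)\<bar> \<bar>Im (w - z)\<bar>" for w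
  have mx0: "0 < mx z'" using \<open>z' \<noteq> z\<close> by (auto simp: mx_def complex_eq_iff less_max_iff_disj)
  have mxc: "continuous_on S mx" for S unfolding mx_def by (intro continuous_intros)
  have zD: "z \<in> ball 0 1" using z by (simp add: regular_pt_def)
  have fib: "\<exists>q. U q = U z \<and> mx q = t" if "0 \<le> t" "t \<le> mx z'" for t
  proof -
    have "connected (mx ` {w \<in> cball 0 1. U w = U z})"
      by (rule connected_continuous_image[OF mxc con])
    moreover have "mx z \<in> mx ` {w \<in> cball 0 1. U w = U z}" "mx z' \<in> mx ` {w \<in> cball 0 1. U w = U z}"
      using zD z' by (intro imageI CollectI; simp)+
    moreover have "mx z = 0" by (simp add: mx_def)
    ultimately have "t \<in> mx ` {w \<in> cball 0 1. U w = U z}"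
      using that by (auto intro: connectedD_interval)
    then show ?thesis by auto
  qed
  have g: "0 \<le> \<gamma> z" by (rule \<gamma>_nonneg)
  \<comment> \<open>Relative length of a piece of side about the fibre point; the expected
    oscillation \<open>\<gamma> z * (\<eta> * t)\<close> of \<open>U\<close> along it is at most c
    t/8.\<close>
  define \<eta> where "\<eta> = min 1 (c / (8 * (\<gamma> z + 1)))"
  have \<eta>: "0 < \<eta>" "\<eta> \<le> 1" using c g by (auto simp: \<eta>_def)
  have g\<eta>: "\<gamma> z * \<eta> \<le> c / 8"
  proof -
    have "\<gamma> z * \<eta> \<le> (\<gamma> z + 1) * (c / (8 * (\<gamma> z + 1)))"
      using g \<eta> by (intro mult_mono) (auto simp: \<eta>_def)
    also have "\<dots> = c / 8"
    proof -
      have "\<gamma> z + 1 \<noteq> 0" using g by linarith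
      then show ?thesis by (simp add: divide_simps)
    qed
    finally show ?thesis .
  qed
  \<comment> \<open>The first bound makes a piece of length \<open>\<eta> * t\<close> too long to
    lie entirely in \<open>Bad\<close>; the second keeps the error \<open>16 * \<kappa> * r\<close>
    below c t/8.\<close>
  define \<kappa> where "\<kappa> = min (\<eta> / 64) (c / 256)"
  have \<kappa>: "0 < \<kappa>" "64 * \<kappa> \<le> \<eta>" "256 * \<kappa> \<le> c" using \<eta> c by (auto simp: \<kappa>_def)
  define Bad where "Bad = {w. dist (U w) (U z) < c / 2 * norm (w - z)}"
  have [measurable]: "Bad \<in> sets borel"
  proof -
    have "open Bad" unfolding Bad_def by (intro open_Collect_less continuous_intros)
    then show ?thesis by simp
  qed
  \<comment> \<open>Records the deviation of \<open>\<gamma>\<close> and the points of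
    \<open>Bad\<close> in one function, so that one choice of the square controls both.\<close>
  define h where "h w = ennreal \<bar>\<gamma> w - \<gamma> z\<bar> + indicator Bad w" for w
  have [measurable]: "h \<in> borel_measurable borel" unfolding h_def by measurable
  have c2: "0 < c / 2" and \<kappa>32: "0 < \<kappa> / 32" using c \<kappa> by auto
  obtain d1 where d1: "0 < d1" "ball z d1 \<subseteq> ball 0 1" "\<And>r. 0 < r \<Longrightarrow> r < d1 \<Longrightarrow>
    emeasure lborel {w \<in> ball z r. c / 2 * norm (w - z) < \<bar>dist (U w) (U z) - tangent z (w - z)\<bar>} \<le> ennreal (\<kappa> / 32 * r\<^sup>2)"
    using deviation_small[OF z c2 \<kappa>32] by blast
  have "lebesgue_pt \<gamma> z" using z by (simp add: regular_pt_def)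
  moreover have "0 < \<kappa> / (8 * pi)" using \<kappa> by simp
  ultimately obtain d2 where d2: "0 < d2" "\<And>r. 0 < r \<Longrightarrow> r < d2 \<Longrightarrow>
      (\<integral>\<^sup>+ w\<in>cball z r. ennreal \<bar>\<gamma> w - \<gamma> z\<bar> \<partial>lborel) \<le> ennreal (\<kappa> / (8 * pi) * measure lborel (cball z r))"
    unfolding lebesgue_pt_def by blast
  define r where "r = min (min d1 d2) (mx z') / 8"
  have r: "0 < r" "4 * r < d1" "2 * r < d2" "r < mx z'"
    using d1 d2 mx0 by (auto simp: r_def min_def)
  have hI: "(\<integral>\<^sup>+ w\<in>cball z (2 * r). h w \<partial>lborel) \<le> ennreal (\<kappa> * r\<^sup>2)"
  proof -
    have "(\<integral>\<^sup>+ w\<in>cball z (2 * r). h w \<partial>lborel)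
        = (\<integral>\<^sup>+ w\<in>cball z (2 * r). ennreal \<bar>\<gamma> w - \<gamma> z\<bar> \<partial>lborel) + (\<integral>\<^sup>+ w. indicator (Bad \<inter> cball z (2 * r)) w \<partial>lborel)"
      by (subst nn_integral_add[symmetric]) (auto simp: h_def distrib_right indicator_inter_arith intro!: nn_integral_cong)
    also have "\<dots> \<le> ennreal (\<kappa> / (8 * pi) * measure lborel (cball z (2 * r))) + emeasure lborel (Bad \<inter> cball z (2 * r))"
      using r by (intro add_mono d2) auto
    also have "\<kappa> / (8 * pi) * measure lborel (cball z (2 * r)) = \<kappa> / 2 * r\<^sup>2"
      using content_cball[of "2 * r" z] r by (simp add: unit_ball_vol_2 power2_eq_square)
    also have "emeasure lborel (Bad \<inter> cball z (2 * r)) \<le> emeasure lborel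
        {w \<in> ball z (4 * r). c / 2 * norm (w - z) < \<bar>dist (U w) (U z) - tangent z (w - z)\<bar>}"
    proof (intro emeasure_mono subsetI)
      fix w assume w: "w \<in> Bad \<inter> cball z (2 * r)"
      have "c * norm (w - z) \<le> tangent z (w - z)" by (rule c(2))
      moreover have "dist (U w) (U z) < c / 2 * norm (w - z)" using w by (simp add: Bad_def)
      ultimately have "c / 2 * norm (w - z) < \<bar>dist (U w) (U z) - tangent z (w - z)\<bar>"
        by linarith
      then show "w \<in> {w \<in> ball z (4 * r). c / 2 * norm (w - z) < \<bar>dist (U w) (U z) - tangent z (w - z)\<bar>}"
        using w r by auto
    next
      have "open (ball z (4 * r) \<inter> {y. c / 2 * norm (y - z) < \<bar>dist (U y) (U z) - tangent z (y - z)\<bar>})"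
        by (intro open_Int open_Collect_less continuous_intros continuous_on_compose2[OF continuous_tangent[OF z]]) auto
      then show "{w \<in> ball z (4 * r). c / 2 * norm (w - z) < \<bar>dist (U w) (U z) - tangent z (w - z)\<bar>} \<in> sets lborel"
      proof -
        have eq: "{w \<in> ball z (4 * r). P w} = ball z (4 * r) \<inter> {y. P y}" for P by auto
        assume "open (ball z (4 * r) \<inter> {y. c / 2 * norm (y - z) < \<bar>dist (U y) (U z) - tangent z (y - z)\<bar>})"
        then show ?thesis unfolding eq by (simp only: sets_lborel borel_open)
      qed
    qed
    also have "\<dots> \<le> ennreal (\<kappa> / 32 * (4 * r)\<^sup>2)" using r by (intro d1) auto
    also have "\<kappa> / 32 * (4 * r)\<^sup>2 = \<kappa> / 2 * r\<^sup>2" by (simp add: power2_eq_square)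
    also have "ennreal (\<kappa> / 2 * r\<^sup>2) + ennreal (\<kappa> / 2 * r\<^sup>2) = ennreal (\<kappa> * r\<^sup>2)"
      using \<kappa> by (simp flip: ennreal_plus)
    finally show ?thesis by (simp add: add_left_mono)
  qed
  define K where "K p v t = (\<integral>\<^sup>+ s\<in>{-r..r}. h (z + chart p v t s) \<partial>lborel)" for p v t
  have [measurable]: "K p v \<in> borel_measurable borel" for p v unfolding K_def by measurable
  have KI: "(\<integral>\<^sup>+ t\<in>{r/2..r}. K p v t \<partial>lborel) \<le> ennreal (\<kappa> * r\<^sup>2)"
    if um: "unimodular p v" and n: "norm p = 1" "norm v = 1" for p v
  proof -
    have "(\<integral>\<^sup>+ t\<in>{r/2..r}. K p v t \<partial>lborel)
        \<le> (\<integral>\<^sup>+ t. \<integral>\<^sup>+ s. h (z + chart p v t s) * indicator (cball z (2 * r)) (z + chart p v t s) \<partial>lborel \<partial>lborel)"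
    proof (intro nn_integral_mono)
      fix t
      show "K p v t * indicator {r/2..r} t \<le> (\<integral>\<^sup>+ s. h (z + chart p v t s) * indicator (cball z (2 * r)) (z + chart p v t s) \<partial>lborel)"
      proof (cases "t \<in> {r/2..r}")
        case True
        have "z + chart p v t s \<in> cball z (2 * r)" if "s \<in> {-r..r}" for s
        proof -
          have "norm (chart p v t s) \<le> \<bar>t\<bar> + \<bar>s\<bar>"
            unfolding chart_def by (rule order_trans[OF norm_triangle_ineq]) (simp add: norm_mult n)
          then show ?thesis using True that by (auto simp: dist_norm)
        qed
        then show ?thesis using True unfolding K_def
          by (auto intro!: nn_integral_mono mult_left_mono indicator_leI simp del: mem_cball)
      qed simp
    qed
    also have "\<dots> = (\<integral>\<^sup>+ w. h (z + w) * indicator (cball z (2 * r)) (z + w) \<partial>lborel)"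
      by (rule unimodularD[OF um, symmetric]) measurable
    also have "\<dots> = (\<integral>\<^sup>+ w\<in>cball z (2 * r). h w \<partial>lborel)"
      by (rule nn_integral_complex_translate[of "\<lambda>w. h w * indicator (cball z (2 * r)) w"]) measurable
    also note hI
    finally show ?thesis .
  qed
  define good where "good p v t \<longleftrightarrow> (\<forall>a b. a \<le> b \<longrightarrow> (\<forall>s\<in>{a..b}. z + chart p v t s \<in> ball 0 1) \<longrightarrow>
    ennreal (dist (U (z + chart p v t a)) (U (z + chart p v t b)))
      \<le> (\<integral>\<^sup>+ s\<in>{a..b}. ennreal (\<gamma> (z + chart p v t s)) \<partial>lborel))" for p v t
  have u: "unimodular 1 \<i>" "unimodular (-1) \<i>" "unimodular \<i> 1" "unimodular (-\<i>) 1"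
    by (intro unimodular_vertical unimodular_horizontal unimodular_uminus)+
  have ch: "z = chart 1 \<i> (Re z) (Im z)" "z = chart (-1) \<i> (- Re z) (Im z)"
      "z = chart \<i> 1 (Im z) (Re z)" "z = chart (-\<i>) 1 (- Im z) (Re z)"
    by (simp_all add: chart_def complex_eq_iff)
  have gd: "AE t in lborel. good 1 \<i> t \<and> good (-1) \<i> t \<and> good \<i> 1 t \<and> good (-\<i>) 1 t"
    unfolding good_def
    using lines_at[OF u(1) _ ch(1)] lines_at[OF u(2) _ ch(2)] lines_at[OF u(3) _ ch(3)] lines_at[OF u(4) _ ch(4)]
    by (intro AE_conjI) simp_all
  \<comment> \<open>The four sides are summed before averaging over \<open>t\<close>; this yields
    one \<open>t\<close> for which every side of the square is good.\<close>
  define KK where "KK t = K 1 \<i> t + K (-1) \<i> t + K \<i> 1 t + K (-\<i>) 1 t" for t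
  have "(\<integral>\<^sup>+ t\<in>{r/2..r}. KK t \<partial>lborel) = (\<integral>\<^sup>+ t\<in>{r/2..r}. K 1 \<i> t \<partial>lborel) + (\<integral>\<^sup>+ t\<in>{r/2..r}. K (-1) \<i> t \<partial>lborel)
      + (\<integral>\<^sup>+ t\<in>{r/2..r}. K \<i> 1 t \<partial>lborel) + (\<integral>\<^sup>+ t\<in>{r/2..r}. K (-\<i>) 1 t \<partial>lborel)"
    unfolding KK_def distrib_right by (simp add: nn_integral_add)
  also have "\<dots> \<le> ennreal (\<kappa> * r\<^sup>2) + ennreal (\<kappa> * r\<^sup>2) + ennreal (\<kappa> * r\<^sup>2) + ennreal (\<kappa> * r\<^sup>2)"
    by (intro add_mono KI u) simp_all
  also have "\<dots> = ennreal (8 * \<kappa> * r * (r - r / 2))"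
    using \<kappa> r by (simp add: power2_eq_square flip: ennreal_plus)
  finally have "\<exists>t\<in>{r/2..r}. (good 1 \<i> t \<and> good (-1) \<i> t \<and> good \<i> 1 t \<and> good (-\<i>) 1 t) \<and> KK t \<le> ennreal (2 * (8 * \<kappa> * r))"
    using r \<kappa> by (intro exists_small_AE[OF gd]) auto
  then obtain t where "t \<in> {r/2..r}" and
    gt: "good 1 \<i> t" "good (-1) \<i> t" "good \<i> 1 t" "good (-\<i>) 1 t" and "KK t \<le> ennreal (2 * (8 * \<kappa> * r))"
    by blast
  then have t: "r / 2 \<le> t" "t \<le> r" and KKt: "KK t \<le> ennreal (16 * \<kappa> * r)"
    by (simp_all add: mult.assoc)
  have Kt: "K 1 \<i> t \<le> KK t" "K (-1) \<i> t \<le> KK t" "K \<i> 1 t \<le> KK t" "K (-\<i>) 1 t \<le> KK t"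
    unfolding KK_def by (simp_all add: add_increasing add_increasing2 add.assoc)
  obtain q where q: "U q = U z" "mx q = t" using fib[of t] t r by auto
  \<comment> \<open>Near the fibre point \<open>q\<close> on its side there is a point off
    \<open>Bad\<close>, whose image has distance at least c t/2 from \<open>U z = U q\<close>. Along
    the side, however, \<open>U\<close> moves by at most c t/4 between the two.\<close>
  have side: False if gp: "good p v t" and Kp: "K p v t \<le> KK t" and n: "norm p = 1" "norm v = 1"
    and far: "\<And>s. t \<le> norm (chart p v t s)" and qs: "q = z + chart p v t s0" "\<bar>s0\<bar> \<le> t" for p v s0
  proof -
    have t0: "0 < t" using t r by linarith
    define a where "a = (if s0 \<le> 0 then s0 else s0 - \<eta> * t)"
    define b where "b = a + \<eta> * t"
    have \<eta>t: "0 < \<eta> * t" "\<eta> * t \<le> t" using \<eta> t0 by auto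
    have ab: "a \<le> s0" "s0 \<le> b" "-r \<le> a" "b \<le> r"
      using qs(2) \<eta>t t by (auto simp: a_def b_def)
    have pD: "z + chart p v t s \<in> ball 0 1" if "s \<in> {a..b}" for s
    proof -
      have "norm (chart p v t s) \<le> \<bar>t\<bar> + \<bar>s\<bar>"
        unfolding chart_def by (rule order_trans[OF norm_triangle_ineq]) (simp add: norm_mult n)
      then have "z + chart p v t s \<in> ball z d1" using that ab t r by (auto simp: dist_norm)
      then show ?thesis using d1(2) by blast
    qed
    have K16: "K p v t \<le> ennreal (16 * \<kappa> * r)" using Kp KKt by (rule order_trans)
    have "\<exists>s\<in>{a..b}. z + chart p v t s \<notin> Bad"
    proof (rule ccontr)
      assume "\<not> ?thesis"
      then have "(\<integral>\<^sup>+ s. indicator {a..b} s \<partial>lborel) \<le> K p v t"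
        unfolding K_def h_def using ab
        by (intro nn_integral_mono) (auto simp: indicator_def intro: add_increasing)
      then have "ennreal (\<eta> * t) \<le> ennreal (16 * \<kappa> * r)"
        using K16 \<eta>t by (simp add: b_def)
      then have "\<eta> * t \<le> 16 * \<kappa> * r" using \<kappa> r by (subst (asm) ennreal_le_iff) auto
      also have "\<dots> \<le> 32 * \<kappa> * t" using mult_left_mono[of r "2 * t" "16 * \<kappa>"] t \<kappa> by simp
      finally have "\<eta> \<le> 32 * \<kappa>" using t0 by simp
      then show False using \<kappa> by linarith
    qed
    then obtain s where s: "s \<in> {a..b}" "z + chart p v t s \<notin> Bad" by blast
    define a' where "a' = min s s0"
    define b' where "b' = max s s0"
    have ab': "a' \<le> b'" "a \<le> a'" "b' \<le> b" using s ab by (auto simp: a'_def b'_def)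
    have "ennreal (dist (U (z + chart p v t s)) (U q)) = ennreal (dist (U (z + chart p v t a')) (U (z + chart p v t b')))"
      by (auto simp: a'_def b'_def qs(1) min_def max_def dist_commute)
    also have "\<dots> \<le> (\<integral>\<^sup>+ s\<in>{a'..b'}. ennreal (\<gamma> (z + chart p v t s)) \<partial>lborel)"
    proof -
      have "\<forall>s\<in>{a'..b'}. z + chart p v t s \<in> ball 0 1"
        using ab' by (intro ballI pD) auto
      then show ?thesis using gp ab'(1) unfolding good_def by blast
    qed
    also have "\<dots> \<le> (\<integral>\<^sup>+ s. h (z + chart p v t s) * indicator {-r..r} s + ennreal (\<gamma> z) * indicator {a..b} s \<partial>lborel)"
    proof (intro nn_integral_mono)
      fix s
      have "ennreal (\<gamma> (z + chart p v t s)) \<le> ennreal (\<bar>\<gamma> (z + chart p v t s) - \<gamma> z\<bar> + \<gamma> z)"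
        by (intro ennreal_leI) linarith
      also have "\<dots> = ennreal \<bar>\<gamma> (z + chart p v t s) - \<gamma> z\<bar> + ennreal (\<gamma> z)" using g by simp
      also have "\<dots> \<le> h (z + chart p v t s) + ennreal (\<gamma> z)" unfolding h_def by (intro add_right_mono) simp
      finally show "ennreal (\<gamma> (z + chart p v t s)) * indicator {a'..b'} s
          \<le> h (z + chart p v t s) * indicator {-r..r} s + ennreal (\<gamma> z) * indicator {a..b} s"
        using ab ab' by (auto simp: indicator_def)
    qed
    also have "\<dots> = K p v t + ennreal (\<gamma> z) * ennreal (\<eta> * t)"
      unfolding K_def using \<eta>t by (subst nn_integral_add) (auto simp: nn_integral_cmult b_def)
    also have "\<dots> \<le> ennreal (16 * \<kappa> * r) + ennreal (\<gamma> z) * ennreal (\<eta> * t)"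
      by (intro add_right_mono K16)
    also have "\<dots> = ennreal (16 * \<kappa> * r + \<gamma> z * (\<eta> * t))"
      using \<kappa> r g \<eta>t by (simp flip: ennreal_mult ennreal_plus)
    finally have "dist (U (z + chart p v t s)) (U q) \<le> 16 * \<kappa> * r + \<gamma> z * (\<eta> * t)"
      using \<kappa> r g \<eta>t by (subst (asm) ennreal_le_iff) auto
    moreover have "16 * \<kappa> * r \<le> c / 8 * t"
    proof -
      have "16 * \<kappa> * r \<le> 16 * \<kappa> * (2 * t)" using t \<kappa> by (intro mult_left_mono) auto
      also have "\<dots> = 32 * \<kappa> * t" by simp
      also have "\<dots> \<le> c / 8 * t" using \<kappa> t0 by (intro mult_right_mono) auto
      finally show ?thesis .
    qed
    moreover have "\<gamma> z * (\<eta> * t) \<le> c / 8 * t"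
      using mult_right_mono[OF g\<eta>, of t] t0 by (simp add: mult.assoc)
    moreover have "c / 2 * t \<le> dist (U (z + chart p v t s)) (U q)"
    proof -
      have "c / 2 * t \<le> c / 2 * norm (chart p v t s)" using far c by (intro mult_left_mono) auto
      also have "\<dots> \<le> dist (U (z + chart p v t s)) (U z)" using s(2) by (simp add: Bad_def)
      finally show ?thesis using q by simp
    qed
    ultimately have "c / 2 * t \<le> c / 4 * t" by linarith
    then show False using c t0 by simp
  qed
  define x where "x = Re (q - z)"
  define y where "y = Im (q - z)"
  have xy: "max \<bar>x\<bar> \<bar>y\<bar> = t" using q by (simp add: mx_def x_def y_def)
  have re: "chart 1 \<i> t s = Complex t s" "chart (-1) \<i> t s = Complex (-t) s"
    "chart \<i> 1 t s = Complex s t" "chart (-\<i>) 1 t s = Complex s (-t)" for s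
    by (simp_all add: chart_def complex_eq_iff)
  have far: "t \<le> norm (Complex t s)" "t \<le> norm (Complex (-t) s)" "t \<le> norm (Complex s t)" "t \<le> norm (Complex s (-t))" for s
    using abs_Re_le_cmod[of "Complex t s"] abs_Re_le_cmod[of "Complex (-t) s"]
      abs_Im_le_cmod[of "Complex s t"] abs_Im_le_cmod[of "Complex s (-t)"] by auto
  have qz: "q = z + Complex x y" by (simp add: x_def y_def complex_eq_iff)
  consider "x = t" "\<bar>y\<bar> \<le> t" | "x = - t" "\<bar>y\<bar> \<le> t" | "y = t" "\<bar>x\<bar> \<le> t" | "y = - t" "\<bar>x\<bar> \<le> t"
    using xy by (auto simp: max_def abs_if split: if_splits)
  then show False
  proof cases
    case 1
    then show ?thesis using side[OF gt(1) Kt(1)] far(1) qz by (simp add: re)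
  next
    case 2
    then show ?thesis using side[OF gt(2) Kt(2)] far(2) qz by (simp add: re)
  next
    case 3
    then show ?thesis using side[OF gt(3) Kt(3)] far(3) qz by (simp add: re)
  next
    case 4
    then show ?thesis using side[OF gt(4) Kt(4)] far(4) qz by (simp add: re)
  qed
qed

end

section \<open>Energy of preimages of balls\<close>

lemma dist_diam_upper: "x \<in> C \<Longrightarrow> y \<in> C \<Longrightarrow> ennreal (d x y) \<le> dist_diam d C"
  unfolding dist_diam_def by (rule SUP_upper2[of x], assumption, rule SUP_upper2[of y]) auto

lemma separated_compacts:
  fixes S :: "'i \<Rightarrow> 'a::metric_space set"
  assumes "finite I" "\<And>i. i \<in> I \<Longrightarrow> compact (S i)"
    and "\<And>i j. i \<in> I \<Longrightarrow> j \<in> I \<Longrightarrow> i \<noteq> j \<Longrightarrow> S i \<inter> S j = {}"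
  shows "\<exists>\<delta>>0. \<forall>i\<in>I. \<forall>j\<in>I. i \<noteq> j \<longrightarrow> (\<forall>x\<in>S i. \<forall>y\<in>S j. \<delta> \<le> dist x y)"
proof -
  have "\<exists>\<delta>>0. i \<noteq> j \<longrightarrow> (\<forall>x\<in>S i. \<forall>y\<in>S j. \<delta> \<le> dist x y)" if "i \<in> I" "j \<in> I" for i j
  proof (cases "i = j")
    case True
    then show ?thesis by (intro exI[of _ 1]) auto
  next
    case False
    show ?thesis
    proof (cases "S i \<times> S j = {}")
      case True
      then show ?thesis by (intro exI[of _ 1]) auto
    next
      case ne: False
      have "compact (S i \<times> S j)" using that by (intro compact_Times assms(2))
      moreover have "continuous_on (S i \<times> S j) (\<lambda>p. dist (fst p) (snd p))" by (intro continuous_intros)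
      ultimately obtain p where p: "p \<in> S i \<times> S j" "\<And>q. q \<in> S i \<times> S j \<Longrightarrow> dist (fst p) (snd p) \<le> dist (fst q) (snd q)"
        using continuous_attains_inf[OF _ ne] by blast
      have "fst p \<noteq> snd p" using p(1) assms(3)[OF that False] by auto
      then show ?thesis using p(2) by (intro exI[of _ "dist (fst p) (snd p)"]) force
    qed
  qed
  then have "\<forall>i\<in>I. \<forall>j\<in>I. \<exists>\<delta>. 0 < \<delta> \<and> (i \<noteq> j \<longrightarrow> (\<forall>x\<in>S i. \<forall>y\<in>S j. \<delta> \<le> dist x y))" by blast
  then have "\<forall>i\<in>I. \<exists>Di. \<forall>j\<in>I. 0 < Di j \<and> (i \<noteq> j \<longrightarrow> (\<forall>x\<in>S i. \<forall>y\<in>S j. Di j \<le> dist x y))"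
    by (intro ballI bchoice) blast
  from bchoice[OF this] obtain D where
    D: "\<And>i j. i \<in> I \<Longrightarrow> j \<in> I \<Longrightarrow> 0 < D i j \<and> (i \<noteq> j \<longrightarrow> (\<forall>x\<in>S i. \<forall>y\<in>S j. D i j \<le> dist x y))"
    by blast
  define \<delta> where "\<delta> = Min (insert 1 ((\<lambda>(i, j). D i j) ` (I \<times> I)))"
  have fin: "finite (insert 1 ((\<lambda>(i, j). D i j) ` (I \<times> I)))" using assms(1) by simp
  have "0 < \<delta>" unfolding \<delta>_def using D by (subst Min_gr_iff[OF fin]) auto
  moreover have "\<delta> \<le> D i j" if "i \<in> I" "j \<in> I" for i j
    unfolding \<delta>_def using that by (intro Min_le[OF fin]) auto
  ultimately show ?thesis
  proof (intro exI[of _ \<delta>] conjI ballI impI)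
    fix i j x y
    assume le: "\<And>i j. i \<in> I \<Longrightarrow> j \<in> I \<Longrightarrow> \<delta> \<le> D i j"
      and ij: "i \<in> I" "j \<in> I" "i \<noteq> j" "x \<in> S i" "y \<in> S j"
    have "\<delta> \<le> D i j" by (rule le[OF ij(1,2)])
    also have "D i j \<le> dist x y" using D[OF ij(1,2)] ij by simp
    finally show "\<delta> \<le> dist x y" .
  qed
qed

text \<open>The disjoint compact images have a positive mutual distance, so a covering set of
  smaller diameter d meets only one of them. Its preimage in \<open>T i\<close> lies in a ball of
  radius d / c i, of area pi d^2 / (c i)^2. Since a set of diameter d enters
  \<open>hausdorff2\<close> with pi d^2 / 4, the factor 4 appears.\<close>

lemma sum_area_le_hausdorff2:
  fixes U :: "complex \<Rightarrow> 'a::metric_space"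
  assumes I: "finite I" and T: "\<And>i. i \<in> I \<Longrightarrow> compact (T i)" and U: "continuous_on UNIV U"
    and low: "\<And>i z w. i \<in> I \<Longrightarrow> z \<in> T i \<Longrightarrow> w \<in> T i \<Longrightarrow> c i * dist z w \<le> dist (U z) (U w)"
    and c: "\<And>i. i \<in> I \<Longrightarrow> 0 < c i"
    and disj: "\<And>i j. i \<in> I \<Longrightarrow> j \<in> I \<Longrightarrow> i \<noteq> j \<Longrightarrow> U ` T i \<inter> U ` T j = {}"
    and S: "\<And>i. i \<in> I \<Longrightarrow> U ` T i \<subseteq> S"
  shows "(\<Sum>i\<in>I. ennreal ((c i)\<^sup>2) * emeasure lborel (T i)) \<le> 4 * hausdorff2 dist S"
proof -
  have cp: "compact (U ` T i)" if "i \<in> I" for i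
    by (rule compact_continuous_image[OF continuous_on_subset[OF U subset_UNIV] T[OF that]])
  have "\<exists>\<delta>>0. \<forall>i\<in>I. \<forall>j\<in>I. i \<noteq> j \<longrightarrow> (\<forall>x\<in>U ` T i. \<forall>y\<in>U ` T j. \<delta> \<le> dist x y)"
  proof (rule separated_compacts[OF I])
    show "compact (U ` T i)" if "i \<in> I" for i using that by (rule cp)
    show "U ` T i \<inter> U ` T j = {}" if "i \<in> I" "j \<in> I" "i \<noteq> j" for i j using that by (rule disj)
  qed
  then obtain \<delta> where \<delta>0: "0 < \<delta>"
    and sep: "\<forall>i\<in>I. \<forall>j\<in>I. i \<noteq> j \<longrightarrow> (\<forall>x\<in>U ` T i. \<forall>y\<in>U ` T j. \<delta> \<le> dist x y)"
    by (elim exE conjE)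
  have \<delta>: "0 < \<delta>"
      "\<And>i j x y. i \<in> I \<Longrightarrow> j \<in> I \<Longrightarrow> i \<noteq> j \<Longrightarrow> x \<in> U ` T i \<Longrightarrow> y \<in> U ` T j \<Longrightarrow> \<delta> \<le> dist x y"
    by (rule \<delta>0) (rule sep[rule_format])
  define X where "X = (\<Sum>i\<in>I. ennreal ((c i)\<^sup>2) * emeasure lborel (T i))"
  have main: "X \<le> 4 * (\<Sum>l. ennreal (pi / 4) * dist_diam dist (C l) ^ 2)"
    if C: "S \<subseteq> (\<Union>l. C l)" "\<And>l. dist_diam dist (C l) < ennreal \<delta>" for C :: "nat \<Rightarrow> 'a set"
  proof -
    define dd where "dd l = enn2real (dist_diam dist (C l))" for l
    have dd0: "0 \<le> dd l" for l by (simp add: dd_def)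
    have dd: "dist_diam dist (C l) = ennreal (dd l)" for l
      unfolding dd_def using C(2)[of l] by (metis ennreal_enn2real ennreal_less_top less_trans)
    have ddl: "dd l < \<delta>" for l using C(2)[of l] dd0[of l] unfolding dd by (simp add: ennreal_less_iff)
    have dist_le: "dist x y \<le> dd l" if "x \<in> C l" "y \<in> C l" for x y l
      using dist_diam_upper[OF that, of dist] unfolding dd by (simp add: dd0)
    define M where "M i l \<longleftrightarrow> (\<exists>p\<in>T i. U p \<in> C l)" for i l
    define p where "p i l = (SOME p. p \<in> T i \<and> U p \<in> C l)" for i l
    have p: "p i l \<in> T i" "U (p i l) \<in> C l" if "M i l" for i l
      using someI_ex[of "\<lambda>p. p \<in> T i \<and> U p \<in> C l"] that by (auto simp: M_def p_def)
    have one: "i = j" if "i \<in> I" "j \<in> I" "M i l" "M j l" for i j l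
    proof (rule ccontr)
      assume "i \<noteq> j"
      have "\<delta> \<le> dist (U (p i l)) (U (p j l))"
        using that p(1) by (intro \<delta>(2)[OF that(1,2) \<open>i \<noteq> j\<close>]) auto
      also have "\<dots> \<le> dd l" using that p(2) by (intro dist_le) auto
      finally show False using ddl[of l] by simp
    qed
    have each: "ennreal ((c i)\<^sup>2) * emeasure lborel (T i) \<le> (\<Sum>l. if M i l then ennreal (pi * (dd l)\<^sup>2) else 0)" if i: "i \<in> I" for i
    proof -
      define Z where "Z l = (if M i l then cball (p i l) (dd l / c i) else {})" for l
      have "T i \<subseteq> (\<Union>l. Z l)"
      proof
        fix z assume z: "z \<in> T i"
        then obtain l where l: "U z \<in> C l" using S[OF i] C(1) by blast
        then have m: "M i l" using z by (auto simp: M_def)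
        have "c i * dist (p i l) z \<le> dd l"
          using low[OF i p(1)[OF m] z] dist_le[OF p(2)[OF m] l] by linarith
        then have "z \<in> Z l" using m c[OF i] by (simp add: Z_def pos_le_divide_eq mult.commute)
        then show "z \<in> (\<Union>l. Z l)" by blast
      qed
      then have "emeasure lborel (T i) \<le> emeasure lborel (\<Union>l. Z l)"
        by (intro emeasure_mono) (auto simp: Z_def)
      also have "\<dots> \<le> (\<Sum>l. emeasure lborel (Z l))"
        by (intro emeasure_subadditive_countably) (auto simp: Z_def)
      also have "\<dots> = (\<Sum>l. if M i l then ennreal (pi * (dd l / c i)\<^sup>2) else 0)"
      proof (rule suminf_cong)
        fix l
        have "emeasure lborel (cball (p i l) (dd l / c i)) = ennreal (pi * (dd l / c i)\<^sup>2)"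
          using emeasure_cball[of "dd l / c i" "p i l"] dd0[of l] c[OF i] by (simp add: unit_ball_vol_2)
        then show "emeasure lborel (Z l) = (if M i l then ennreal (pi * (dd l / c i)\<^sup>2) else 0)"
          by (simp add: Z_def)
      qed
      finally have "ennreal ((c i)\<^sup>2) * emeasure lborel (T i)
          \<le> ennreal ((c i)\<^sup>2) * (\<Sum>l. if M i l then ennreal (pi * (dd l / c i)\<^sup>2) else 0)"
        by (intro mult_left_mono) auto
      also have "\<dots> = (\<Sum>l. ennreal ((c i)\<^sup>2) * (if M i l then ennreal (pi * (dd l / c i)\<^sup>2) else 0))"
        by simp
      also have "\<dots> = (\<Sum>l. if M i l then ennreal (pi * (dd l)\<^sup>2) else 0)"
        using c[OF i] by (intro suminf_cong) (auto simp: power_divide simp flip: ennreal_mult)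
      finally show ?thesis .
    qed
    have "X \<le> (\<Sum>i\<in>I. \<Sum>l. if M i l then ennreal (pi * (dd l)\<^sup>2) else 0)"
      unfolding X_def by (intro sum_mono each)
    also have "\<dots> = (\<Sum>l. \<Sum>i\<in>I. if M i l then ennreal (pi * (dd l)\<^sup>2) else 0)"
      by (rule suminf_sum[symmetric]) simp
    also have "\<dots> \<le> (\<Sum>l. ennreal (pi * (dd l)\<^sup>2))"
    proof (intro suminf_le summableI)
      fix l
      show "(\<Sum>i\<in>I. if M i l then ennreal (pi * (dd l)\<^sup>2) else 0) \<le> ennreal (pi * (dd l)\<^sup>2)"
      proof (cases "\<exists>i\<in>I. M i l")
        case True
        then obtain i where i: "i \<in> I" "M i l" by blast
        have "(\<Sum>j\<in>I. if M j l then ennreal (pi * (dd l)\<^sup>2) else 0) = (\<Sum>j\<in>I. if j = i then ennreal (pi * (dd l)\<^sup>2) else 0)"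
        proof (rule sum.cong[OF refl])
          fix j assume "j \<in> I"
          then have "M j l \<longleftrightarrow> j = i" using one[of j i l] i by blast
          then show "(if M j l then ennreal (pi * (dd l)\<^sup>2) else 0) = (if j = i then ennreal (pi * (dd l)\<^sup>2) else 0)"
            by (simp only:)
        qed
        also have "\<dots> = ennreal (pi * (dd l)\<^sup>2)" using I i by simp
        finally show ?thesis by simp
      next
        case False
        then have "(\<Sum>j\<in>I. if M j l then ennreal (pi * (dd l)\<^sup>2) else 0) = 0" by (intro sum.neutral) auto
        then show ?thesis by simp
      qed
    qed
    also have "\<dots> = (\<Sum>l. 4 * (ennreal (pi / 4) * dist_diam dist (C l) ^ 2))"
    proof (rule suminf_cong)
      fix l
      have "ennreal (pi * (dd l)\<^sup>2) = ennreal (4 * (pi / 4 * (dd l)\<^sup>2))" by simp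
      also have "\<dots> = 4 * (ennreal (pi / 4) * dist_diam dist (C l) ^ 2)"
        using dd0[of l] unfolding dd
        by (simp only: ennreal_power ennreal_mult zero_le_power2 ennreal_numeral zero_le_numeral
            pi_ge_zero divide_nonneg_nonneg mult_nonneg_nonneg)
      finally show "ennreal (pi * (dd l)\<^sup>2) = 4 * (ennreal (pi / 4) * dist_diam dist (C l) ^ 2)" .
    qed
    finally show ?thesis by simp
  qed
  have "X / 4 \<le> hausdorff2_pre dist \<delta> S"
    unfolding hausdorff2_pre_def
  proof (rule INF_greatest)
    fix C assume "C \<in> {C :: nat \<Rightarrow> 'a set. S \<subseteq> (\<Union>i. C i) \<and> (\<forall>i. dist_diam dist (C i) < ennreal \<delta>)}"
    then have "X \<le> 4 * (\<Sum>l. ennreal (pi / 4) * dist_diam dist (C l) ^ 2)" by (intro main) auto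
    then show "X / 4 \<le> (\<Sum>l. ennreal (pi / 4) * dist_diam dist (C l) ^ 2)"
      by (simp add: divide_le_posI_ennreal mult.commute)
  qed
  also have "\<dots> \<le> hausdorff2 dist S"
    unfolding hausdorff2_def using \<delta>(1) by (intro SUP_upper) simp
  finally have "4 * (X / 4) \<le> 4 * hausdorff2 dist S" by (intro mult_left_mono) auto
  moreover have "4 * (X / 4) = X"
    by (simp add: ennreal_times_divide ennreal_mult_divide_eq mult.commute[of 4])
  ultimately show ?thesis by (simp add: X_def)
qed

text \<open>In \<open>qc\<close> the seminorm \<open>s\<close> ranges over all approximate metric
  derivatives, so that it can be instantiated with \<open>tangent z\<close>. The fibres are taken in
  the closed disc, as in the definition of monotonicity.\<close>

locale qc_map = line_sobolev U \<gamma> for U :: "complex \<Rightarrow> 'a::metric_space" and \<gamma> +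
  fixes L Q :: real
  assumes L: "0 < L" and Q: "1 \<le> Q"
    and growth: "\<And>x r. 0 < r \<Longrightarrow> hausdorff2 dist (ball x r :: 'a set) \<le> ennreal (L * r\<^sup>2)"
    and fibres: "\<And>y. connected {z \<in> cball 0 1. U z = y}"
    and qc: "AE z in lborel. z \<in> ball 0 1 \<longrightarrow>
      (\<forall>s. ap_md (ball 0 1) U z s \<longrightarrow> ennreal (\<gamma> z) ^ 2 \<le> ennreal Q * jacobian_J s)"
begin

text \<open>The constant of \<open>seminorm_lower_of_jacobian\<close>: \<open>tangent z\<close> is
  at least \<open>c0 * \<gamma> z\<close> times the Euclidean norm at nondegenerate points.\<close>

definition c0 :: real where "c0 = 1 / (100 * pi * Q)"

lemma c0: "0 < c0" "c0 \<le> 1"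
proof -
  show "0 < c0" using Q by (simp add: c0_def)
  have "1 * 1 \<le> (100 * pi) * Q" using Q pi_gt3 by (intro mult_mono) auto
  moreover have "0 < 100 * pi * Q" using Q by simp
  ultimately show "c0 \<le> 1" unfolding c0_def by (subst divide_le_eq_1_pos) simp_all
qed

definition nondeg_pt :: "complex \<Rightarrow> bool" where
  "nondeg_pt z \<longleftrightarrow> regular_pt z \<and> 0 < \<gamma> z \<and> (\<forall>w. c0 * \<gamma> z * norm w \<le> tangent z w)"

lemma AE_nondeg_pt: "AE z in lborel. 0 < \<gamma> z \<longrightarrow> nondeg_pt z"
  using AE_regular_pt qc
proof (eventually_elim, intro impI)
  fix z assume reg: "z \<in> ball 0 1 \<longrightarrow> regular_pt z"
    and q: "z \<in> ball 0 1 \<longrightarrow> (\<forall>s. ap_md (ball 0 1) U z s \<longrightarrow> ennreal (\<gamma> z) ^ 2 \<le> ennreal Q * jacobian_J s)"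
    and g: "0 < \<gamma> z"
  have zD: "z \<in> ball 0 1" using \<gamma>_outside[of z] g by fastforce
  with reg have z: "regular_pt z" by blast
  have J: "ennreal (\<gamma> z) ^ 2 \<le> ennreal Q * jacobian_J (tangent z)"
    using q zD ap_md_tangent[OF z] by blast
  have "c0 * \<gamma> z * norm w \<le> tangent z w" for w
  proof -
    have "\<gamma> z * norm w \<le> 100 * pi * Q * tangent z w"
      by (rule seminorm_lower_of_jacobian[OF seminorm_tangent[OF z] tangent_le_norm[OF z] g Q J])
    then have "c0 * (\<gamma> z * norm w) \<le> c0 * (100 * pi * Q * tangent z w)"
      using c0 by (intro mult_left_mono) auto
    also have "\<dots> = tangent z w" using Q by (simp add: c0_def)
    finally show ?thesis by (simp add: mult.assoc)
  qed
  with z g show "nondeg_pt z" by (simp add: nondeg_pt_def)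
qed

lemma nondeg_inj:
  assumes "nondeg_pt z" "w \<in> cball 0 1" "U w = U z"
  shows "w = z"
  using assms fibre_trivial[of z "c0 * \<gamma> z" w] fibres[of "U z"] c0 by (simp add: nondeg_pt_def)

text \<open>For g at most \<open>\<gamma> z\<close> and \<open>\<gamma> z\<close> below 2g,
  \<open>tangent z\<close> lies between \<open>c0 * \<gamma> z\<close> and
  \<open>2 * \<gamma> z\<close> times the norm. A deviation of at most
  \<open>c0 / 2 * \<gamma> z\<close> leaves c0 g / 2 below and 3 \<open>\<gamma> z\<close>, hence
  6g, above. A set of pairs is used so that the area of its sections depends measurably on the
  point.\<close>

definition distorted :: "real \<Rightarrow> (complex \<times> complex) set" where
  "distorted g = {(z, y). dist (U y) (U z) < c0 / 2 * g * dist y z \<or> 6 * g * dist y z < dist (U y) (U z)}"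

lemma distorted_borel: "distorted g \<in> sets (lborel \<Otimes>\<^sub>M lborel)"
proof -
  have "distorted g = {p. dist (U (snd p)) (U (fst p)) < c0 / 2 * g * dist (snd p) (fst p)}
      \<union> {p. 6 * g * dist (snd p) (fst p) < dist (U (snd p)) (U (fst p))}"
    by (auto simp: distorted_def)
  also have "open \<dots>" by (intro open_Un open_Collect_less continuous_intros)
  finally have "distorted g \<in> sets borel" by simp
  then show ?thesis by (simp only: lborel_prod sets_lborel)
qed

text \<open>Points at which \<open>U\<close> distorts distances by a factor comparable to \<open>2 powi k\<close>, up to
  sets of small density, at all scales below \<open>2^-n\<close>.\<close>
definition tame :: "real \<Rightarrow> nat \<Rightarrow> int \<Rightarrow> complex set" where
  "tame \<kappa> n k = {z. 2 powi k \<le> \<gamma> z \<and> \<gamma> z < 2 * 2 powi k \<and>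
     (\<forall>m\<ge>n. emeasure lborel {y \<in> ball z ((1/2)^m). (z, y) \<in> distorted (2 powi k)} \<le> ennreal (\<kappa> * ((1/2)^m)\<^sup>2))}"

text \<open>Sections of a Borel set in the product have Borel measurable area, and the restriction
  to dyadic radii leaves countably many conditions.\<close>

lemma tame_borel: "tame \<kappa> n k \<in> sets borel"
proof -
  define E where "E m = {p \<in> distorted (2 powi k). dist (fst p) (snd p) < (1/2)^m}" for m :: nat
  have E: "E m \<in> sets (lborel \<Otimes>\<^sub>M lborel)" for m
  proof -
    have "open {p :: complex \<times> complex. dist (fst p) (snd p) < (1/2)^m}"
      by (intro open_Collect_less continuous_intros)
    then have "{p :: complex \<times> complex. dist (fst p) (snd p) < (1/2)^m} \<in> sets (lborel \<Otimes>\<^sub>M lborel)"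
      by (simp only: lborel_prod sets_lborel borel_open)
    then have "distorted (2 powi k) \<inter> {p :: complex \<times> complex. dist (fst p) (snd p) < (1/2)^m} \<in> sets (lborel \<Otimes>\<^sub>M lborel)"
      using distorted_borel by (rule sets.Int[rotated])
    then show ?thesis by (simp add: E_def Int_def)
  qed
  have [measurable]: "(\<lambda>z. emeasure lborel (Pair z -` E m)) \<in> borel_measurable borel" for m
    using lborel.measurable_emeasure_Pair[OF E] by simp
  have "Pair z -` E m = {y \<in> ball z ((1/2)^m). (z, y) \<in> distorted (2 powi k)}" for z m
    by (auto simp: E_def)
  then have "tame \<kappa> n k = {z \<in> space borel. 2 powi k \<le> \<gamma> z \<and> \<gamma> z < 2 * 2 powi k \<and>
     (\<forall>m. n \<le> m \<longrightarrow> emeasure lborel (Pair z -` E m) \<le> ennreal (\<kappa> * ((1/2)^m)\<^sup>2))}"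
    by (simp add: tame_def)
  also have "\<dots> \<in> sets borel" by measurable
  finally show ?thesis .
qed

lemma nondeg_tame:
  assumes z: "nondeg_pt z" and "0 < \<kappa>"
  shows "\<exists>n k. z \<in> tame \<kappa> n k"
proof -
  have reg: "regular_pt z" and g: "0 < \<gamma> z" and low: "\<And>w. c0 * \<gamma> z * norm w \<le> tangent z w"
    using z by (auto simp: nondeg_pt_def)
  define k where "k = \<lfloor>log 2 (\<gamma> z)\<rfloor>"
  have k: "2 powi k \<le> \<gamma> z" "\<gamma> z < 2 * 2 powi k"
  proof -
    have "2 powr real_of_int k \<le> 2 powr log 2 (\<gamma> z)" unfolding k_def by simp
    then show "2 powi k \<le> \<gamma> z" using g by (simp add: powr_real_of_int')
    have "2 powr log 2 (\<gamma> z) < 2 powr (real_of_int k + 1)" unfolding k_def by simp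
    then show "\<gamma> z < 2 * 2 powi k" using g by (simp add: powr_add powr_real_of_int')
  qed
  define \<epsilon> where "\<epsilon> = c0 / 2 * \<gamma> z"
  have eps: "0 < \<epsilon>" using c0 g by (simp add: \<epsilon>_def)
  obtain \<delta> where \<delta>: "0 < \<delta>" "\<And>r. 0 < r \<Longrightarrow> r < \<delta> \<Longrightarrow>
    emeasure lborel {w \<in> ball z r. \<epsilon> * norm (w - z) < \<bar>dist (U w) (U z) - tangent z (w - z)\<bar>} \<le> ennreal (\<kappa> * r\<^sup>2)"
  proof (rule deviation_small[OF reg eps \<open>0 < \<kappa>\<close>])
  qed (rule that)
  obtain n where n: "(1/2 :: real)^n < \<delta>" using real_arch_pow_inv[OF \<delta>(1), of "1/2"] by auto
  have "emeasure lborel {y \<in> ball z ((1/2)^m). (z, y) \<in> distorted (2 powi k)} \<le> ennreal (\<kappa> * ((1/2)^m)\<^sup>2)" if m: "n \<le> m" for m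
  proof -
    have "(1/2 :: real)^m \<le> (1/2)^n" using m by (intro power_decreasing) auto
    then have r: "0 < (1/2 :: real)^m" "(1/2 :: real)^m < \<delta>" using le_less_trans[OF _ n] by simp_all
    have "open {w. \<epsilon> * norm (w - z) < \<bar>dist (U w) (U z) - tangent z (w - z)\<bar>}"
      by (intro open_Collect_less continuous_intros continuous_on_compose2[OF continuous_tangent[OF reg]]) auto
    then have op: "{w \<in> ball z ((1/2)^m). \<epsilon> * norm (w - z) < \<bar>dist (U w) (U z) - tangent z (w - z)\<bar>} \<in> sets lborel"
      unfolding Collect_conj_eq Collect_mem_eq sets_lborel by (intro borel_open open_Int open_ball)
    have "{y \<in> ball z ((1/2)^m). (z, y) \<in> distorted (2 powi k)}
        \<subseteq> {w \<in> ball z ((1/2)^m). \<epsilon> * norm (w - z) < \<bar>dist (U w) (U z) - tangent z (w - z)\<bar>}"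
    proof (rule subsetI, rule CollectI, rule conjI)
      fix y assume y: "y \<in> {y \<in> ball z ((1/2)^m). (z, y) \<in> distorted (2 powi k)}"
      then show "y \<in> ball z ((1/2)^m)" by simp
      define d where "d = norm (y - z)"
      have d: "dist y z = d" "0 \<le> d" by (simp_all add: d_def dist_norm)
      have t: "c0 * \<gamma> z * d \<le> tangent z (y - z)" "tangent z (y - z) \<le> 2 * \<gamma> z * d"
        using low[of "y - z"] tangent_le_norm[OF reg, of "y - z"] by (simp_all add: d_def)
      have "dist (U y) (U z) < c0 / 2 * 2 powi k * d \<or> 6 * 2 powi k * d < dist (U y) (U z)"
        using y by (simp add: distorted_def d)
      then show "\<epsilon> * norm (y - z) < \<bar>dist (U y) (U z) - tangent z (y - z)\<bar>"
      proof
        assume h: "dist (U y) (U z) < c0 / 2 * 2 powi k * d"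
        have "c0 / 2 * 2 powi k * d \<le> c0 / 2 * \<gamma> z * d"
          using k c0 d by (intro mult_right_mono mult_left_mono) auto
        then have "dist (U y) (U z) < \<epsilon> * d" using h by (simp add: \<epsilon>_def)
        moreover have "c0 * \<gamma> z * d = \<epsilon> * d + \<epsilon> * d" by (simp add: \<epsilon>_def)
        ultimately show ?thesis using t unfolding d_def[symmetric] by linarith
      next
        assume h: "6 * 2 powi k * d < dist (U y) (U z)"
        have "3 * \<gamma> z * d \<le> 3 * (2 * 2 powi k) * d"
          using k d by (intro mult_right_mono mult_left_mono) auto
        moreover have "\<epsilon> * d \<le> \<gamma> z * d"
          unfolding \<epsilon>_def using c0 g d by (intro mult_right_mono) auto
        moreover have "3 * \<gamma> z * d = 2 * \<gamma> z * d + \<gamma> z * d" by simp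
        moreover have "3 * (2 * 2 powi k) * d = 6 * 2 powi k * d" by simp
        ultimately show ?thesis using t h unfolding d_def[symmetric] by linarith
      qed
    qed
    then have "emeasure lborel {y \<in> ball z ((1/2)^m). (z, y) \<in> distorted (2 powi k)}
        \<le> emeasure lborel {w \<in> ball z ((1/2)^m). \<epsilon> * norm (w - z) < \<bar>dist (U w) (U z) - tangent z (w - z)\<bar>}"
      by (rule emeasure_mono[OF _ op])
    also have "\<dots> \<le> ennreal (\<kappa> * ((1/2)^m)\<^sup>2)" by (rule \<delta>(2)[OF r])
    finally show ?thesis .
  qed
  with k show ?thesis unfolding tame_def by blast
qed

text \<open>Pass through a third point near \<open>y\<close> that is undistorted as seen from both \<open>y\<close> and \<open>z\<close>.\<close>
lemma tame_expands:
  "\<exists>\<kappa>>0. \<forall>n k y z. y \<in> tame \<kappa> n k \<longrightarrow> z \<in> tame \<kappa> n k \<longrightarrow> dist y z < (1/2)^(n+1) \<longrightarrow>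
    c0 / 4 * 2 powi k * dist y z \<le> dist (U y) (U z)"
proof -
  \<comment> \<open>An undistorted point within \<open>\<eta> * d\<close> of \<open>y\<close> yields
    the rate c0/2 minus \<open>(c0 / 2 + 6) * \<eta>\<close>; the bound on \<open>(1/2)^j\<close>
    limits this loss to c0/4.\<close>
  obtain j :: nat where j: "(1/2)^j < c0 / (16 * (c0 / 2 + 6))"
    using real_arch_pow_inv[of "c0 / (16 * (c0 / 2 + 6))" "1/2"] c0 by auto
  define \<eta> where "\<eta> = 4 * (1/2 :: real)^j"
  have \<eta>: "0 < \<eta>" "(c0 / 2 + 6) * \<eta> \<le> c0 / 4"
  proof -
    show "0 < \<eta>" by (simp add: \<eta>_def)
    have "0 < 16 * (c0 / 2 + 6)" using c0 by simp
    with j have "(1/2)^j * (16 * (c0 / 2 + 6)) < c0" by (simp only: pos_less_divide_eq)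
    moreover have "(c0 / 2 + 6) * \<eta> = (1/2)^j * (16 * (c0 / 2 + 6)) / 4" unfolding \<eta>_def by (simp add: algebra_simps)
    ultimately show "(c0 / 2 + 6) * \<eta> \<le> c0 / 4" by linarith
  qed
  have \<eta>1: "\<eta> \<le> 1"
  proof -
    have "6 * \<eta> \<le> (c0 / 2 + 6) * \<eta>" using \<eta>(1) c0 by (intro mult_right_mono) auto
    then show ?thesis using \<eta>(2) c0 by linarith
  qed
  \<comment> \<open>Then \<open>\<kappa> * \<rho>\<^sup>2 = \<rho>'\<^sup>2\<close>: distorted
    points seen from \<open>z\<close> and those seen from \<open>y\<close> together have area at
    most twice \<open>\<rho>'\<^sup>2\<close>, too little to fill the ball of radius
    \<open>\<rho>'\<close> about \<open>y\<close>, as pi exceeds 2.\<close>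
  define \<kappa> where "\<kappa> = ((1/2 :: real)^j)\<^sup>2"
  have \<kappa>: "0 < \<kappa>" "\<kappa> \<le> 1" unfolding \<kappa>_def by (simp, intro power_le_one) simp_all
  show ?thesis
  proof (intro exI[of _ \<kappa>] conjI allI impI \<kappa>(1))
    fix n k y z assume y: "y \<in> tame \<kappa> n k" and z: "z \<in> tame \<kappa> n k" and yz: "dist y z < (1/2)^(n+1)"
    define g :: real where "g = 2 powi k"
    have g: "0 < g" by (simp add: g_def)
    define d where "d = dist y z"
    show "c0 / 4 * 2 powi k * dist y z \<le> dist (U y) (U z)"
    proof (cases "d = 0")
      case True
      then show ?thesis by (simp add: d_def)
    next
      case False
      then have d: "0 < d" by (simp add: d_def)
      \<comment> \<open>The preceding dyadic radius lies between 2d and 4d. The assumption on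
        \<open>dist y z\<close> makes its exponent at least \<open>n\<close>, so that the conditions
        in \<open>tame\<close> apply at that scale.\<close>
      define p where "p = (LEAST p. (1/2 :: real)^p \<le> 2 * d)"
      obtain p0 where "(1/2 :: real)^p0 < 2 * d" using real_arch_pow_inv[of "2 * d" "1/2"] d by auto
      then have p: "(1/2 :: real)^p \<le> 2 * d" unfolding p_def
        by (rule LeastI[of "\<lambda>p. (1/2 :: real)^p \<le> 2 * d" p0, OF less_imp_le])
      have pn: "n < p"
      proof (rule ccontr)
        assume "\<not> n < p"
        then have "(1/2 :: real)^n \<le> (1/2)^p" by (intro power_decreasing) auto
        moreover have "(1/2 :: real)^(n+1) = (1/2)^n / 2" by simp
        ultimately show False using p yz d unfolding d_def[symmetric] by linarith
      qed
      then obtain m where m: "p = Suc m" "n \<le> m" by (cases p) auto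
      have \<rho>2: "2 * d < (1/2 :: real)^m"
        using not_less_Least[of m "\<lambda>p. (1/2 :: real)^p \<le> 2 * d"] m(1) unfolding p_def[symmetric] by simp
      define \<rho> where "\<rho> = (1/2 :: real)^m"
      define \<rho>' where "\<rho>' = (1/2 :: real)^(m + j)"
      have \<rho>: "2 * d < \<rho>" "\<rho> \<le> 4 * d" using \<rho>2 p m(1) by (simp_all add: \<rho>_def)
      have \<rho>'\<rho>: "\<rho>' = \<rho> * (1/2)^j" by (simp add: \<rho>'_def \<rho>_def power_add)
      have \<rho>'0: "0 < \<rho>'" by (simp add: \<rho>'_def)
      have \<rho>'d: "\<rho>' \<le> \<eta> * d"
        unfolding \<rho>'\<rho> \<eta>_def using mult_right_mono[OF \<rho>(2), of "(1/2)^j"] by (simp add: mult_ac)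
      have \<eta>d: "\<eta> * d \<le> d" using \<eta>1 d by simp
      have \<kappa>\<rho>: "\<kappa> * \<rho>\<^sup>2 = \<rho>'\<^sup>2" unfolding \<rho>'\<rho> \<kappa>_def by (simp add: power_mult_distrib)
      define Bz where "Bz = {w \<in> ball z \<rho>. (z, w) \<in> distorted g}"
      define By where "By = {w \<in> ball y \<rho>'. (y, w) \<in> distorted g}"
      have meas: "{w \<in> ball x r. (x, w) \<in> distorted g} \<in> sets borel" for x r
      proof -
        have "Pair x -` distorted g \<in> sets borel" using sets_Pair1[OF distorted_borel] by simp
        moreover have "{w \<in> ball x r. (x, w) \<in> distorted g} = ball x r \<inter> Pair x -` distorted g" by auto
        ultimately show ?thesis by simp
      qed
      have Bz: "emeasure lborel Bz \<le> ennreal (\<kappa> * \<rho>\<^sup>2)"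
        unfolding Bz_def \<rho>_def g_def using z[unfolded tame_def, THEN CollectD, THEN conjunct2, THEN conjunct2, rule_format, OF m(2)] .
      have By: "emeasure lborel By \<le> ennreal (\<kappa> * \<rho>'\<^sup>2)"
        unfolding By_def \<rho>'_def g_def
        using y[unfolded tame_def, THEN CollectD, THEN conjunct2, THEN conjunct2, rule_format, OF trans_le_add1[OF m(2)]] .
      have "\<not> ball y \<rho>' \<subseteq> Bz \<union> By"
      proof
        assume "ball y \<rho>' \<subseteq> Bz \<union> By"
        then have "emeasure lborel (ball y \<rho>') \<le> emeasure lborel (Bz \<union> By)"
          unfolding Bz_def By_def by (rule emeasure_mono) (simp only: sets_lborel, intro sets.Un meas)
        also have "\<dots> \<le> emeasure lborel Bz + emeasure lborel By"
          unfolding Bz_def By_def by (rule emeasure_subadditive) (simp_all only: sets_lborel meas)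
        also have "\<dots> \<le> ennreal (\<kappa> * \<rho>\<^sup>2) + ennreal (\<kappa> * \<rho>'\<^sup>2)" by (intro add_mono Bz By)
        also have "\<dots> = ennreal (\<rho>'\<^sup>2 + \<kappa> * \<rho>'\<^sup>2)" unfolding \<kappa>\<rho> using \<kappa> by simp
        also have "emeasure lborel (ball y \<rho>') = ennreal (pi * \<rho>'\<^sup>2)"
          using emeasure_ball[of \<rho>' y] \<rho>'0 by (simp add: unit_ball_vol_2)
        finally have "pi * \<rho>'\<^sup>2 \<le> \<rho>'\<^sup>2 + \<kappa> * \<rho>'\<^sup>2" using \<kappa> by (subst (asm) ennreal_le_iff) auto
        also have "\<dots> \<le> \<rho>'\<^sup>2 + 1 * \<rho>'\<^sup>2" using \<kappa> by (intro add_left_mono mult_right_mono) auto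
        finally have "pi * \<rho>'\<^sup>2 \<le> 2 * \<rho>'\<^sup>2" by simp
        then have "pi \<le> 2" using \<rho>'0 by simp
        then show False using pi_gt3 by simp
      qed
      then obtain w where w: "w \<in> ball y \<rho>'" "w \<notin> Bz" "w \<notin> By" by blast
      have wy: "dist w y \<le> \<eta> * d" using w(1) \<rho>'d by (simp add: dist_commute)
      have tz: "dist w z \<le> dist w y + d" unfolding d_def by (rule dist_triangle)
      have tz': "d \<le> dist w y + dist w z" unfolding d_def by (rule dist_triangle3)
      have "w \<in> ball z \<rho>" using tz wy \<eta>d \<rho>(1) by (simp add: dist_commute)
      with w(2) have "(z, w) \<notin> distorted g" by (simp add: Bz_def)
      then have a: "c0 / 2 * g * dist w z \<le> dist (U w) (U z)" by (auto simp: distorted_def)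
      have "(y, w) \<notin> distorted g" using w by (simp add: By_def)
      then have b: "dist (U w) (U y) \<le> 6 * g * dist w y" by (auto simp: distorted_def)
      have "c0 / 2 * g * (d - \<eta> * d) \<le> c0 / 2 * g * dist w z"
        using wy tz' c0 g by (intro mult_left_mono) auto
      moreover have "6 * g * dist w y \<le> 6 * g * (\<eta> * d)" using wy g by (intro mult_left_mono) auto
      moreover have "dist (U w) (U z) \<le> dist (U w) (U y) + dist (U y) (U z)" by (rule dist_triangle)
      moreover have "(c0 / 2 + 6) * \<eta> * (g * d) \<le> c0 / 4 * (g * d)"
        using \<eta>(2) g d by (intro mult_right_mono) auto
      moreover have "c0 / 2 * g * (d - \<eta> * d) - 6 * g * (\<eta> * d) = c0 / 2 * (g * d) - (c0 / 2 + 6) * \<eta> * (g * d)"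
        by (simp add: algebra_simps diff_divide_distrib add_divide_distrib)
      moreover have "c0 / 2 * (g * d) = c0 / 4 * (g * d) + c0 / 4 * (g * d)" by simp
      ultimately have "c0 / 4 * (g * d) \<le> dist (U y) (U z)" using a b by linarith
      then show ?thesis by (simp add: g_def d_def mult.assoc)
    qed
  qed
qed

end

section \<open>The energy estimate\<close>

context qc_map
begin

text \<open>On each of countably many pieces \<open>\<gamma>\<close> is constant up to a factor 2
  and \<open>U\<close> expands at a comparable rate. By \<open>nondeg_inj\<close> distinct points of
  the pieces have distinct images, so finitely many disjoint pieces, replaced by compact subsets,
  fit \<open>sum_area_le_hausdorff2\<close>, and the growth condition bounds the total.\<close>

theorem energy_bound:
  "\<exists>C\<ge>0. \<forall>x R. 0 < R \<longrightarrow> (\<integral>\<^sup>+ z\<in>{z. U z \<in> ball x R}. ennreal (\<gamma> z) ^ 2 \<partial>lborel) \<le> ennreal (C * R\<^sup>2)"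
proof -
  obtain \<kappa> where \<kappa>: "0 < \<kappa>" and ex: "\<And>n k y z. y \<in> tame \<kappa> n k \<Longrightarrow> z \<in> tame \<kappa> n k \<Longrightarrow> dist y z < (1/2)^(n+1) \<Longrightarrow>
    c0 / 4 * 2 powi k * dist y z \<le> dist (U y) (U z)"
  proof -
    from tame_expands obtain \<kappa> where "0 < \<kappa>" and *: "\<forall>n k y z. y \<in> tame \<kappa> n k \<longrightarrow> z \<in> tame \<kappa> n k \<longrightarrow>
        dist y z < (1/2)^(n+1) \<longrightarrow> c0 / 4 * 2 powi k * dist y z \<le> dist (U y) (U z)"
      by (elim exE conjE)
    show thesis by (rule that[OF \<open>0 < \<kappa>\<close>]) (rule *[rule_format])
  qed
  obtain N where N: "N \<in> null_sets lborel" "\<And>z. z \<notin> N \<Longrightarrow> 0 < \<gamma> z \<Longrightarrow> nondeg_pt z"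
  proof (rule AE_E3[OF AE_nondeg_pt])
    fix N assume "N \<in> null_sets lborel" "\<And>z. z \<in> space lborel - N \<Longrightarrow> 0 < \<gamma> z \<longrightarrow> nondeg_pt z"
    then show thesis by (intro that[of N]) simp_all
  qed
  have Nb: "N \<in> sets borel" using N(1) by auto
  define idx :: "nat \<Rightarrow> nat \<times> int \<times> (rat \<times> rat)" where "idx = from_nat"
  define g :: "nat \<Rightarrow> real" where "g i = 2 powi fst (snd (idx i))" for i
  have g0: "0 < g i" for i by (simp add: g_def)
  \<comment> \<open>Two points of such a ball are closer than (1/2)^(n+1), the range in which
    \<open>tame_expands\<close> holds.\<close>
  define A where "A i = tame \<kappa> (fst (idx i)) (fst (snd (idx i)))
      \<inter> ball (rat_point (snd (snd (idx i)))) ((1/2)^(fst (idx i) + 2)) - N" for i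
  have Ab[measurable]: "A i \<in> sets borel" for i
    unfolding A_def using Nb by (intro sets.Diff sets.Int tame_borel) auto
  have Ag: "g i \<le> \<gamma> z" "\<gamma> z < 2 * g i" "0 < \<gamma> z" if "z \<in> A i" for i z
  proof -
    show "g i \<le> \<gamma> z" "\<gamma> z < 2 * g i" using that by (auto simp: A_def tame_def g_def)
    with g0[of i] show "0 < \<gamma> z" by linarith
  qed
  have Aex: "c0 / 4 * g i * dist y z \<le> dist (U y) (U z)" if "y \<in> A i" "z \<in> A i" for i y z
    unfolding g_def
  proof (rule ex[of y "fst (idx i)" _ z])
    let ?r = "(1/2 :: real)^(fst (idx i) + 2)"
    have "dist y z \<le> dist (rat_point (snd (snd (idx i)))) y + dist (rat_point (snd (snd (idx i)))) z"
      by (rule dist_triangle3)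
    also have "\<dots> < ?r + ?r" using that by (intro add_strict_mono) (auto simp: A_def)
    finally show "dist y z < (1/2)^(fst (idx i) + 1)" by simp
  qed (use that in \<open>auto simp: A_def\<close>)
  have AN: "nondeg_pt z" if "z \<in> A i" for z i
    using N(2)[of z] Ag(3)[OF that] that by (auto simp: A_def)
  have Ainj: "z = w" if "z \<in> A i" "w \<in> A j" "U z = U w" for z w i j
  proof -
    have "w \<in> ball 0 1" using \<gamma>_outside[of w] Ag(3)[OF that(2)] by fastforce
    then show ?thesis using nondeg_inj[OF AN[OF that(1)], of w] that(3) by simp
  qed
  have cover: "z \<in> (\<Union>i. A i)" if z: "z \<notin> N" "0 < \<gamma> z" for z
  proof -
    obtain n k where nk: "z \<in> tame \<kappa> n k" using nondeg_tame[OF N(2)[OF z] \<kappa>] by blast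
    obtain j where j: "dist (rat_point j) z < (1/2)^(n+2)" using rat_point_dense[of "(1/2)^(n+2)" z] by auto
    have "idx (to_nat (n, k, j)) = (n, k, j)" by (simp add: idx_def)
    then have "z \<in> A (to_nat (n, k, j))" using nk j z by (simp add: A_def)
    then show ?thesis by blast
  qed
  \<comment> \<open>On a piece the squared gradient is below 4 g^2, which is 64 / c0^2 times the
    squared expansion rate (c0 g / 4)^2; the remaining 4 L comes from
    \<open>sum_area_le_hausdorff2\<close> and the growth condition.\<close>
  define C where "C = 256 * L / c0\<^sup>2"
  have C0: "0 \<le> C" using L by (simp add: C_def)
  show ?thesis
  proof (intro exI[of _ C] conjI allI impI C0)
    fix x :: 'a and R :: real assume R: "0 < R"
    define V where "V = {z. U z \<in> ball x R}"
    have [measurable]: "V \<in> sets borel"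
    proof -
      have "open (U -` ball x R)" using cont_U by (intro open_vimage) auto
      then show ?thesis by (simp add: V_def vimage_def)
    qed
    define B where "B i = disjointed A i \<inter> V" for i
    have Bb[measurable]: "B i \<in> sets borel" for i
    proof -
      have "range (disjointed A) \<subseteq> sets borel" by (rule sets.range_disjointed_sets) auto
      then have "disjointed A i \<in> sets borel" by blast
      then show ?thesis unfolding B_def by simp
    qed
    have BA: "B i \<subseteq> A i" for i using disjointed_subset[of A i] by (auto simp: B_def)
    have Bd: "disjoint_family B"
      using disjoint_family_disjointed[of A] by (auto simp: disjoint_family_on_def B_def)
    have part: "(\<Sum>i<n. \<integral>\<^sup>+ z\<in>B i. ennreal (\<gamma> z) ^ 2 \<partial>lborel) \<le> ennreal (C * R\<^sup>2)" for n
    proof (rule ennreal_le_epsilon)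
      fix e :: real assume e: "0 < e"
      \<comment> \<open>The part of piece \<open>i\<close> lost by inner approximation carries at
        most \<open>4 * (g i)\<^sup>2 * \<eta> i\<close>, which is e/(n+1); the \<open>n\<close>
        pieces together lose at most \<open>e\<close>.\<close>
      define \<eta> where "\<eta> i = e / (4 * (g i)\<^sup>2 * (real n + 1))" for i
      have \<eta>0: "0 < \<eta> i" for i using e g0[of i] by (simp add: \<eta>_def)
      have "\<exists>T. closed T \<and> T \<subseteq> B i \<and> emeasure lborel (B i - T) < ennreal (\<eta> i)" for i
      proof -
        have "B i \<in> sets lebesgue" by simp
        then obtain T where T: "closed T" "T \<subseteq> B i" "emeasure lebesgue (B i - T) < ennreal (\<eta> i)"
          by (rule sets_lebesgue_inner_closed[OF _ \<eta>0])
        have "B i - T \<in> sets borel" using T(1) by (intro sets.Diff Bb) auto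
        then show ?thesis using T by (intro exI[of _ T]) simp
      qed
      then have "\<forall>i. \<exists>T. closed T \<and> T \<subseteq> B i \<and> emeasure lborel (B i - T) < ennreal (\<eta> i)" by (rule allI)
      from choice[OF this] obtain T where
        "\<forall>i. closed (T i) \<and> T i \<subseteq> B i \<and> emeasure lborel (B i - T i) < ennreal (\<eta> i)"
        by (elim exE)
      then have T: "\<And>i. closed (T i)" "\<And>i. T i \<subseteq> B i" "\<And>i. emeasure lborel (B i - T i) < ennreal (\<eta> i)"
        by simp_all
      have TA: "T i \<subseteq> A i" for i using T(2) BA by blast
      have Tb[measurable]: "T i \<in> sets borel" for i using T(1) by simp
      have Tc: "compact (T i)" for i
      proof -
        have "T i \<subseteq> ball (rat_point (snd (snd (idx i)))) ((1/2)^(fst (idx i) + 2))"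
          using TA[of i] by (auto simp: A_def)
        then have "bounded (T i)" by (rule bounded_subset[OF bounded_ball])
        then show ?thesis using T(1) by (simp add: compact_eq_bounded_closed)
      qed
      have each: "(\<integral>\<^sup>+ z\<in>B i. ennreal (\<gamma> z) ^ 2 \<partial>lborel)
          \<le> ennreal (64 / c0\<^sup>2) * (ennreal ((c0 / 4 * g i)\<^sup>2) * emeasure lborel (T i)) + ennreal (e / (real n + 1))" for i
      proof -
        have "(\<integral>\<^sup>+ z\<in>B i. ennreal (\<gamma> z) ^ 2 \<partial>lborel) \<le> (\<integral>\<^sup>+ z. ennreal (4 * (g i)\<^sup>2) * indicator (B i) z \<partial>lborel)"
        proof (intro nn_integral_mono)
          fix z
          show "ennreal (\<gamma> z) ^ 2 * indicator (B i) z \<le> ennreal (4 * (g i)\<^sup>2) * indicator (B i) z"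
          proof (cases "z \<in> B i")
            case True
            then have "\<gamma> z \<le> 2 * g i" using Ag(2)[of z i] BA by (auto intro: less_imp_le)
            then have "(\<gamma> z)\<^sup>2 \<le> (2 * g i)\<^sup>2" using \<gamma>_nonneg by (intro power_mono) auto
            then show ?thesis using True \<gamma>_nonneg[of z]
              by (simp add: ennreal_power ennreal_leI power_mult_distrib)
          qed simp
        qed
        also have "\<dots> = ennreal (4 * (g i)\<^sup>2) * emeasure lborel (B i)"
          by (rule nn_integral_cmult_indicator) simp
        also have "emeasure lborel (B i) \<le> emeasure lborel (T i) + emeasure lborel (B i - T i)"
          by (rule order_trans[OF emeasure_mono emeasure_subadditive]) auto
        also have "\<dots> \<le> emeasure lborel (T i) + ennreal (\<eta> i)"
          using T(3)[of i] by (intro add_left_mono) simp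
        finally have "(\<integral>\<^sup>+ z\<in>B i. ennreal (\<gamma> z) ^ 2 \<partial>lborel)
          \<le> ennreal (4 * (g i)\<^sup>2) * (emeasure lborel (T i) + ennreal (\<eta> i))"
          by (simp add: mult_left_mono)
        also have "\<dots> = ennreal (4 * (g i)\<^sup>2) * emeasure lborel (T i) + ennreal (4 * (g i)\<^sup>2 * \<eta> i)"
          using \<eta>0[of i] by (simp add: distrib_left ennreal_mult')
        also have "4 * (g i)\<^sup>2 * \<eta> i = e / (real n + 1)"
          using g0[of i] by (simp add: \<eta>_def)
        also have "ennreal (4 * (g i)\<^sup>2) = ennreal (64 / c0\<^sup>2) * ennreal ((c0 / 4 * g i)\<^sup>2)"
          using c0 by (simp add: power_mult_distrib power_divide flip: ennreal_mult)
        finally show ?thesis by (simp only: mult.assoc)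
      qed
      have "(\<Sum>i<n. \<integral>\<^sup>+ z\<in>B i. ennreal (\<gamma> z) ^ 2 \<partial>lborel)
          \<le> (\<Sum>i<n. ennreal (64 / c0\<^sup>2) * (ennreal ((c0 / 4 * g i)\<^sup>2) * emeasure lborel (T i)) + ennreal (e / (real n + 1)))"
        by (intro sum_mono each)
      also have "\<dots> = ennreal (64 / c0\<^sup>2) * (\<Sum>i<n. ennreal ((c0 / 4 * g i)\<^sup>2) * emeasure lborel (T i))
          + of_nat n * ennreal (e / (real n + 1))"
        by (simp only: sum.distrib sum_distrib_left sum_constant card_lessThan)
      also have "\<dots> \<le> ennreal (64 / c0\<^sup>2) * (4 * ennreal (L * R\<^sup>2)) + ennreal e"
      proof (intro add_mono mult_left_mono)
        have "(\<Sum>i<n. ennreal ((c0 / 4 * g i)\<^sup>2) * emeasure lborel (T i)) \<le> 4 * hausdorff2 dist (ball x R)"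
        proof (rule sum_area_le_hausdorff2[OF _ Tc cont_U])
          show "c0 / 4 * g i * dist z w \<le> dist (U z) (U w)" if "z \<in> T i" "w \<in> T i" for i z w
            using that TA by (intro Aex) auto
          show "0 < c0 / 4 * g i" for i using c0 g0 by simp
          show "U ` T i \<inter> U ` T j = {}" if "i \<noteq> j" for i j
          proof (rule ccontr)
            assume "U ` T i \<inter> U ` T j \<noteq> {}"
            then obtain z w where zw: "z \<in> T i" "w \<in> T j" "U z = U w" by fastforce
            then have "z = w" using TA Ainj by blast
            then have "z \<in> B i \<inter> B j" using zw T(2) by blast
            moreover have "B i \<inter> B j = {}" using Bd that by (auto simp: disjoint_family_on_def)
            ultimately show False by simp
          qed
          show "U ` T i \<subseteq> ball x R" for i using T(2)[of i] by (auto simp: B_def V_def)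
        qed simp
        also have "\<dots> \<le> 4 * ennreal (L * R\<^sup>2)" by (intro mult_left_mono growth R) simp
        finally show "(\<Sum>i<n. ennreal ((c0 / 4 * g i)\<^sup>2) * emeasure lborel (T i)) \<le> 4 * ennreal (L * R\<^sup>2)" .
        have "of_nat n * ennreal (e / (real n + 1)) = ennreal (real n * (e / (real n + 1)))"
          using e by (simp add: ennreal_of_nat_eq_real_of_nat flip: ennreal_mult)
        also have "\<dots> \<le> ennreal e" using e by (intro ennreal_leI) (simp add: field_simps)
        finally show "of_nat n * ennreal (e / (real n + 1)) \<le> ennreal e" .
      qed simp
      also have "ennreal (64 / c0\<^sup>2) * (4 * ennreal (L * R\<^sup>2)) = ennreal (64 / c0\<^sup>2) * (ennreal 4 * ennreal (L * R\<^sup>2))"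
        by simp
      also have "\<dots> = ennreal (64 / c0\<^sup>2) * ennreal (4 * (L * R\<^sup>2))"
        by (subst ennreal_mult[of 4]) (use L in simp_all)
      also have "\<dots> = ennreal (64 / c0\<^sup>2 * (4 * (L * R\<^sup>2)))"
        by (rule ennreal_mult[symmetric]) (use L in simp_all)
      also have "64 / c0\<^sup>2 * (4 * (L * R\<^sup>2)) = C * R\<^sup>2" by (simp add: C_def)
      finally show "(\<Sum>i<n. \<integral>\<^sup>+ z\<in>B i. ennreal (\<gamma> z) ^ 2 \<partial>lborel) \<le> ennreal (C * R\<^sup>2) + ennreal e" .
    qed
    have UB: "(\<Union>i. B i) = (\<Union>i. A i) \<inter> V" using UN_disjointed_eq[of A] by (auto simp: B_def)
    have "(\<integral>\<^sup>+ z\<in>V. ennreal (\<gamma> z) ^ 2 \<partial>lborel) = (\<integral>\<^sup>+ z\<in>(\<Union>i. B i). ennreal (\<gamma> z) ^ 2 \<partial>lborel)"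
    proof (intro nn_integral_cong_AE)
      have "AE z in lborel. z \<notin> N" by (rule AE_not_in[OF N(1)])
      then show "AE z in lborel. ennreal (\<gamma> z) ^ 2 * indicator V z = ennreal (\<gamma> z) ^ 2 * indicator (\<Union>i. B i) z"
      proof eventually_elim
        case (elim z)
        show ?case
        proof (cases "\<gamma> z = 0")
          case False
          then have "z \<in> (\<Union>i. A i)" using cover[OF elim] \<gamma>_nonneg[of z] by simp
          then have "z \<in> (\<Union>i. B i) \<longleftrightarrow> z \<in> V" unfolding UB by blast
          then show ?thesis by (simp only: indicator_def)
        qed simp
      qed
    qed
    also have "\<dots> = emeasure (density lborel (\<lambda>z. ennreal (\<gamma> z) ^ 2)) (\<Union>i. B i)"
      by (simp add: emeasure_density)
    also have "\<dots> = (\<Sum>i. emeasure (density lborel (\<lambda>z. ennreal (\<gamma> z) ^ 2)) (B i))"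
      by (rule suminf_emeasure[symmetric]) (use Bd in auto)
    also have "\<dots> = (\<Sum>i. \<integral>\<^sup>+ z\<in>B i. ennreal (\<gamma> z) ^ 2 \<partial>lborel)"
      by (simp add: emeasure_density)
    also have "\<dots> \<le> ennreal (C * R\<^sup>2)"
      unfolding suminf_eq_SUP by (intro SUP_least part)
    finally show "(\<integral>\<^sup>+ z\<in>{z. U z \<in> ball x R}. ennreal (\<gamma> z) ^ 2 \<partial>lborel) \<le> ennreal (C * R\<^sup>2)"
      unfolding V_def .
  qed
qed

end

section \<open>Injectivity\<close>

text \<open>Here \<open>r\<close> is the first time at which the value \<open>d\<close> is attained,
  and \<open>l\<close> the last time before \<open>r\<close> with value \<open>c\<close>. The strict
  inequalities at \<open>t0\<close> and \<open>t1\<close> keep both in the interior, which matters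
  when \<open>t0\<close> or \<open>t1\<close> lies on the boundary circle.\<close>

lemma crossing:
  fixes \<delta> :: "real \<Rightarrow> real"
  assumes cont: "continuous_on {t0..t1} \<delta>" and "t0 \<le> t1" and "\<delta> t0 < c" "c < d" "d < \<delta> t1"
  shows "\<exists>l r. t0 < l \<and> l < r \<and> r < t1 \<and> \<delta> l = c \<and> \<delta> r = d \<and> (\<forall>t. l < t \<and> t < r \<longrightarrow> c < \<delta> t \<and> \<delta> t \<le> d)"
proof -
  define R where "R = {t \<in> {t0..t1}. \<delta> t = d}"
  have Rc: "compact R"
  proof -
    have "closed ({t0..t1} \<inter> \<delta> -` {d})" by (rule continuous_closed_preimage[OF cont]) auto
    then have "compact ({t0..t1} \<inter> ({t0..t1} \<inter> \<delta> -` {d}))" by (intro compact_Int_closed compact_Icc)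
    moreover have "{t0..t1} \<inter> ({t0..t1} \<inter> \<delta> -` {d}) = R" by (auto simp: R_def)
    ultimately show ?thesis by simp
  qed
  have "\<exists>t. t0 \<le> t \<and> t \<le> t1 \<and> \<delta> t = d"
    using assms by (intro IVT' cont) auto
  then have Rne: "R \<noteq> {}" by (auto simp: R_def)
  obtain r where r: "r \<in> R" "\<And>t. t \<in> R \<Longrightarrow> r \<le> t"
    using compact_attains_inf[OF Rc Rne] by blast
  have r': "t0 \<le> r" "r \<le> t1" "\<delta> r = d" using r(1) by (auto simp: R_def)
  have cr: "continuous_on {t0..r} \<delta>" using r' by (intro continuous_on_subset[OF cont]) auto
  define S where "S = {t \<in> {t0..r}. \<delta> t = c}"
  have Sc: "compact S"
  proof -
    have "closed ({t0..r} \<inter> \<delta> -` {c})" by (rule continuous_closed_preimage[OF cr]) auto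
    then have "compact ({t0..r} \<inter> ({t0..r} \<inter> \<delta> -` {c}))" by (intro compact_Int_closed compact_Icc)
    moreover have "{t0..r} \<inter> ({t0..r} \<inter> \<delta> -` {c}) = S" by (auto simp: S_def)
    ultimately show ?thesis by simp
  qed
  have "\<exists>t. t0 \<le> t \<and> t \<le> r \<and> \<delta> t = c"
    using assms r' by (intro IVT' cr) auto
  then have Sne: "S \<noteq> {}" by (auto simp: S_def)
  obtain l where l: "l \<in> S" "\<And>t. t \<in> S \<Longrightarrow> t \<le> l"
    using compact_attains_sup[OF Sc Sne] by blast
  have l': "t0 \<le> l" "l \<le> r" "\<delta> l = c" using l(1) by (auto simp: S_def)
  have "t0 < l" using l' assms(3) by (cases "t0 = l") auto
  moreover have "l < r" using l' r' assms(4) by (cases "l = r") auto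
  moreover have "r < t1" using r' assms(5) by (cases "r = t1") auto
  moreover have "c < \<delta> t \<and> \<delta> t \<le> d" if t: "l < t" "t < r" for t
  proof
    show "c < \<delta> t"
    proof (rule ccontr)
      assume "\<not> c < \<delta> t"
      then have "\<exists>s. t \<le> s \<and> s \<le> r \<and> \<delta> s = c"
        using t l' r' assms(4) by (intro IVT' continuous_on_subset[OF cr]) auto
      then obtain s where "t \<le> s" "s \<le> r" "\<delta> s = c" by blast
      then have "s \<in> S" using t l' by (auto simp: S_def)
      then show False using l(2)[of s] t \<open>t \<le> s\<close> by linarith
    qed
    show "\<delta> t \<le> d"
    proof (rule ccontr)
      assume "\<not> \<delta> t \<le> d"
      then have "\<exists>s. l \<le> s \<and> s \<le> t \<and> \<delta> s = d"
        using t l' r' assms(4) by (intro IVT' continuous_on_subset[OF cr]) auto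
      then obtain s where "l \<le> s" "s \<le> t" "\<delta> s = d" by blast
      then have "s \<in> R" using t l' r' by (auto simp: R_def)
      then show False using r(2)[of s] t \<open>s \<le> t\<close> by linarith
    qed
  qed
  ultimately show ?thesis using l' r' by blast
qed

lemma crossing_unordered:
  fixes \<delta> :: "real \<Rightarrow> real"
  assumes cont: "continuous_on UNIV \<delta>" and "\<delta> t0 < c" "c < d" "d < \<delta> t1"
  obtains l r where "min t0 t1 < l" "l < r" "r < max t0 t1" "\<bar>\<delta> r - \<delta> l\<bar> = d - c"
    "\<And>t. l < t \<Longrightarrow> t < r \<Longrightarrow> c < \<delta> t \<and> \<delta> t \<le> d"
proof (cases "t0 \<le> t1")
  case True
  have "continuous_on {t0..t1} \<delta>" by (rule continuous_on_subset[OF cont]) simp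
  from crossing[OF this True assms(2-4)] obtain l r where
    "t0 < l" "l < r" "r < t1" "\<delta> l = c" "\<delta> r = d" "\<forall>t. l < t \<and> t < r \<longrightarrow> c < \<delta> t \<and> \<delta> t \<le> d" by (elim exE conjE)
  with True assms(3) show thesis by (intro that[of l r]) auto
next
  case False
  define \<delta>' where "\<delta>' t = \<delta> (- t)" for t
  have "continuous_on {-t0..-t1} \<delta>'" unfolding \<delta>'_def
    by (intro continuous_on_compose2[OF cont] continuous_intros) auto
  moreover have "-t0 \<le> -t1" "\<delta>' (-t0) < c" "d < \<delta>' (-t1)" using False assms by (auto simp: \<delta>'_def)
  ultimately obtain l r where
    lr: "-t0 < l" "l < r" "r < -t1" "\<delta>' l = c" "\<delta>' r = d" "\<forall>t. l < t \<and> t < r \<longrightarrow> c < \<delta>' t \<and> \<delta>' t \<le> d"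
    using crossing[of "-t0" "-t1" \<delta>' c d] assms(3) by blast
  show thesis
  proof (rule that[of "-r" "-l"])
    show "c < \<delta> t \<and> \<delta> t \<le> d" if "-r < t" "t < -l" for t
      using lr(6)[rule_format, of "-t"] that by (auto simp: \<delta>'_def)
  qed (use lr False assms(3) in \<open>auto simp: \<delta>'_def\<close>)
qed

text \<open>Upgrades almost every line to every line: a failure that persists on an open set of
  parameters would contradict the almost everywhere statement.\<close>

lemma AE_open_exists:
  assumes "AE y in lborel. P (y::real)" "open S" "y0 \<in> S"
  shows "\<exists>y\<in>S. P y"
proof -
  obtain e where e: "0 < e" "cball y0 e \<subseteq> S" using assms(2,3) by (meson open_contains_cball)
  have "\<exists>y\<in>{y0..y0 + e}. P y \<and> (0::ennreal) \<le> ennreal (2 * 1)"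
    by (rule exists_small_AE[OF assms(1)]) (use e in auto)
  moreover have "{y0..y0 + e} \<subseteq> cball y0 e" by (auto simp: dist_real_def)
  ultimately show ?thesis using e(2) by blast
qed

lemma harmonic_tail_infinite:
  assumes "\<And>k. k0 \<le> k \<Longrightarrow> ennreal (1 / (2 * (real k + 1))) \<le> (f k :: ennreal)"
  shows "(\<Sum>k. f k) = top"
proof (rule ccontr)
  assume "(\<Sum>k. f k) \<noteq> top"
  have "(\<Sum>k. ennreal (1 / (2 * (real (k + k0) + 1)))) \<le> (\<Sum>k. f (k + k0))"
    by (intro suminf_le summableI assms) simp
  also have "\<dots> \<le> (\<Sum>k. f k)"
  proof -
    have "(\<Sum>k. f k) = (\<Sum>k. f (k + k0)) + (\<Sum>k<k0. f k)" by (rule suminf_offset) simp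
    then show ?thesis by simp
  qed
  finally have "(\<Sum>k. ennreal (1 / (2 * (real (k + k0) + 1)))) \<noteq> top"
    using \<open>(\<Sum>k. f k) \<noteq> top\<close> by (auto simp: top_unique)
  then have "summable (\<lambda>k. 1 / (2 * (real (k + k0) + 1)))"
    by (intro summable_suminf_not_top) auto
  then have "summable (\<lambda>k. 1 / (2 * (real k + 1)))"
    by (subst (asm) summable_iff_shift[of "\<lambda>k. 1 / (2 * (real k + 1))"])
  from summable_mult[OF this, of 2] have "summable (\<lambda>k. 2 * (1 / (2 * (real k + 1))))" .
  moreover have "(\<lambda>k. 2 * (1 / (2 * (real k + 1)))) = (\<lambda>k. inverse (real (Suc k)))"
    by (simp add: fun_eq_iff field_simps)
  ultimately have "summable (\<lambda>k. inverse (real (Suc k)))" by simp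
  then show False
    using not_summable_harmonic[where 'a = real] by (subst (asm) summable_Suc_iff) simp
qed

section \<open>The logarithmic weight and the spreading of a nondegenerate fibre\<close>

context qc_map
begin

text \<open>The shells discretise the weight \<open>\<gamma> / (d log (1 / d))\<close> with \<open>d = dist (U z) x\<close>.\<close>
definition shell :: "'a \<Rightarrow> nat \<Rightarrow> complex set" where
  "shell x k = {z. (1/2)^(k+1) < dist (U z) x \<and> dist (U z) x \<le> (1/2)^k}"

definition weight :: "'a \<Rightarrow> nat \<Rightarrow> complex \<Rightarrow> real" where
  "weight x k z = 2^k / (real k + 1) * \<gamma> z * indicator (shell x k) z"

lemma shell_borel [measurable]: "shell x k \<in> sets borel"
proof -
  have "shell x k = {z. (1/2)^(k+1) < dist (U z) x} \<inter> {z. dist (U z) x \<le> (1/2)^k}"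
    by (auto simp: shell_def)
  also have "\<dots> \<in> sets borel"
    by (intro sets.Int borel_open borel_closed open_Collect_less closed_Collect_le continuous_intros)
  finally show ?thesis .
qed

lemma weight_borel [measurable]: "weight x k \<in> borel_measurable borel"
  unfolding weight_def by measurable

text \<open>On each shell the weight a times \<open>\<gamma>\<close> is at most 1 plus its square.
  The constants 1 add up to at most the area of the disc, the shells being disjoint. By
  \<open>energy_bound\<close>, the squares contribute 4C/(k+1)^2. The radius there is doubled
  because the shell contains the sphere of radius (1/2)^k and the ball is open.\<close>

lemma weight_integrable: "(\<integral>\<^sup>+ z. (\<Sum>k. ennreal (weight x k z)) \<partial>lborel) < \<infinity>"
proof -
  obtain C where C: "0 \<le> C" "\<And>x R. 0 < R \<Longrightarrow>
      (\<integral>\<^sup>+ z\<in>{z. U z \<in> ball x R}. ennreal (\<gamma> z) ^ 2 \<partial>lborel) \<le> ennreal (C * R\<^sup>2)"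
    using energy_bound by blast
  let ?D = "ball (0::complex) 1"
  have each: "(\<integral>\<^sup>+ z. ennreal (weight x k z) \<partial>lborel) \<le> emeasure lborel (shell x k \<inter> ?D) + ennreal (4 * C * (1 / (real k + 1)\<^sup>2))" for k
  proof -
    define a where "a = 2^k / (real k + 1)"
    have a0: "0 \<le> a" by (simp add: a_def)
    have "(\<integral>\<^sup>+ z. ennreal (weight x k z) \<partial>lborel)
        \<le> (\<integral>\<^sup>+ z. indicator (shell x k \<inter> ?D) z + ennreal (a\<^sup>2) * (ennreal (\<gamma> z) ^ 2 * indicator {z. U z \<in> ball x (2 * (1/2)^k)} z) \<partial>lborel)"
    proof (intro nn_integral_mono)
      fix z
      show "ennreal (weight x k z) \<le> indicator (shell x k \<inter> ?D) z + ennreal (a\<^sup>2) * (ennreal (\<gamma> z) ^ 2 * indicator {z. U z \<in> ball x (2 * (1/2)^k)} z)"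
      proof (cases "z \<in> shell x k \<and> z \<in> ?D")
        case True
        have "0 < (1/2 :: real)^k" by simp
        then have ib: "U z \<in> ball x (2 * (1/2)^k)" using True by (auto simp: shell_def dist_commute)
        have "weight x k z = a * \<gamma> z" using True by (simp add: weight_def a_def)
        also have "\<dots> \<le> 1 + (a * \<gamma> z)\<^sup>2"
          using zero_le_power2[of "a * \<gamma> z - 1"] mult_nonneg_nonneg[OF a0 \<gamma>_nonneg[of z]]
          unfolding power2_diff one_power2 mult_1_right by linarith
        finally have "ennreal (weight x k z) \<le> ennreal (1 + a\<^sup>2 * (\<gamma> z)\<^sup>2)"
          by (intro ennreal_leI) (simp add: power_mult_distrib)
        also have "\<dots> = 1 + ennreal (a\<^sup>2) * ennreal (\<gamma> z) ^ 2"
          using \<gamma>_nonneg[of z] by (simp add: ennreal_power ennreal_mult)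
        finally show ?thesis using True ib by simp
      next
        case False
        then have "weight x k z = 0" using \<gamma>_outside[of z] by (auto simp: weight_def)
        then show ?thesis by simp
      qed
    qed
    also have "\<dots> = emeasure lborel (shell x k \<inter> ?D)
        + ennreal (a\<^sup>2) * (\<integral>\<^sup>+ z\<in>{z. U z \<in> ball x (2 * (1/2)^k)}. ennreal (\<gamma> z) ^ 2 \<partial>lborel)"
    proof -
      have "open (U -` ball x (2 * (1/2)^k))" using cont_U by (intro open_vimage) auto
      then have [measurable]: "{z. U z \<in> ball x (2 * (1/2)^k)} \<in> sets borel" by (simp only: vimage_def borel_open)
      define V where "V = {z. U z \<in> ball x (2 * (1/2)^k)}"
      have [measurable]: "V \<in> sets borel" unfolding V_def by fact
      have "(\<integral>\<^sup>+ z. indicator (shell x k \<inter> ?D) z \<partial>lborel) = emeasure lborel (shell x k \<inter> ?D)"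
        by (rule nn_integral_indicator) simp
      then show ?thesis unfolding V_def[symmetric] by (subst nn_integral_add) (auto simp: nn_integral_cmult)
    qed
    also have "\<dots> \<le> emeasure lborel (shell x k \<inter> ?D) + ennreal (a\<^sup>2) * ennreal (C * (2 * (1/2)^k)\<^sup>2)"
      by (intro add_left_mono mult_left_mono C(2)) auto
    also have "ennreal (a\<^sup>2) * ennreal (C * (2 * (1/2)^k)\<^sup>2) = ennreal (4 * C * (1 / (real k + 1)\<^sup>2))"
    proof -
      have "ennreal (a\<^sup>2) * ennreal (C * (2 * (1/2)^k)\<^sup>2) = ennreal (a\<^sup>2 * (C * (2 * (1/2)^k)\<^sup>2))"
        using C(1) by (intro ennreal_mult[symmetric]) auto
      also have "a\<^sup>2 * (C * (2 * (1/2)^k)\<^sup>2) = 4 * C * ((2^k * (1/2)^k)\<^sup>2 / (real k + 1)\<^sup>2)"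
        by (simp add: a_def power_mult_distrib power_divide)
      also have "(2::real)^k * (1/2)^k = 1" by (simp flip: power_mult_distrib)
      finally show ?thesis by simp
    qed
    finally show ?thesis .
  qed
  have disj: "disjoint_family (\<lambda>k. shell x k \<inter> ?D)"
    unfolding disjoint_family_on_def
  proof (intro ballI impI)
    have *: "shell x m \<inter> shell x n = {}" if "m < n" for m n
    proof -
      have "(1/2 :: real)^n \<le> (1/2)^(m+1)" using that by (intro power_decreasing) auto
      then show ?thesis by (force simp: shell_def)
    qed
    fix m n :: nat assume "m \<noteq> n"
    then show "(shell x m \<inter> ?D) \<inter> (shell x n \<inter> ?D) = {}"
      using *[of m n] *[of n m] by (cases m n rule: linorder_cases) blast+
  qed
  have "(\<integral>\<^sup>+ z. (\<Sum>k. ennreal (weight x k z)) \<partial>lborel) = (\<Sum>k. \<integral>\<^sup>+ z. ennreal (weight x k z) \<partial>lborel)"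
    by (rule nn_integral_suminf) simp
  also have "\<dots> \<le> (\<Sum>k. emeasure lborel (shell x k \<inter> ?D) + ennreal (4 * C * (1 / (real k + 1)\<^sup>2)))"
    by (intro suminf_le summableI each)
  also have "\<dots> = (\<Sum>k. emeasure lborel (shell x k \<inter> ?D)) + (\<Sum>k. ennreal (4 * C * (1 / (real k + 1)\<^sup>2)))"
    by (rule suminf_add[symmetric]) simp_all
  also have "(\<Sum>k. emeasure lborel (shell x k \<inter> ?D)) = emeasure lborel (\<Union>k. shell x k \<inter> ?D)"
    by (rule suminf_emeasure) (use disj in auto)
  also have "\<dots> \<le> emeasure lborel ?D" by (rule emeasure_mono) auto
  finally have "(\<integral>\<^sup>+ z. (\<Sum>k. ennreal (weight x k z)) \<partial>lborel)
      \<le> emeasure lborel ?D + (\<Sum>k. ennreal (4 * C * (1 / (real k + 1)\<^sup>2)))"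
    by (simp add: add_right_mono)
  also have "\<dots> < \<infinity>"
  proof -
    have "summable (\<lambda>k. 1 / (real k + 1)\<^sup>2)"
      using inverse_squares_sums by (simp add: sums_iff add.commute)
    then have "summable (\<lambda>k. 4 * C * (1 / (real k + 1)\<^sup>2))" by (rule summable_mult)
    then have "(\<Sum>k. ennreal (4 * C * (1 / (real k + 1)\<^sup>2))) \<noteq> top"
      using C(1) by (intro ennreal_suminf_neq_top) auto
    then show ?thesis using emeasure_lborel_ball_finite[of "0::complex" 1] by (simp add: less_top)
  qed
  finally show ?thesis .
qed

text \<open>On its way out of the fibre the curve crosses every shell with \<open>k\<close> at least
  some \<open>k0\<close>. Crossing shell \<open>k\<close> requires an integral of
  \<open>\<gamma>\<close> of at least half of (1/2)^k, hence a weighted one of at least 1/(2(k+1)),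
  and the sum diverges. The line estimate is assumed only inside the open interval, while
  \<open>t0\<close> and \<open>t1\<close> may be its ends, as for a chord ending on the
  circle.\<close>

lemma line_in_fibre:
  fixes \<phi> :: "real \<Rightarrow> complex"
  assumes line: "\<And>a b. a \<le> b \<Longrightarrow> \<alpha> < a \<Longrightarrow> b < \<beta> \<Longrightarrow>
      ennreal (dist (U (\<phi> a)) (U (\<phi> b))) \<le> (\<integral>\<^sup>+ t\<in>{a..b}. ennreal (\<gamma> (\<phi> t)) \<partial>lborel)"
    and fin: "(\<integral>\<^sup>+ t. (\<Sum>k. ennreal (weight x k (\<phi> t))) \<partial>lborel) < \<infinity>"
    and \<phi>: "continuous_on UNIV \<phi>"
    and t0: "t0 \<in> {\<alpha>..\<beta>}" "U (\<phi> t0) = x" and t1: "t1 \<in> {\<alpha>..\<beta>}"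
  shows "U (\<phi> t1) = x"
proof (rule ccontr)
  assume "U (\<phi> t1) \<noteq> x"
  have [measurable]: "\<phi> \<in> borel_measurable borel" using \<phi> by (rule borel_measurable_continuous_onI)
  define \<delta> where "\<delta> t = dist (U (\<phi> t)) x" for t
  have \<delta>c: "continuous_on UNIV \<delta>" unfolding \<delta>_def by (intro continuous_intros \<phi>)
  have "0 < \<delta> t1" using \<open>U (\<phi> t1) \<noteq> x\<close> by (simp add: \<delta>_def)
  then obtain k0 where k0: "(1/2 :: real)^k0 < \<delta> t1" using real_arch_pow_inv[of "\<delta> t1" "1/2"] by auto
  have "ennreal (1 / (2 * (real k + 1))) \<le> (\<integral>\<^sup>+ t. ennreal (weight x k (\<phi> t)) \<partial>lborel)" if k: "k0 \<le> k" for k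
  proof -
    have "(1/2 :: real)^k \<le> (1/2)^k0" using k by (intro power_decreasing) auto
    then have d1: "(1/2 :: real)^k < \<delta> t1" using k0 by (rule le_less_trans)
    have c0': "\<delta> t0 < (1/2)^(k+1)" using t0 by (simp add: \<delta>_def)
    have cd: "(1/2 :: real)^(k+1) < (1/2)^k" by simp
    obtain l r where lr: "min t0 t1 < l" "l < r" "r < max t0 t1" "\<bar>\<delta> r - \<delta> l\<bar> = (1/2)^k - (1/2)^(k+1)"
      "\<And>t. l < t \<Longrightarrow> t < r \<Longrightarrow> (1/2)^(k+1) < \<delta> t \<and> \<delta> t \<le> (1/2)^k"
    proof (rule crossing_unordered[of \<delta> t0 "(1/2)^(k+1)" "(1/2)^k" t1])
      show "continuous_on UNIV \<delta>" by (rule \<delta>c)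
      show "\<delta> t0 < (1/2)^(k+1)" by (rule c0')
      show "(1/2 :: real)^(k+1) < (1/2)^k" by (rule cd)
      show "(1/2)^k < \<delta> t1" by (rule d1)
    qed (rule that)
    have lr': "\<alpha> < l" "r < \<beta>" using lr t0 t1 by auto
    define a where "a = 2^k / (real k + 1)"
    have a0: "0 \<le> a" by (simp add: a_def)
    have "(1/2 :: real)^k - (1/2)^(k+1) = (1/2)^k / 2" by simp
    then have "(1/2)^k / 2 \<le> dist (U (\<phi> l)) (U (\<phi> r))"
      using lr(4) abs_dist_diff_le[of "U (\<phi> r)" x "U (\<phi> l)"] unfolding \<delta>_def by (simp add: dist_commute)
    then have "ennreal a * ennreal ((1/2)^k / 2) \<le> ennreal a * ennreal (dist (U (\<phi> l)) (U (\<phi> r)))"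
      by (intro mult_left_mono ennreal_leI) auto
    also have "\<dots> \<le> ennreal a * (\<integral>\<^sup>+ t\<in>{l..r}. ennreal (\<gamma> (\<phi> t)) \<partial>lborel)"
      using lr(2) lr' by (intro mult_left_mono line) auto
    also have "\<dots> = (\<integral>\<^sup>+ t. ennreal a * (ennreal (\<gamma> (\<phi> t)) * indicator {l..r} t) \<partial>lborel)"
      by (rule nn_integral_cmult[symmetric]) measurable
    also have "\<dots> \<le> (\<integral>\<^sup>+ t. ennreal (weight x k (\<phi> t)) \<partial>lborel)"
    proof (intro nn_integral_mono_AE)
      show "AE t in lborel. ennreal a * (ennreal (\<gamma> (\<phi> t)) * indicator {l..r} t) \<le> ennreal (weight x k (\<phi> t))"
        using AE_lborel_singleton[of l] AE_lborel_singleton[of r]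
      proof eventually_elim
        case (elim t)
        show ?case
        proof (cases "l < t \<and> t < r")
          case True
          then have "\<phi> t \<in> shell x k" using lr(5)[of t] by (simp add: shell_def \<delta>_def)
          then have "weight x k (\<phi> t) = a * \<gamma> (\<phi> t)" by (simp add: weight_def a_def)
          then show ?thesis using True a0 \<gamma>_nonneg by (simp add: ennreal_mult)
        next
          case False
          then show ?thesis using elim by auto
        qed
      qed
    qed
    also have "ennreal a * ennreal ((1/2)^k / 2) = ennreal (1 / (2 * (real k + 1)))"
    proof -
      have "a * ((1/2)^k / 2) = (2^k * (1/2)^k) / (2 * (real k + 1))" by (simp add: a_def)
      also have "(2::real)^k * (1/2)^k = 1" by (simp flip: power_mult_distrib)
      finally have "a * ((1/2)^k / 2) = 1 / (2 * (real k + 1))" .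
      then show ?thesis using a0 by (simp only: ennreal_mult'[symmetric])
    qed
    finally show ?thesis .
  qed
  then have "(\<Sum>k. \<integral>\<^sup>+ t. ennreal (weight x k (\<phi> t)) \<partial>lborel) = top" by (rule harmonic_tail_infinite)
  moreover have "(\<integral>\<^sup>+ t. (\<Sum>k. ennreal (weight x k (\<phi> t))) \<partial>lborel) = (\<Sum>k. \<integral>\<^sup>+ t. ennreal (weight x k (\<phi> t)) \<partial>lborel)"
    by (rule nn_integral_suminf) measurable
  ultimately show False using fin by simp
qed

lemma chord_in_fibre:
  assumes nrm: "\<And>y t. (norm (chart p v y t))\<^sup>2 = y\<^sup>2 + t\<^sup>2" and v: "norm v = 1"
    and fin: "(\<integral>\<^sup>+ t. (\<Sum>k. ennreal (weight x k (chart p v y t))) \<partial>lborel) \<noteq> \<infinity>"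
    and ln: "\<forall>a b. a \<le> b \<longrightarrow> (\<forall>t\<in>{a..b}. chart p v y t \<in> ball 0 1) \<longrightarrow>
        ennreal (dist (U (chart p v y a)) (U (chart p v y b)))
          \<le> (\<integral>\<^sup>+ t\<in>{a..b}. ennreal (norm v * \<gamma> (chart p v y t)) \<partial>lborel)"
    and t0: "chart p v y t0 \<in> cball 0 1" "U (chart p v y t0) = x" and t: "chart p v y t \<in> cball 0 1"
  shows "U (chart p v y t) = x"
proof -
  \<comment> \<open>Half the length of the chord; by \<open>nrm\<close> the vectors \<open>p\<close>
    and \<open>v\<close> form an orthonormal frame.\<close>
  define \<rho> where "\<rho> = sqrt (1 - y\<^sup>2)"
  have inside: "chart p v y s \<in> ball 0 1" if "-\<rho> < s" "s < \<rho>" for s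
  proof -
    have "sqrt (s\<^sup>2) < sqrt (1 - y\<^sup>2)" using that by (simp add: \<rho>_def abs_less_iff)
    then have "s\<^sup>2 < 1 - y\<^sup>2" by (simp only: real_sqrt_less_iff)
    then have "(norm (chart p v y s))\<^sup>2 < 1" using nrm[of y s] by linarith
    then show ?thesis by (simp add: abs_square_less_1)
  qed
  have range: "s \<in> {-\<rho>..\<rho>}" if "chart p v y s \<in> cball 0 1" for s
  proof -
    have "(norm (chart p v y s))\<^sup>2 \<le> 1" using that by (simp add: abs_square_le_1)
    then have "sqrt (s\<^sup>2) \<le> \<rho>" unfolding \<rho>_def real_sqrt_le_iff using nrm[of y s] by linarith
    then show ?thesis by (simp add: abs_le_iff)
  qed
  have line: "ennreal (dist (U (chart p v y a)) (U (chart p v y b))) \<le> (\<integral>\<^sup>+ t\<in>{a..b}. ennreal (\<gamma> (chart p v y t)) \<partial>lborel)"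
    if "a \<le> b" "-\<rho> < a" "b < \<rho>" for a b
  proof -
    have "\<forall>t\<in>{a..b}. chart p v y t \<in> ball 0 1"
    proof
      fix t assume "t \<in> {a..b}"
      then have "-\<rho> < t" "t < \<rho>" using that by simp_all
      then show "chart p v y t \<in> ball 0 1" by (rule inside)
    qed
    from ln[rule_format, OF that(1) bspec[OF this]] show ?thesis by (simp only: v mult_1_left)
  qed
  have "(\<integral>\<^sup>+ t. (\<Sum>k. ennreal (weight x k (chart p v y t))) \<partial>lborel) < \<infinity>" using fin by (simp add: less_top)
  moreover have "continuous_on UNIV (chart p v y)"
    using continuous_chart[of UNIV "\<lambda>_. y" "\<lambda>t. t" p v] by (simp add: continuous_on_const continuous_on_id)
  ultimately show ?thesis
    using line_in_fibre[of "-\<rho>" \<rho> "chart p v y" x t0 t, OF line _ _ range[OF t0(1)] t0(2) range[OF t]] by simp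
qed

text \<open>By \<open>weight_integrable\<close> and Fubini almost every chord over \<open>S\<close>
  satisfies \<open>chord_in_fibre\<close>. A point outside the fibre would remain outside for an
  open set of parameters \<open>y\<close>, so \<open>AE_open_exists\<close> removes the exceptional
  chords.\<close>

lemma fibre_propagates:
  assumes um: "unimodular p v" and nrm: "\<And>y t. (norm (chart p v y t))\<^sup>2 = y\<^sup>2 + t\<^sup>2" and v: "norm v = 1"
    and S: "open S"
    and hit: "\<And>y. y \<in> S \<Longrightarrow> \<exists>t. chart p v y t \<in> cball 0 1 \<and> U (chart p v y t) = x"
    and y: "y \<in> S" "chart p v y t \<in> ball 0 1"
  shows "U (chart p v y t) = x"
proof (rule ccontr)
  assume neq: "U (chart p v y t) \<noteq> x"
  have "(\<integral>\<^sup>+ y. \<integral>\<^sup>+ t. (\<Sum>k. ennreal (weight x k (chart p v y t))) \<partial>lborel \<partial>lborel) < \<infinity>"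
    using weight_integrable[of x] by (subst unimodularD[OF um, symmetric]) auto
  then have "AE y in lborel. (\<integral>\<^sup>+ t. (\<Sum>k. ennreal (weight x k (chart p v y t))) \<partial>lborel) \<noteq> \<infinity>"
    by (intro nn_integral_PInf_AE) auto
  then have ae: "AE y in lborel. y \<in> S \<longrightarrow> (\<forall>t. chart p v y t \<in> cball 0 1 \<longrightarrow> U (chart p v y t) = x)"
    using lines[OF um]
  proof eventually_elim
    case (elim y)
    show ?case
    proof (intro impI allI)
      fix t assume "y \<in> S" and t: "chart p v y t \<in> cball 0 1"
      with hit obtain t0 where t0: "chart p v y t0 \<in> cball 0 1" "U (chart p v y t0) = x" by blast
      show "U (chart p v y t) = x"
        by (rule chord_in_fibre[OF nrm v elim t0 t])
    qed
  qed
  define V where "V = S \<inter> {y. norm (chart p v y t) < 1} \<inter> {y. 0 < dist (U (chart p v y t)) x}"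
  have "open V" unfolding V_def
    by (intro open_Int S open_Collect_less continuous_intros)
  moreover have "y \<in> V" using y neq by (simp add: V_def)
  ultimately obtain y' where y': "y' \<in> V"
    "y' \<in> S \<longrightarrow> (\<forall>t. chart p v y' t \<in> cball 0 1 \<longrightarrow> U (chart p v y' t) = x)"
    using AE_open_exists[OF ae] by blast
  then have "U (chart p v y' t) = x" by (simp add: V_def)
  with y'(1) show False by (simp add: V_def)
qed

lemma chart_horizontal: "chart \<i> 1 y x = Complex x y"
  by (simp add: chart_def complex_eq_iff)

text \<open>Chords over \<open>S\<close> lie in the fibre; perpendicular lines that cross one of
  them lie in it as well, among these the diameter at \<open>t = 0\<close>; and every chord of the
  original direction meets that diameter.\<close>

lemma strip_spreads:
  assumes um: "unimodular p v" "unimodular v p" and nrm: "\<And>y t. (norm (chart p v y t))\<^sup>2 = y\<^sup>2 + t\<^sup>2"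
    and v: "norm v = 1" "norm p = 1" and sw: "\<And>y t. chart v p t y = chart p v y t"
    and S: "open S" "S \<subseteq> {-1<..<1}" "S \<noteq> {}"
    and hit: "\<And>y. y \<in> S \<Longrightarrow> \<exists>t. chart p v y t \<in> cball 0 1 \<and> U (chart p v y t) = x"
    and w: "chart p v y t \<in> ball 0 1"
  shows "U (chart p v y t) = x"
proof -
  have S': "U (chart p v y t) = x" if "y \<in> S" "chart p v y t \<in> ball 0 1" for y t
    using fibre_propagates[OF um(1) nrm v(1) S(1) hit that] .
  obtain y1 where y1: "y1 \<in> S" using S(3) by blast
  then have "y1 \<in> {-1<..<1}" using S(2) by blast
  then have y12: "y1\<^sup>2 < 1" using abs_square_less_1[of y1] by (simp add: abs_less_iff)
  have inball: "chart p v y t \<in> ball 0 1 \<longleftrightarrow> y\<^sup>2 + t\<^sup>2 < 1" for y t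
    using abs_square_less_1[of "norm (chart p v y t)"] nrm[of y t] by simp
  \<comment> \<open>Parameters of the perpendicular lines that cross the chord at \<open>y1\<close>
    inside the disc; 0 belongs to \<open>T\<close> because \<open>y1\<close> lies strictly between
    -1 and 1.\<close>
  define T where "T = {t :: real. t\<^sup>2 < 1 - y1\<^sup>2}"
  have T: "open T" "T \<subseteq> {-1<..<1}" "0 \<in> T"
  proof -
    show "open T" unfolding T_def by (intro open_Collect_less continuous_intros)
    show "T \<subseteq> {-1<..<1}"
    proof
      fix t assume "t \<in> T"
      then have "t\<^sup>2 < 1 - y1\<^sup>2" by (simp add: T_def)
      also have "\<dots> \<le> 1" by simp
      finally have "\<bar>t\<bar> < 1" by (simp only: abs_square_less_1)
      then show "t \<in> {-1<..<1}" by auto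
    qed
    show "0 \<in> T" using y12 by (simp add: T_def)
  qed
  have T': "U (chart p v y t) = x" if "t \<in> T" "chart p v y t \<in> ball 0 1" for y t
  proof -
    have "U (chart v p t y) = x"
    proof (rule fibre_propagates[OF um(2) _ v(2) T(1)])
      show "(norm (chart v p y t))\<^sup>2 = y\<^sup>2 + t\<^sup>2" for y t using nrm[of t y] by (simp add: sw)
      show "\<exists>y. chart v p t y \<in> cball 0 1 \<and> U (chart v p t y) = x" if "t \<in> T" for t
      proof (intro exI conjI)
        have b: "chart p v y1 t \<in> ball 0 1" using that unfolding inball T_def by simp
        then show "chart v p t y1 \<in> cball 0 1" by (simp add: sw)
        show "U (chart v p t y1) = x" using S'[OF y1 b] by (simp add: sw)
      qed
    qed (use that in \<open>simp_all add: sw\<close>)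
    then show ?thesis by (simp add: sw)
  qed
  show ?thesis
  proof (rule fibre_propagates[OF um(1) nrm v(1), of "{-1<..<1}"])
    show "\<exists>t. chart p v y t \<in> cball 0 1 \<and> U (chart p v y t) = x" if "y \<in> {-1<..<1}" for y
    proof (intro exI conjI)
      have "y\<^sup>2 < 1" using that abs_square_less_1[of y] by (simp add: abs_less_iff)
      then have b: "chart p v y 0 \<in> ball 0 1" unfolding inball by simp
      then show "chart p v y 0 \<in> cball 0 1" by simp
      show "U (chart p v y 0) = x" by (rule T'[OF T(3) b])
    qed
    have "y\<^sup>2 < 1" using w zero_le_power2[of t] unfolding inball by linarith
    then show "y \<in> {-1<..<1}" using abs_square_less_1[of y] by (simp add: abs_less_iff)
  qed (use w in auto)
qed

lemma between_interval:
  assumes "a \<in> {-1..1}" "b \<in> {-1..1}" "a \<noteq> (b::real)"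
  shows "open {min a b<..<max a b}" "{min a b<..<max a b} \<subseteq> {-1<..<1}" "{min a b<..<max a b} \<noteq> {}"
  using assms by (auto simp: min_def max_def)

text \<open>Two points of a fibre differ in real or imaginary part, and by connectedness the
  corresponding projection of the fibre contains an open interval of lines that meet it. Then
  \<open>strip_spreads\<close> makes \<open>U\<close> constant on the open disc, and continuity on
  the closed one.\<close>

theorem inj_on_disc:
  assumes ne: "\<exists>z\<in>cball 0 1. \<exists>w\<in>cball 0 1. U z \<noteq> U w"
  shows "inj_on U (cball 0 1)"
proof (rule inj_onI, rule ccontr)
  fix a b assume ab: "a \<in> cball 0 1" "b \<in> cball 0 1" "U a = U b" "a \<noteq> b"
  define x where "x = U a"
  define E where "E = {z \<in> cball 0 1. U z = x}"
  have E: "connected E" "a \<in> E" "b \<in> E" using fibres ab by (auto simp: E_def x_def)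
  have hitE: "\<exists>q\<in>E. f q = y" if f: "continuous_on UNIV f" and y: "y \<in> {min (f a) (f b)<..<max (f a) (f b)}" for f :: "complex \<Rightarrow> real" and y
  proof -
    have "connected (f ` E)"
      by (rule connected_continuous_image[OF continuous_on_subset[OF f subset_UNIV] E(1)])
    moreover have "f a \<in> f ` E" "f b \<in> f ` E" using E by auto
    ultimately have "y \<in> f ` E"
      using y connectedD_interval[of "f ` E" "f a" "f b" y] connectedD_interval[of "f ` E" "f b" "f a" y]
      by (auto simp: min_def max_def split: if_splits)
    then show ?thesis by blast
  qed
  have Ux: "U w = x" if w: "w \<in> ball 0 1" for w
  proof -
    have nV: "(norm (Complex y t))\<^sup>2 = y\<^sup>2 + t\<^sup>2" for y t by (simp add: cmod_power2)
    have rng: "Re q \<in> {-1..1}" "Im q \<in> {-1..1}" if "q \<in> cball 0 1" for q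
      using that abs_Re_le_cmod[of q] abs_Im_le_cmod[of q] by (auto simp: abs_le_iff)
    consider "Re a \<noteq> Re b" | "Im a \<noteq> Im b" using ab(4) by (auto simp: complex_eq_iff)
    then show ?thesis
    proof cases
      case 1
      have "U (chart 1 \<i> (Re w) (Im w)) = x"
      proof (rule strip_spreads[OF unimodular_vertical unimodular_horizontal])
        show "\<exists>t. chart 1 \<i> y t \<in> cball 0 1 \<and> U (chart 1 \<i> y t) = x" if y: "y \<in> {min (Re a) (Re b)<..<max (Re a) (Re b)}" for y
        proof -
          obtain q where "q \<in> E" "Re q = y" using hitE[OF continuous_on_Re[OF continuous_on_id] y] by auto
          then show ?thesis by (intro exI[of _ "Im q"]) (auto simp: chart_vertical E_def)
        qed
      qed (use between_interval[OF rng(1)[OF ab(1)] rng(1)[OF ab(2)] 1] w in \<open>auto simp: chart_vertical chart_horizontal nV\<close>)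
      then show ?thesis by (simp add: chart_vertical)
    next
      case 2
      have "U (chart \<i> 1 (Im w) (Re w)) = x"
      proof (rule strip_spreads[OF unimodular_horizontal unimodular_vertical])
        show "\<exists>t. chart \<i> 1 y t \<in> cball 0 1 \<and> U (chart \<i> 1 y t) = x" if y: "y \<in> {min (Im a) (Im b)<..<max (Im a) (Im b)}" for y
        proof -
          obtain q where "q \<in> E" "Im q = y" using hitE[OF continuous_on_Im[OF continuous_on_id] y] by auto
          then show ?thesis by (intro exI[of _ "Re q"]) (auto simp: chart_horizontal E_def)
        qed
      qed (use between_interval[OF rng(2)[OF ab(1)] rng(2)[OF ab(2)] 2] w in \<open>auto simp: chart_vertical chart_horizontal nV\<close>)
      then show ?thesis by (simp add: chart_horizontal)
    qed
  qed
  have "U w = x" if "w \<in> cball 0 1" for w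
  proof -
    have "closed {w. U w = x}"
      using cont_U by (intro closed_Collect_eq continuous_intros)
    moreover have "ball 0 1 \<subseteq> {w. U w = x}" using Ux by auto
    ultimately have "closure (ball 0 1) \<subseteq> {w. U w = x}" by (rule closure_minimal[rotated])
    then show ?thesis using that by auto
  qed
  then show False using ne by metis
qed

end

section \<open>Extension to the plane and conclusion\<close>

theorem theorem6p2:
  fixes u :: "complex \<Rightarrow> 'a::{metric_space, complete_space}"
    and L Q :: real
  assumes "L > 0"
    and "\<forall>x::'a. \<forall>r>0. hausdorff2 dist (ball x r) \<le> ennreal (L * r ^ 2)"
    and "continuous_on (cball 0 1) u"
    and "\<forall>y. connected {z \<in> cball 0 1. u z = y}"
    and "\<exists>z\<in>cball 0 1. \<exists>w\<in>cball 0 1. u z \<noteq> u w"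
    and "newton_sobolev_12 (ball 0 1) u"
    and "Q \<ge> 1"
    and "infinitesimally_qc Q (ball 0 1) u"
  shows "\<exists>v. homeomorphism (cball 0 1) (u ` cball 0 1) u v"
proof -
  \<comment> \<open>The nearest-point retraction onto the closed disc extends \<open>u\<close>
    continuously to the plane without changing fibres or derivatives in the disc.\<close>
  define U where "U z = u (closest_point (cball 0 1) z)" for z
  have Uu: "U z = u z" if "z \<in> cball 0 1" for z
    using that by (simp add: U_def closest_point_self)
  have Uu': "U z = u z" if "z \<in> ball 0 1" for z using that by (intro Uu) simp
  have contU: "continuous_on UNIV U"
    unfolding U_def
  proof (rule continuous_on_compose2[OF assms(3)])
    show "continuous_on UNIV (closest_point (cball (0::complex) 1))"
      by (intro continuous_on_closest_point) auto
    show "closest_point (cball 0 1) ` UNIV \<subseteq> cball (0::complex) 1"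
    proof (rule image_subsetI)
      show "closest_point (cball 0 1) z \<in> cball 0 1" for z :: complex
        by (rule closest_point_in_set) auto
    qed
  qed
  obtain g where g: "minimal_weak_upper_gradient (ball 0 1) u g"
    and qc: "AE z in lborel. z \<in> ball 0 1 \<longrightarrow>
           (\<forall>s. ap_md (ball 0 1) u z s \<longrightarrow> g z ^ 2 \<le> ennreal Q * jacobian_J s)"
    using assms(8) unfolding infinitesimally_qc_def by (elim exE conjE)
  have wug: "weak_upper_gradient (ball 0 1) u g" and L2: "(\<integral>\<^sup>+ z\<in>ball 0 1. g z ^ 2 \<partial>lborel) < \<infinity>"
    using g by (auto simp: minimal_weak_upper_gradient_def L2_on_def)
  have [measurable]: "g \<in> borel_measurable borel" using wug by (simp add: weak_upper_gradient_def)
  \<comment> \<open>Replacing infinite values of \<open>g\<close> by 0 affects only a null set in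
    the disc, since \<open>g\<close> is square integrable there; line integrals change on almost no
    line.\<close>
  define \<gamma> where "\<gamma> z = indicator (ball 0 1) z * enn2real (g z)" for z
  have g\<gamma>: "ennreal (\<gamma> z) \<le> g z * indicator (ball 0 1) z" for z
    by (cases "g z") (auto simp: \<gamma>_def indicator_def)
  have "AE z in lborel. g z ^ 2 * indicator (ball 0 1) z \<noteq> \<infinity>"
    using L2 by (intro nn_integral_PInf_AE) auto
  then have fin: "AE z in lborel. z \<in> ball 0 1 \<longrightarrow> g z = ennreal (\<gamma> z)"
  proof eventually_elim
    case (elim z)
    show ?case
    proof
      assume z: "z \<in> ball 0 1"
      then have "g z \<noteq> top" using elim by (auto simp: power2_eq_square)
      then show "g z = ennreal (\<gamma> z)" using z by (simp add: \<gamma>_def less_top)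
    qed
  qed
  interpret qc_map U \<gamma> L Q
  proof
    show "continuous_on UNIV U" by (rule contU)
    show "\<gamma> \<in> borel_measurable borel" unfolding \<gamma>_def by measurable
    show "0 \<le> \<gamma> z" for z by (simp add: \<gamma>_def)
    show "\<gamma> z = 0" if "z \<notin> ball 0 1" for z using that by (simp add: \<gamma>_def)
    have "(\<integral>\<^sup>+ z. ennreal (\<gamma> z) ^ 2 \<partial>lborel) \<le> (\<integral>\<^sup>+ z\<in>ball 0 1. g z ^ 2 \<partial>lborel)"
    proof (rule nn_integral_mono)
      fix z
      have "ennreal (\<gamma> z) ^ 2 \<le> (g z * indicator (ball 0 1) z) ^ 2" by (intro power_mono g\<gamma>) simp
      then show "ennreal (\<gamma> z) ^ 2 \<le> g z ^ 2 * indicator (ball 0 1) z"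
        by (auto simp: indicator_def split: if_splits)
    qed
    then show "(\<integral>\<^sup>+ z. ennreal (\<gamma> z) ^ 2 \<partial>lborel) < \<infinity>" using L2 by (rule le_less_trans)
    show "AE y in lborel. \<forall>a b. a \<le> b \<longrightarrow> (\<forall>t\<in>{a..b}. chart p v y t \<in> ball 0 1) \<longrightarrow>
      ennreal (dist (U (chart p v y a)) (U (chart p v y b)))
        \<le> (\<integral>\<^sup>+ t\<in>{a..b}. ennreal (norm v * \<gamma> (chart p v y t)) \<partial>lborel)" if um: "unimodular p v" for p v
    proof -
      have "emeasure lborel (ball (0::complex) 1) < \<infinity>" using emeasure_lborel_ball_finite[of "0::complex" 1] by simp
      from weak_upper_gradient_lines[OF wug um _ this] AE_chart[OF um fin]
      have "AE y in lborel. (\<forall>a b. a \<le> b \<longrightarrow> (\<forall>t\<in>{a..b}. chart p v y t \<in> ball 0 1) \<longrightarrow>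
          ennreal (dist (u (chart p v y a)) (u (chart p v y b))) \<le> (\<integral>\<^sup>+ t\<in>{a..b}. ennreal (norm v) * g (chart p v y t) \<partial>lborel))
        \<and> (AE t in lborel. chart p v y t \<in> ball 0 1 \<longrightarrow> g (chart p v y t) = ennreal (\<gamma> (chart p v y t)))"
        by (intro AE_conjI) simp_all
      then show ?thesis
      proof (eventually_elim, intro allI impI)
        fix y a b :: real
        assume h: "(\<forall>a b. a \<le> b \<longrightarrow> (\<forall>t\<in>{a..b}. chart p v y t \<in> ball 0 1) \<longrightarrow>
          ennreal (dist (u (chart p v y a)) (u (chart p v y b))) \<le> (\<integral>\<^sup>+ t\<in>{a..b}. ennreal (norm v) * g (chart p v y t) \<partial>lborel))
        \<and> (AE t in lborel. chart p v y t \<in> ball 0 1 \<longrightarrow> g (chart p v y t) = ennreal (\<gamma> (chart p v y t)))"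
          and ab: "a \<le> b" and seg: "\<forall>t\<in>{a..b}. chart p v y t \<in> ball 0 1"
        have "chart p v y a \<in> ball 0 1" "chart p v y b \<in> ball 0 1"
          using bspec[OF seg, of a] bspec[OF seg, of b] ab by simp_all
        then have "ennreal (dist (U (chart p v y a)) (U (chart p v y b))) = ennreal (dist (u (chart p v y a)) (u (chart p v y b)))"
          by (simp only: Uu')
        also have "\<dots> \<le> (\<integral>\<^sup>+ t\<in>{a..b}. ennreal (norm v) * g (chart p v y t) \<partial>lborel)"
          by (rule h[THEN conjunct1, rule_format, OF ab bspec[OF seg]])
        also have "\<dots> = (\<integral>\<^sup>+ t\<in>{a..b}. ennreal (norm v * \<gamma> (chart p v y t)) \<partial>lborel)"
        proof (rule nn_integral_cong_AE, use h[THEN conjunct2] in eventually_elim)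
          fix t assume "chart p v y t \<in> ball 0 1 \<longrightarrow> g (chart p v y t) = ennreal (\<gamma> (chart p v y t))"
          then show "ennreal (norm v) * g (chart p v y t) * indicator {a..b} t
              = ennreal (norm v * \<gamma> (chart p v y t)) * indicator {a..b} t"
            using seg by (cases "t \<in> {a..b}") (auto simp: ennreal_mult')
        qed
        finally show "ennreal (dist (U (chart p v y a)) (U (chart p v y b)))
          \<le> (\<integral>\<^sup>+ t\<in>{a..b}. ennreal (norm v * \<gamma> (chart p v y t)) \<partial>lborel)" .
      qed
    qed
    show "0 < L" "1 \<le> Q" using assms by auto
    show "hausdorff2 dist (ball x r :: 'a set) \<le> ennreal (L * r\<^sup>2)" if "0 < r" for x r
      using assms(2) that by blast
    have "{z \<in> cball 0 1. U z = y} = {z \<in> cball 0 1. u z = y}" for y using Uu by auto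
    then show "connected {z \<in> cball 0 1. U z = y}" for y using assms(4) by simp
    show "AE z in lborel. z \<in> ball 0 1 \<longrightarrow>
      (\<forall>s. ap_md (ball 0 1) U z s \<longrightarrow> ennreal (\<gamma> z) ^ 2 \<le> ennreal Q * jacobian_J s)"
      using qc
    proof (eventually_elim, intro impI allI)
      fix z s assume h: "z \<in> ball 0 1 \<longrightarrow> (\<forall>s. ap_md (ball 0 1) u z s \<longrightarrow> g z ^ 2 \<le> ennreal Q * jacobian_J s)"
        and z: "z \<in> ball 0 1" and md: "ap_md (ball 0 1) U z s"
      \<comment> \<open>The approximate metric derivative only samples points of the open disc,
        where \<open>U\<close> and \<open>u\<close> coincide.\<close>
      have "{y \<in> ball 0 1 \<inter> ball z r. \<epsilon> * norm (y - z) < \<bar>dist (U y) (U z) - s (y - z)\<bar>}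
          = {y \<in> ball 0 1 \<inter> ball z r. \<epsilon> * norm (y - z) < \<bar>dist (u y) (u z) - s (y - z)\<bar>}" for r \<epsilon>
        using Uu' z by auto
      then have "ap_md (ball 0 1) U z s \<longleftrightarrow> ap_md (ball 0 1) u z s" unfolding ap_md_def by (simp only:)
      with md have "ap_md (ball 0 1) u z s" by (rule iffD1[rotated])
      with h z have "g z ^ 2 \<le> ennreal Q * jacobian_J s" by blast
      moreover have "ennreal (\<gamma> z) ^ 2 \<le> g z ^ 2" using g\<gamma>[of z] z by (intro power_mono) simp_all
      ultimately show "ennreal (\<gamma> z) ^ 2 \<le> ennreal Q * jacobian_J s" by (rule order_trans[rotated])
    qed
  qed
  have "inj_on U (cball 0 1)" using assms(5) Uu by (intro inj_on_disc) metis
  then have "inj_on u (cball 0 1)" using inj_on_cong[of "cball 0 1" U u, OF Uu] by blast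
  then show ?thesis
    using homeomorphism_compact[OF compact_cball assms(3) refl] by metis
qed

end
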